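(* Let $\Gamma=(X,\mathcal E)$ be Tutte's 8-cage (the distance-regular graph with $30$ vertices and intersection array $\{3,2,2,2;1,1,1,3\}$); the spectrum of its adjacency matrix $A$ is $3^12^90^{10}(-2)^9(-3)^1$. Let $x\in X$ and $T=T(x)$. Order the three vertices of $\Gamma_1(x)$ arbitrarily. Order $\Gamma_2(x)$ as $y_1,\dots,y_6$, $\Gamma_3(x)$ as $z_1,\dots,z_{12}$ and $\Gamma_4(x)$ as $w_1,\dots,w_8$ so that: each of the pairs $\{y_1,y_2\},\{y_3,y_4\},\{y_5,y_6\}$ has a common neighbor in $\Gamma_1(x)$; $z_{2j-1},z_{2j}$ are the neighbors of $y_j$ in $\Gamma_3(x)$ for $1\le j\le6$; the neighbor sets of $w_1,w_4,w_5,w_8$ are, in some order, $\{z_1,z_5,z_9\},\{z_2,z_8,z_{12}\},\{z_3,z_7,z_{10}\},\{z_4,z_6,z_{11}\}$; and the neighbor sets of $w_2,w_3,w_6,w_7$ are, in some order, $\{z_2,z_6,z_{10}\},\{z_1,z_7,z_{11}\},\{z_4,z_8,z_9\},\{z_3,z_5,z_{12}\}$. Then the standard module $V=\mathbb C^X$ is an orthogonal direct sum of irreducible $T$-modules $V=W_0\oplus W_{1,a}\oplus W_{1,b}\oplus W_{2,a}\oplus W_{2,b}\oplus W_{2,c}\oplus W_{3,a}\oplus W_{3,b}\oplus W_{3,c}\oplus W_{3,d}\oplus W_{3,e}\oplus W_{3,f}\oplus W_4$, where two summands are isomorphic if and only if they have the same type in the following list, and the data are as listed. Each listed basis is a pure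 basis of the module. For each summand other than $W_0$, the seed vector $\nu$ spans $E_r^*W$ (so $\dim E_r^*W=1$), where $r$ is the endpoint of the summand $W$, and is given by its essential part. Type I ($W_0$): endpoint 0, multiplicity 1, dimension 5, diameter 4, shape $(1,1,1,1,1)$; basis $e_0^*,\dots,e_4^*$; matrix representing $A$: $\begin{pmatrix}0&3&0&0&0\\1&0&2&0&0\\0&1&0&2&0\\0&0&1&0&2\\0&0&0&3&0\end{pmatrix}$, with eigenvalues $3,2,0,-2,-3$. Type II ($W_{1,a},W_{1,b}$): endpoint 1, multiplicity 2, dimension 3, diameter 2, shape $(1,1,1)$; basis $\nu,A\nu,E_3^*A^2\nu$ (with $A\nu=E_2^*A\nu$), where $\nu=[1,-1,0]$ for $W_{1,a}$ and $\nu=[1,1,-2]$ for $W_{1,b}$; matrix representing $A$: $\begin{pmatrix}0&2&0\\1&0&2\\0&1&0\end{pmatrix}$, with eigenvalues $2,0,-2$. Type III ($W_{2,a},W_{2,b},W_{2,c}$): endpoint 2, multiplicity 3, dimension 3, diameter 2, shape $(1,1,1)$; basis $\nu,A\nu,E_4^*A^2\nu$ (with $A\nu=E_3^*A\nu$), where $\nu=[1,-1,0,0,0,0]$ for $W_{2,a}$, $\nu=[0,0,1,-1,0,0]$ for $W_{2,b}$, $\nu=[0,0,0,0,1,-1]$ for $W_{2,c}$; matrix representing $A$: $\begin{pmatrix}0&2&0\\1&0&2\\0&1&0\end{pmatrix}$. Type IV ($W_{3,a},W_{3,b},W_{3,c}$): endpoint 3, multiplicity 3, dimension 1, diameter 0,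 shape $(1)$; basis $\nu$, where $W_{3,a}$: $\nu=[2,-2,0,0,-1,1,-1,1,-1,1,-1,1]$; $W_{3,b}$: $\nu=[0,0,2,-2,-1,1,-1,1,1,-1,1,-1]$; $W_{3,c}$: $\nu=[0,0,0,0,-1,1,1,-1,1,-1,-1,1]$; matrix representing $A$: $\begin{pmatrix}0\end{pmatrix}$, with eigenvalue $0$. Type V ($W_{3,d},W_{3,e},W_{3,f}$): endpoint 3, multiplicity 3, dimension 2, diameter 1, shape $(1,1)$; basis $\nu,A\nu$ (with $A\nu=E_4^*A\nu$), where $W_{3,d}$: $\nu=[-1,1,-1,1,-1,1,-1,1,0,0,0,0]$; $W_{3,e}$: $\nu=[-1,1,1,-1,-1,1,1,-1,-2,2,0,0]$; $W_{3,f}$: $\nu=[-1,1,1,-1,1,-1,-1,1,0,0,-2,2]$; matrix representing $A$: $\begin{pmatrix}0&4\\1&0\end{pmatrix}$, with eigenvalues $2,-2$. Type VI ($W_4$): endpoint 4, multiplicity 1, dimension 1, diameter 0, shape $(1)$; basis $\nu$, where $\nu=[1,-1,-1,1,1,-1,-1,1]$; matrix representing $A$: $\begin{pmatrix}0\end{pmatrix}$. Moreover $\dim T=5^2+3^2+3^2+1^2+2^2+1^2=49$.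
   Context: Let $\Gamma=(X,\mathcal E)$ be a finite undirected connected graph without loops or multiple edges, with path-length distance $d$ and diameter $D\ge1$; put $\Gamma_i(x)=\{y\in X:d(x,y)=i\}$. $\Gamma$ is distance-regular if for all $0\le h,i,j\le D$ the number $p^h_{i,j}=|\Gamma_i(y)\cap\Gamma_j(z)|$ is the same for all $y,z\in X$ with $d(y,z)=h$. Its intersection array is $\{b_0,\dots,b_{D-1};c_1,\dots,c_D\}$ with $b_i=p^i_{1,i+1}$, $c_i=p^i_{1,i-1}$. $A\in\mathrm{Mat}_X(\mathbb C)$ is the adjacency matrix; in its spectrum, exponents denote multiplicities. The standard module $V=\mathbb C^X$ (column vectors) carries the Hermitian inner product $\langle u,v\rangle=u^t\bar v$. Fix a base vertex $x\in X$. For $0\le i\le D$, $E_i^*=E_i^*(x)$ is the diagonal matrix with $(y,y)$-entry $1$ if $d(x,y)=i$ and $0$ otherwise, and $e_i^*\in V$ is the vector with $y$-entry $1$ if $d(x,y)=i$ and $0$ otherwise. The Terwilliger algebra $T=T(x)$ is the subalgebra of $\mathrm{Mat}_X(\mathbb C)$ generated by $A$ and $E_0^*,\dots,E_D^*$. A $T$-module is a subspace $W\subseteq V$ with $BW\subseteq W$ for all $B\in T$; it is irreducible if $W\ne0$ and it properly contains no nonzero $T$-module. Isomorphisms of $T$-modules are vector space isomorphisms commuting with every $B\in T$. The endpoint of $W$ is $r=\min\{i:E_i^*W\ne0\}$; the diameter of an irreducible $W$ is $\delta=|\{i:E_i^*W\ne0\}|-1$, and its shape is $(\dim E_r^*W,\dots,\dim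 E_{r+\delta}^*W)$. The multiplicity of an irreducible module is the number of summands isomorphic to it in an orthogonal decomposition of $V$ into irreducible $T$-modules. A nonzero vector is pure with support $i$ if it lies in $E_i^*V$; its essential part is the row vector of its coordinates at the vertices of $\Gamma_i(x)$, in the chosen order (all its other coordinates are $0$). A pure basis of an irreducible $T$-module is an ordered basis of pure vectors with weakly increasing supports. The matrix $B$ representing $A$ with respect to a basis $v_1,\dots,v_\ell$ is given by $Av_j=\sum_iB_{ij}v_i$. *)

theory Defs
  imports "HOL-Analysis.Analysis" "Jordan_Normal_Form.Char_Poly"
begin

text \<open>
  Graphs live on a finite vertex type \<open>'v\<close> and are given by their adjacency relation.  The
  standard module is \<open>complex ^ 'v\<close> and \<open>complex ^ 'v ^ 'v\<close> is the full matrix algebra.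
  Only the small matrices representing the adjacency matrix on a module (whose size
  varies from module to module) are matrices in the sense of \<open>Jordan_Normal_Form\<close>.
\<close>

no_notation Matrix.vec_index (infixl \<open>$\<close> 100)

section \<open>Distance-regular graphs\<close>

definition simple_graph :: "('v \<Rightarrow> 'v \<Rightarrow> bool) \<Rightarrow> bool" where
  "simple_graph adj \<longleftrightarrow> symp adj \<and> irreflp adj"

definition connected_graph :: "('v \<Rightarrow> 'v \<Rightarrow> bool) \<Rightarrow> bool" where
  "connected_graph adj \<longleftrightarrow> (\<forall>y z. adj\<^sup>*\<^sup>* y z)"

definition gdist :: "('v \<Rightarrow> 'v \<Rightarrow> bool) \<Rightarrow> 'v \<Rightarrow> 'v \<Rightarrow> nat" where
  "gdist adj y z = (LEAST n. (adj ^^ n) y z)"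

definition gdiameter :: "('v::finite \<Rightarrow> 'v \<Rightarrow> bool) \<Rightarrow> nat" where
  "gdiameter adj = Max {gdist adj y z | y z. True}"

definition gsphere :: "('v \<Rightarrow> 'v \<Rightarrow> bool) \<Rightarrow> nat \<Rightarrow> 'v \<Rightarrow> 'v set" where
  "gsphere adj i y = {z. gdist adj y z = i}"

definition distance_regular :: "('v::finite \<Rightarrow> 'v \<Rightarrow> bool) \<Rightarrow> bool" where
  "distance_regular adj \<longleftrightarrow>
     simple_graph adj \<and> connected_graph adj \<and> gdiameter adj \<ge> 1 \<and>
     (\<forall>h \<le> gdiameter adj. \<forall>i \<le> gdiameter adj. \<forall>j \<le> gdiameter adj. \<exists>p. \<forall>y z.
        gdist adj y z = h \<longrightarrow> card (gsphere adj i y \<inter> gsphere adj j z) = p)"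

definition intersection_number :: "('v::finite \<Rightarrow> 'v \<Rightarrow> bool) \<Rightarrow> nat \<Rightarrow> nat \<Rightarrow> nat \<Rightarrow> nat" where
  "intersection_number adj h i j =
     (THE p. \<forall>y z. gdist adj y z = h \<longrightarrow> card (gsphere adj i y \<inter> gsphere adj j z) = p)"

definition intersection_array :: "('v::finite \<Rightarrow> 'v \<Rightarrow> bool) \<Rightarrow> nat list \<times> nat list" where
  "intersection_array adj =
     (map (\<lambda>i. intersection_number adj i 1 (i + 1)) [0..<gdiameter adj],
      map (\<lambda>i. intersection_number adj i 1 (i - 1)) [1..<gdiameter adj + 1])"

definition neighbors :: "('v \<Rightarrow> 'v \<Rightarrow> bool) \<Rightarrow> 'v \<Rightarrow> 'v set" where
  "neighbors adj y = {z. adj y z}"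


section \<open>Adjacency matrix, standard module and Terwilliger algebra\<close>

definition adj_matrix :: "('v::finite \<Rightarrow> 'v \<Rightarrow> bool) \<Rightarrow> complex ^ 'v ^ 'v" where
  "adj_matrix adj = (\<chi> y z. if adj y z then 1 else 0)"

definition hermitian_inner :: "complex ^ 'v::finite \<Rightarrow> complex ^ 'v \<Rightarrow> complex" where
  "hermitian_inner u v = (\<Sum>y\<in>UNIV. u $ y * cnj (v $ y))"

definition eigenspace :: "complex ^ 'v::finite ^ 'v \<Rightarrow> complex \<Rightarrow> (complex ^ 'v) set" where
  "eigenspace M \<theta> = {v. M *v v = \<theta> *s v}"

definition dual_idempotent ::
    "('v::finite \<Rightarrow> 'v \<Rightarrow> bool) \<Rightarrow> 'v \<Rightarrow> nat \<Rightarrow> complex ^ 'v ^ 'v" where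
  "dual_idempotent adj x i = (\<chi> y z. if y = z \<and> gdist adj x y = i then 1 else 0)"

definition sphere_vector :: "('v::finite \<Rightarrow> 'v \<Rightarrow> bool) \<Rightarrow> 'v \<Rightarrow> nat \<Rightarrow> complex ^ 'v" where
  "sphere_vector adj x i = (\<chi> y. if gdist adj x y = i then 1 else 0)"

text \<open>The componentwise \<open>*s\<close> on \<open>complex ^ 'v ^ 'v\<close> is not multiplication by a complex scalar.\<close>

definition cmat_scale :: "complex \<Rightarrow> complex ^ 'v::finite ^ 'v \<Rightarrow> complex ^ 'v ^ 'v" where
  "cmat_scale c M = (\<chi> y z. c * M $ y $ z)"

global_interpretation cmat: vector_space cmat_scale
  by unfold_locales
    (simp_all add: cmat_scale_def Finite_Cartesian_Product.vec_eq_iff algebra_simps)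

definition matrix_subalgebra :: "(complex ^ 'v::finite ^ 'v) set \<Rightarrow> bool" where
  "matrix_subalgebra S \<longleftrightarrow>
     cmat.subspace S \<and> Finite_Cartesian_Product.mat 1 \<in> S \<and> (\<forall>M\<in>S. \<forall>N\<in>S. M ** N \<in> S)"

definition terwilliger_algebra ::
    "('v::finite \<Rightarrow> 'v \<Rightarrow> bool) \<Rightarrow> 'v \<Rightarrow> (complex ^ 'v ^ 'v) set" where
  "terwilliger_algebra adj x =
     matrix_subalgebra hull
       ({adj_matrix adj} \<union> dual_idempotent adj x ` {0..gdiameter adj})"


section \<open>Modules\<close>

definition is_module :: "(complex ^ 'v::finite ^ 'v) set \<Rightarrow> (complex ^ 'v) set \<Rightarrow> bool" where
  "is_module T W \<longleftrightarrow> vec.subspace W \<and> (\<forall>B\<in>T. \<forall>w\<in>W. B *v w \<in> W)"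

definition irreducible_module ::
    "(complex ^ 'v::finite ^ 'v) set \<Rightarrow> (complex ^ 'v) set \<Rightarrow> bool" where
  "irreducible_module T W \<longleftrightarrow>
     is_module T W \<and> W \<noteq> {0} \<and> \<not> (\<exists>U. is_module T U \<and> U \<noteq> {0} \<and> U \<subset> W)"

definition module_isomorphic ::
    "(complex ^ 'v::finite ^ 'v) set \<Rightarrow> (complex ^ 'v) set \<Rightarrow> (complex ^ 'v) set \<Rightarrow> bool" where
  "module_isomorphic T W U \<longleftrightarrow>
     (\<exists>\<phi>. bij_betw \<phi> W U \<and>
          (\<forall>v\<in>W. \<forall>w\<in>W. \<phi> (v + w) = \<phi> v + \<phi> w) \<and>
          (\<forall>c. \<forall>w\<in>W. \<phi> (c *s w) = c *s \<phi> w) \<and>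
          (\<forall>B\<in>T. \<forall>w\<in>W. \<phi> (B *v w) = B *v \<phi> w))"

text \<open>
  Uniqueness of the summands is not required separately: it follows from orthogonality.
\<close>

definition orthogonal_direct_sum ::
    "'k set \<Rightarrow> ('k \<Rightarrow> (complex ^ 'v::finite) set) \<Rightarrow> bool" where
  "orthogonal_direct_sum I W \<longleftrightarrow>
     finite I \<and> (\<forall>k\<in>I. vec.subspace (W k)) \<and>
     (\<forall>k\<in>I. \<forall>l\<in>I. k \<noteq> l \<longrightarrow> (\<forall>u\<in>W k. \<forall>v\<in>W l. hermitian_inner u v = 0)) \<and>
     (\<forall>v. \<exists>f. (\<forall>k\<in>I. f k \<in> W k) \<and> v = (\<Sum>k\<in>I. f k))"

definition irreducible_decomposition ::
    "(complex ^ 'v::finite ^ 'v) set \<Rightarrow> (complex ^ 'v) set set \<Rightarrow> bool" where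
  "irreducible_decomposition T \<D> \<longleftrightarrow>
     orthogonal_direct_sum \<D> (\<lambda>U. U) \<and> (\<forall>U\<in>\<D>. irreducible_module T U)"

text \<open>The multiplicity must not depend on the decomposition used to compute it.\<close>

definition has_multiplicity ::
    "(complex ^ 'v::finite ^ 'v) set \<Rightarrow> (complex ^ 'v) set \<Rightarrow> nat \<Rightarrow> bool" where
  "has_multiplicity T W m \<longleftrightarrow>
     (\<exists>\<D>. irreducible_decomposition T \<D>) \<and>
     (\<forall>\<D>. irreducible_decomposition T \<D> \<longrightarrow> card {U\<in>\<D>. module_isomorphic T U W} = m)"

definition module_component ::
    "('v::finite \<Rightarrow> 'v \<Rightarrow> bool) \<Rightarrow> 'v \<Rightarrow> nat \<Rightarrow> (complex ^ 'v) set \<Rightarrow> (complex ^ 'v) set" where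
  "module_component adj x i W = (\<lambda>w. dual_idempotent adj x i *v w) ` W"

definition module_supports ::
    "('v::finite \<Rightarrow> 'v \<Rightarrow> bool) \<Rightarrow> 'v \<Rightarrow> (complex ^ 'v) set \<Rightarrow> nat set" where
  "module_supports adj x W = {i. i \<le> gdiameter adj \<and> module_component adj x i W \<noteq> {0}}"

definition module_endpoint ::
    "('v::finite \<Rightarrow> 'v \<Rightarrow> bool) \<Rightarrow> 'v \<Rightarrow> (complex ^ 'v) set \<Rightarrow> nat" where
  "module_endpoint adj x W = Min (module_supports adj x W)"

definition module_diameter ::
    "('v::finite \<Rightarrow> 'v \<Rightarrow> bool) \<Rightarrow> 'v \<Rightarrow> (complex ^ 'v) set \<Rightarrow> nat" where
  "module_diameter adj x W = card (module_supports adj x W) - 1"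

definition module_shape ::
    "('v::finite \<Rightarrow> 'v \<Rightarrow> bool) \<Rightarrow> 'v \<Rightarrow> (complex ^ 'v) set \<Rightarrow> nat list" where
  "module_shape adj x W =
     map (\<lambda>i. vec.dim (module_component adj x i W))
       [module_endpoint adj x W ..< module_endpoint adj x W + module_diameter adj x W + 1]"

definition pure_vector ::
    "('v::finite \<Rightarrow> 'v \<Rightarrow> bool) \<Rightarrow> 'v \<Rightarrow> nat \<Rightarrow> complex ^ 'v \<Rightarrow> bool" where
  "pure_vector adj x i v \<longleftrightarrow>
     i \<le> gdiameter adj \<and> v \<noteq> 0 \<and> v \<in> module_component adj x i UNIV"

text \<open>The vertices of a sphere of size \<open>n\<close> are enumerated as \<open>f 1, \<dots>, f n\<close>.\<close>

definition essential_part :: "(nat \<Rightarrow> 'v::finite) \<Rightarrow> nat \<Rightarrow> complex ^ 'v \<Rightarrow> complex list" where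
  "essential_part f n v = map (\<lambda>k. v $ f k) [1..<n + 1]"

definition pure_basis ::
    "('v::finite \<Rightarrow> 'v \<Rightarrow> bool) \<Rightarrow> 'v \<Rightarrow> (complex ^ 'v) set \<Rightarrow> (complex ^ 'v) list \<Rightarrow> bool" where
  "pure_basis adj x W bs \<longleftrightarrow>
     distinct bs \<and> vec.independent (set bs) \<and> vec.span (set bs) = W \<and>
     (\<exists>ss. sorted ss \<and> list_all2 (pure_vector adj x) ss bs)"

definition representing_matrix ::
    "complex ^ 'v::finite ^ 'v \<Rightarrow> (complex ^ 'v) list \<Rightarrow> complex Matrix.mat \<Rightarrow> bool" where
  "representing_matrix M bs B \<longleftrightarrow>
     B \<in> carrier_mat (length bs) (length bs) \<and>
     (\<forall>j<length bs. M *v (bs ! j) = (\<Sum>i<length bs. B $$ (i, j) *s bs ! i))"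

definition square_matrix :: "complex list list \<Rightarrow> complex Matrix.mat" where
  "square_matrix rs = mat_of_rows_list (length rs) rs"

definition module_data ::
    "('v::finite \<Rightarrow> 'v \<Rightarrow> bool) \<Rightarrow> 'v \<Rightarrow> (complex ^ 'v) set \<Rightarrow>
     nat \<Rightarrow> nat \<Rightarrow> nat \<Rightarrow> nat \<Rightarrow> nat list \<Rightarrow> (complex ^ 'v) list \<Rightarrow> complex Matrix.mat \<Rightarrow> bool" where
  "module_data adj x W r m n \<delta> sh bs B \<longleftrightarrow>
     module_endpoint adj x W = r \<and>
     has_multiplicity (terwilliger_algebra adj x) W m \<and>
     vec.dim W = n \<and>
     module_diameter adj x W = \<delta> \<and>
     module_shape adj x W = sh \<and>
     pure_basis adj x W bs \<and>
     representing_matrix (adj_matrix adj) bs B"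

definition seed_vector ::
    "('v::finite \<Rightarrow> 'v \<Rightarrow> bool) \<Rightarrow> 'v \<Rightarrow> (complex ^ 'v) set \<Rightarrow> complex ^ 'v \<Rightarrow> bool" where
  "seed_vector adj x W \<nu> \<longleftrightarrow>
     pure_vector adj x (module_endpoint adj x W) \<nu> \<and>
     vec.span {\<nu>} = module_component adj x (module_endpoint adj x W) W"


section \<open>Orderings of the spheres around the base vertex\<close>

text \<open>
  The two equations between sets of neighborhoods say that the neighborhoods are the listed
  sets in some order, since both sides are indexed by four elements and the four listed
  sets are pairwise distinct.
\<close>

definition tutte_ordering ::
    "('v::finite \<Rightarrow> 'v \<Rightarrow> bool) \<Rightarrow> 'v \<Rightarrow> (nat \<Rightarrow> 'v) \<Rightarrow> (nat \<Rightarrow> 'v) \<Rightarrow> (nat \<Rightarrow> 'v) \<Rightarrow> (nat \<Rightarrow> 'v) \<Rightarrow> bool" where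
  "tutte_ordering adj x u y z w \<longleftrightarrow>
     bij_betw u {1..3} (gsphere adj 1 x) \<and>
     bij_betw y {1..6} (gsphere adj 2 x) \<and>
     bij_betw z {1..12} (gsphere adj 3 x) \<and>
     bij_betw w {1..8} (gsphere adj 4 x) \<and>
     (\<forall>(i, j) \<in> {(1, 2), (3, 4), (5, 6)}.
        \<exists>v \<in> gsphere adj 1 x. adj v (y i) \<and> adj v (y j)) \<and>
     (\<forall>j \<in> {1..6}. neighbors adj (y j) \<inter> gsphere adj 3 x = {z (2 * j - 1), z (2 * j)}) \<and>
     (\<lambda>k. neighbors adj (w k)) ` {1, 4, 5, 8} =
       {{z 1, z 5, z 9}, {z 2, z 8, z 12}, {z 3, z 7, z 10}, {z 4, z 6, z 11}} \<and>
     (\<lambda>k. neighbors adj (w k)) ` {2, 3, 6, 7} =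
       {{z 2, z 6, z 10}, {z 1, z 7, z 11}, {z 4, z 8, z 9}, {z 3, z 5, z 12}}"


section \<open>Labels of the summands and of their isomorphism types\<close>

datatype module_type = TypeI | TypeII | TypeIII | TypeIV | TypeV | TypeVI

datatype summand =
  W0 | W1a | W1b | W2a | W2b | W2c | W3a | W3b | W3c | W3d | W3e | W3f | W4

fun summand_type :: "summand \<Rightarrow> module_type" where
  "summand_type W0 = TypeI"
| "summand_type W1a = TypeII"
| "summand_type W1b = TypeII"
| "summand_type W2a = TypeIII"
| "summand_type W2b = TypeIII"
| "summand_type W2c = TypeIII"
| "summand_type W3a = TypeIV"
| "summand_type W3b = TypeIV"
| "summand_type W3c = TypeIV"
| "summand_type W3d = TypeV"
| "summand_type W3e = TypeV"
| "summand_type W3f = TypeV"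
| "summand_type W4 = TypeVI"

end

(*
  A thin irreducible module is spanned by one pure vector per level, obtained from its seed by
  repeatedly applying the adjacency matrix.  Thirty pairwise orthogonal vectors of this kind, in
  thirteen ladders, decompose the standard module.  Ladders of the same type carry the same
  tridiagonal matrix, so the Terwilliger algebra lies in the span of the matrix units that act
  simultaneously on all ladders of one type.  Conversely, the unit at the bottom level of each type
  is obtained from the dual idempotents by subtracting the types of smaller endpoint, where the two
  types with endpoint 3 are told apart by going up to level 4 and back; the other units follow by
  multiplying with the adjacency matrix.  Hence the algebra has dimension 49, and the multiplicity
  of a type is the rank of its bottom unit.

  All computations take place in one fixed labelled graph.  Any graph with the given intersection
  array has this labelling because a vertex at distance 3 and a vertex not adjacent to it in the
  other color class are joined by exactly one path of length 3: the leaves of a vertex at distance 4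
  determine, by passing to siblings, another vertex at distance 4, and the absence of hexagons
  fixes all remaining adjacencies.
*)

theory Submission
  imports Defs
begin

section \<open>Hermitian inner product and orthogonal families\<close>

text \<open>\<open>T\<close> is given only as a hull, so its dimension needs two bounds: an
  induction over generators shows that every element acts by one common matrix on all ladders of a
  type, and explicit products of generators show that the units are present. The representing matrix
  alone does not identify a module: types II and III carry the same matrix and differ only by their
  endpoints. Types IV and V share the endpoint, and there the loop from level 3 to level 4 and back
  acts as 0 and as 4, the square of the eigenvalues of type V. Multiplicities are claimed for every
  orthogonal decomposition into irreducibles, not just for the explicit one. Hence the image of one
  idempotent of \<open>T\<close> is computed in both decompositions and its dimension compared. An
  ordering determines all adjacencies, but it leaves the order of the three vertices at distance 1
  free, and the vertices at distance 4 are fixed only within two classes of four. So the type II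
  seeds carry a permutation, all six of which are evaluated, while the type VI seed is constant on
  each class. The ladder lengths add up to 5 + 2*3 + 3*3 + 3*1 + 3*2 + 1 = 30, so orthogonality
  alone gives a basis.\<close>

lemma hermitian_inner_add_left: "hermitian_inner (u + v) w = hermitian_inner u w + hermitian_inner v w"
  by (simp add: hermitian_inner_def distrib_right sum.distrib)

lemma hermitian_inner_scale_left: "hermitian_inner (c *s u) w = c * hermitian_inner u w"
  by (simp add: hermitian_inner_def sum_distrib_left mult.assoc)

lemma hermitian_inner_scale_right: "hermitian_inner u (c *s w) = cnj c * hermitian_inner u w"
  by (simp add: hermitian_inner_def sum_distrib_left mult_ac)

lemma hermitian_inner_zero_left [simp]: "hermitian_inner 0 w = 0"
  by (simp add: hermitian_inner_def)

lemma hermitian_inner_zero_right [simp]: "hermitian_inner w 0 = 0"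
  by (simp add: hermitian_inner_def)

lemma hermitian_inner_sum_left:
  "hermitian_inner (\<Sum>i\<in>I. f i) w = (\<Sum>i\<in>I. hermitian_inner (f i) w)"
  by (induction I rule: infinite_finite_induct) (auto simp: hermitian_inner_add_left)

lemma hermitian_inner_commute: "hermitian_inner u v = cnj (hermitian_inner v u)"
  by (simp add: hermitian_inner_def mult.commute)

lemma hermitian_inner_eq_0_commute: "hermitian_inner u v = 0 \<longleftrightarrow> hermitian_inner v u = 0"
  by (subst hermitian_inner_commute) simp

lemma hermitian_inner_add_right: "hermitian_inner w (u + v) = hermitian_inner w u + hermitian_inner w v"
  by (simp add: hermitian_inner_def distrib_left sum.distrib)

lemma hermitian_inner_self_eq_0_iff [simp]: "hermitian_inner v v = 0 \<longleftrightarrow> v = 0"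
proof
  assume "hermitian_inner v v = 0"
  moreover have "hermitian_inner v v = complex_of_real (\<Sum>y\<in>UNIV. (cmod (v $ y))\<^sup>2)"
    by (simp only: hermitian_inner_def complex_norm_square[symmetric] of_real_sum)
  ultimately have "(\<Sum>y\<in>UNIV. (cmod (v $ y))\<^sup>2) = 0" by (simp only: of_real_eq_0_iff)
  then show "v = 0"
    by (simp add: sum_nonneg_eq_0_iff Finite_Cartesian_Product.vec_eq_iff)
qed simp

text \<open>An indexed family instead of a set, because ladder vectors and eigenvectors come with
  indices; injectivity follows, since a nonzero vector is not orthogonal to itself.\<close>

definition orthogonal_family :: "'i set \<Rightarrow> ('i \<Rightarrow> complex ^ 'v::finite) \<Rightarrow> bool" where
  "orthogonal_family I f \<longleftrightarrow> finite I \<and> (\<forall>i\<in>I. f i \<noteq> 0) \<and>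
     (\<forall>i\<in>I. \<forall>j\<in>I. i \<noteq> j \<longrightarrow> hermitian_inner (f i) (f j) = 0)"

lemma orthogonal_family_inj_on: "orthogonal_family I f \<Longrightarrow> inj_on f I"
  unfolding orthogonal_family_def inj_on_def by (metis hermitian_inner_self_eq_0_iff)

lemma orthogonal_family_independent:
  assumes "orthogonal_family I f"
  shows "vec.independent (f ` I)"
proof -
  have inj: "inj_on f I" using assms by (rule orthogonal_family_inj_on)
  have fin: "finite I" using assms by (simp add: orthogonal_family_def)
  show ?thesis
  proof (rule vec.independent_if_scalars_zero)
    show "finite (f ` I)" using fin by simp
  next
    fix c v assume s: "(\<Sum>v\<in>f ` I. c v *s v) = 0" and "v \<in> f ` I"
    then obtain i where i: "i \<in> I" "v = f i" by auto
    have "0 = hermitian_inner (\<Sum>v\<in>f ` I. c v *s v) (f i)" by (simp add: s)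
    also have "\<dots> = (\<Sum>j\<in>I. c (f j) * hermitian_inner (f j) (f i))"
      by (simp add: sum.reindex[OF inj] hermitian_inner_sum_left hermitian_inner_scale_left)
    also have "\<dots> = (\<Sum>j\<in>I. if j = i then c (f i) * hermitian_inner (f i) (f i) else 0)"
      using assms i by (intro sum.cong) (auto simp: orthogonal_family_def)
    also have "\<dots> = c (f i) * hermitian_inner (f i) (f i)" using i fin by simp
    finally show "c v = 0" using assms i by (simp add: orthogonal_family_def)
  qed
qed

text \<open>Counting replaces any rank computation: independent vectors as numerous as the dimension
  span.\<close>

lemma orthogonal_family_span_UNIV:
  fixes f :: "'i \<Rightarrow> complex ^ 'v::finite"
  assumes "orthogonal_family I f" and "card I = CARD('v)"
  shows "vec.span (f ` I) = UNIV"
proof -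
  have "vec.dim (UNIV :: (complex ^ 'v) set) \<le> card (f ` I)"
    using assms orthogonal_family_inj_on[OF assms(1)] by (simp add: card_image vec_dim_card del: vec.dim_UNIV)
  then show ?thesis
    using vec.card_ge_dim_independent[of "f ` I" UNIV] orthogonal_family_independent[OF assms(1)]
    by auto
qed

lemma orthogonal_family_expansion:
  assumes "orthogonal_family I f" and "v \<in> vec.span (f ` I)"
  shows "v = (\<Sum>i\<in>I. (hermitian_inner v (f i) / hermitian_inner (f i) (f i)) *s f i)"
  using assms(2)
proof (induction rule: vec.span_induct_alt)
  case base
  show ?case by (simp add: hermitian_inner_def)
next
  case (step c u w)
  then obtain i where i: "i \<in> I" "u = f i" by auto
  have fin: "finite I" using assms(1) by (simp add: orthogonal_family_def)
  have u: "u = (\<Sum>j\<in>I. (hermitian_inner u (f j) / hermitian_inner (f j) (f j)) *s f j)"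
  proof -
    have "(\<Sum>j\<in>I. (hermitian_inner u (f j) / hermitian_inner (f j) (f j)) *s f j)
        = (\<Sum>j\<in>I. if j = i then f i else 0)"
      using assms(1) i by (intro sum.cong) (auto simp: orthogonal_family_def)
    then show ?thesis using i fin by simp
  qed
  have "(\<Sum>j\<in>I. (hermitian_inner (c *s u + w) (f j) / hermitian_inner (f j) (f j)) *s f j)
      = c *s (\<Sum>j\<in>I. (hermitian_inner u (f j) / hermitian_inner (f j) (f j)) *s f j)
        + (\<Sum>j\<in>I. (hermitian_inner w (f j) / hermitian_inner (f j) (f j)) *s f j)"
    by (simp add: hermitian_inner_add_left hermitian_inner_scale_left add_divide_distrib
        vec.scale_left_distrib sum.distrib vec.scale_sum_right)
  also have "\<dots> = c *s u + w" using u step(2) by metis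
  finally show ?case by (rule sym)
qed


section \<open>The Terwilliger algebra and its modules\<close>

lemma matrix_subalgebra_Inter:
  "(\<And>S. S \<in> \<F> \<Longrightarrow> matrix_subalgebra S) \<Longrightarrow> matrix_subalgebra (\<Inter>\<F>)"
  unfolding matrix_subalgebra_def using cmat.subspace_Inter[of \<F>] by auto

lemma terwilliger_subalgebra: "matrix_subalgebra (terwilliger_algebra adj x)"
  unfolding terwilliger_algebra_def by (rule hull_in) (auto intro: matrix_subalgebra_Inter)

lemma adj_matrix_in_terwilliger: "adj_matrix adj \<in> terwilliger_algebra adj x"
  unfolding terwilliger_algebra_def by (rule hull_inc) simp

lemma dual_idempotent_in_terwilliger:
  "i \<le> gdiameter adj \<Longrightarrow> dual_idempotent adj x i \<in> terwilliger_algebra adj x"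
  unfolding terwilliger_algebra_def by (rule hull_inc) simp

lemma terwilliger_mult:
  "M \<in> terwilliger_algebra adj x \<Longrightarrow> N \<in> terwilliger_algebra adj x \<Longrightarrow> M ** N \<in> terwilliger_algebra adj x"
  using terwilliger_subalgebra[of adj x] by (auto simp: matrix_subalgebra_def)

lemma terwilliger_subspace: "cmat.subspace (terwilliger_algebra adj x)"
  using terwilliger_subalgebra[of adj x] by (auto simp: matrix_subalgebra_def)

lemma cmat_scale_mult_vec: "cmat_scale c M *v v = c *s (M *v v)"
  by (simp add: cmat_scale_def matrix_vector_mult_def Finite_Cartesian_Product.vec_eq_iff
      sum_distrib_left mult.assoc)

lemma matrix_vector_mult_sum_left: "(\<Sum>i\<in>I. M i) *v v = (\<Sum>i\<in>I. M i *v v)"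
  by (induction I rule: infinite_finite_induct) (auto simp: matrix_vector_mult_add_rdistrib)

lemma terwilliger_induct [consumes 1, case_names adj dual one add scale mult]:
  assumes "B \<in> terwilliger_algebra adj x"
    and "P (adj_matrix adj)" and "\<And>i. i \<le> gdiameter adj \<Longrightarrow> P (dual_idempotent adj x i)"
    and "P (Finite_Cartesian_Product.mat 1)"
    and "\<And>M N. P M \<Longrightarrow> P N \<Longrightarrow> P (M + N)" and "\<And>c M. P M \<Longrightarrow> P (cmat_scale c M)"
    and "\<And>M N. P M \<Longrightarrow> P N \<Longrightarrow> P (M ** N)"
  shows "P B"
  using assms(1) unfolding terwilliger_algebra_def
proof (rule hull_induct)
  \<comment> \<open>A subspace contains 0, which is reached here as a zero multiple of
    \<open>adj_matrix adj\<close>.\<close>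
  have "P (cmat_scale 0 (adj_matrix adj))" using assms(2) by (rule assms(6))
  then have "P 0" by simp
  then show "matrix_subalgebra {B. P B}"
    using assms(4-7) by (simp add: matrix_subalgebra_def cmat.subspace_def)
qed (use assms(2,3) in auto)

text \<open>The matrices that leave a fixed subspace invariant form a subalgebra, so testing the
  generators is enough.\<close>

lemma is_module_terwilliger_iff:
  "is_module (terwilliger_algebra adj x) W \<longleftrightarrow> vec.subspace W \<and>
     (\<forall>w\<in>W. adj_matrix adj *v w \<in> W) \<and>
     (\<forall>i\<le>gdiameter adj. \<forall>w\<in>W. dual_idempotent adj x i *v w \<in> W)"
  (is "?L \<longleftrightarrow> ?R")
proof
  assume ?L then show ?R
    using adj_matrix_in_terwilliger dual_idempotent_in_terwilliger by (fastforce simp: is_module_def)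
next
  assume R: ?R
  have "\<forall>w\<in>W. B *v w \<in> W" if "B \<in> terwilliger_algebra adj x" for B
    using that
  proof (induction rule: terwilliger_induct)
    case (add M N) then show ?case using R by (simp add: matrix_vector_mult_add_rdistrib vec.subspace_add)
  next
    case (scale c M) then show ?case using R by (simp add: cmat_scale_mult_vec vec.subspace_scale)
  next
    case (mult M N) then show ?case by (simp add: matrix_vector_mul_assoc[symmetric])
  qed (use R in auto)
  then show ?L using R by (simp add: is_module_def)
qed

lemma dual_idempotent_mult_nth:
  "(dual_idempotent adj x i *v v) $ y = (if gdist adj x y = i then v $ y else 0)"
proof -
  have "(dual_idempotent adj x i *v v) $ y = (\<Sum>z\<in>UNIV. if z = y then (if gdist adj x y = i then v $ y else 0) else 0)"
    unfolding dual_idempotent_def matrix_vector_mult_def by (auto intro!: sum.cong simp: if_distrib[of "\<lambda>a. a * _"] cong: if_cong)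
  then show ?thesis by simp
qed

lemma dual_idempotent_dual_idempotent:
  "dual_idempotent adj x i *v (dual_idempotent adj x j *v v) =
     (if i = j then dual_idempotent adj x i *v v else 0)"
  by (auto simp: Finite_Cartesian_Product.vec_eq_iff dual_idempotent_mult_nth)

lemma hermitian_inner_different_levels:
  assumes "dual_idempotent adj x i *v u = u" "dual_idempotent adj x j *v v = v" "i \<noteq> j"
  shows "hermitian_inner u v = 0"
proof -
  have "u $ y * cnj (v $ y) = 0" for y
    using arg_cong[OF assms(1), of "\<lambda>u. u $ y"] arg_cong[OF assms(2), of "\<lambda>u. u $ y"] assms(3)
    by (auto simp: dual_idempotent_mult_nth split: if_splits)
  then show ?thesis unfolding hermitian_inner_def by (intro sum.neutral) blast
qed

text \<open>
  The sequence \<open>c\<close> is extended by zero outside \<open>lo, \<dots>, hi\<close>, so that statements about it need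
  no side conditions on the index.
\<close>

definition ladder :: "('v::finite \<Rightarrow> 'v \<Rightarrow> bool) \<Rightarrow> 'v \<Rightarrow> nat \<Rightarrow> nat \<Rightarrow> (nat \<Rightarrow> complex) \<Rightarrow>
    (nat \<Rightarrow> complex) \<Rightarrow> (nat \<Rightarrow> complex ^ 'v) \<Rightarrow> bool" where
  "ladder adj x lo hi up down c \<longleftrightarrow>
     lo \<le> hi \<and> hi \<le> gdiameter adj \<and>
     (\<forall>i. lo \<le> i \<and> i < hi \<longrightarrow> up i \<noteq> 0) \<and> (\<forall>i. lo < i \<and> i \<le> hi \<longrightarrow> down i \<noteq> 0) \<and>
     (\<forall>i. c i \<noteq> 0 \<longleftrightarrow> lo \<le> i \<and> i \<le> hi) \<and>
     (\<forall>i. dual_idempotent adj x i *v c i = c i) \<and>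
     (\<forall>i. lo \<le> i \<and> i \<le> hi \<longrightarrow>
        adj_matrix adj *v c i = up i *s c (i + 1) + (if i = lo then 0 else down i *s c (i - 1)))"

text \<open>Spanning over all indices keeps \<open>lo\<close> and \<open>hi\<close> out of the
  definition; outside these bounds the vectors of a ladder are zero.\<close>

definition ladder_space :: "(nat \<Rightarrow> complex ^ 'v::finite) \<Rightarrow> (complex ^ 'v) set" where
  "ladder_space c = vec.span (range c)"

lemma in_ladder_space [simp]: "c i \<in> ladder_space c"
  unfolding ladder_space_def by (intro vec.span_base) simp

lemma subspace_ladder_space [simp]: "vec.subspace (ladder_space c)"
  by (simp add: ladder_space_def)

context
  fixes adj :: "'v::finite \<Rightarrow> 'v \<Rightarrow> bool" and x :: 'v and lo hi up down c
  assumes ladder: "ladder adj x lo hi up down c"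
begin

lemma ladder_levels: "lo \<le> hi" "hi \<le> gdiameter adj"
  using ladder by (auto simp: ladder_def)

lemma ladder_eq_0_iff: "c i = 0 \<longleftrightarrow> \<not> (lo \<le> i \<and> i \<le> hi)"
  using ladder by (auto simp: ladder_def)

lemma ladder_dual: "dual_idempotent adj x i *v c j = (if i = j then c i else 0)"
proof -
  have "c j = dual_idempotent adj x j *v c j" using ladder by (simp add: ladder_def)
  then have "dual_idempotent adj x i *v c j = dual_idempotent adj x i *v (dual_idempotent adj x j *v c j)"
    by simp
  then show ?thesis using ladder by (auto simp: dual_idempotent_dual_idempotent ladder_def)
qed

lemma ladder_adj:
  "adj_matrix adj *v c i =
     (if lo \<le> i \<and> i \<le> hi then up i *s c (i + 1) + (if i = lo then 0 else down i *s c (i - 1)) else 0)"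
  using ladder ladder_eq_0_iff[of i] by (auto simp: ladder_def)

lemma ladder_orthogonal_family: "orthogonal_family {lo..hi} c"
  unfolding orthogonal_family_def
proof (intro conjI ballI impI)
  fix i j :: nat assume "i \<noteq> j"
  with ladder show "hermitian_inner (c i) (c j) = 0"
    by (intro hermitian_inner_different_levels[of adj x i _ j]) (auto simp: ladder_def)
qed (use ladder in \<open>auto simp: ladder_def\<close>)

lemma ladder_space_eq: "ladder_space c = vec.span (c ` {lo..hi})"
proof -
  have "insert 0 (range c) = insert 0 (c ` {lo..hi})"
    using ladder_eq_0_iff by fastforce
  then show ?thesis unfolding ladder_space_def by (metis vec.span_insert_0)
qed

lemma ladder_space_dim: "vec.dim (ladder_space c) = hi + 1 - lo"
  using ladder_orthogonal_family
  by (simp add: ladder_space_eq vec.dim_eq_card_independent orthogonal_family_independent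
      orthogonal_family_inj_on card_image)

lemma ladder_space_induct [consumes 1, case_names zero add]:
  assumes "v \<in> ladder_space c" "P 0" "\<And>a i w. P w \<Longrightarrow> w \<in> ladder_space c \<Longrightarrow> P (a *s c i + w)"
  shows "P v"
proof -
  have "v \<in> ladder_space c \<and> P v"
    using assms(1) unfolding ladder_space_def
  proof (induction rule: vec.span_induct_alt)
    case base then show ?case using assms(2) by (simp add: vec.span_zero)
  next
    case (step a u w)
    then show ?case using assms(3)
      by (metis ladder_space_def rangeE vec.span_add vec.span_base vec.span_scale)
  qed
  then show ?thesis ..
qed

text \<open>Thinness: a dual idempotent kills every rung except the one at its own level.\<close>

lemma ladder_component: "w \<in> ladder_space c \<Longrightarrow> \<exists>a. dual_idempotent adj x i *v w = a *s c i"
proof (induction rule: ladder_space_induct)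
  case zero show ?case by (rule exI[of _ 0]) simp
next
  case (add a j w)
  then obtain a' where "dual_idempotent adj x i *v w = a' *s c i" by auto
  then have "dual_idempotent adj x i *v (a *s c j + w) = (if i = j then a + a' else a') *s c i"
    by (simp add: matrix_vector_right_distrib vec.scale ladder_dual vec.scale_left_distrib)
  then show ?case by blast
qed

lemma ladder_module: "is_module (terwilliger_algebra adj x) (ladder_space c)"
  unfolding is_module_terwilliger_iff
proof (intro conjI ballI allI impI)
  fix w assume "w \<in> ladder_space c"
  then show "adj_matrix adj *v w \<in> ladder_space c"
  proof (induction rule: ladder_space_induct)
    case zero show ?case by (simp add: vec.subspace_0)
  next
    case (add a i w)
    have "adj_matrix adj *v c i \<in> ladder_space c"
      unfolding ladder_adj by (auto intro!: vec.subspace_add vec.subspace_scale vec.subspace_0)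
    with add show ?case
      by (auto simp: matrix_vector_right_distrib vec.scale intro!: vec.subspace_add vec.subspace_scale)
  qed
next
  fix i w assume "w \<in> ladder_space c"
  then show "dual_idempotent adj x i *v w \<in> ladder_space c"
    using ladder_component[of w i] by (auto intro!: vec.subspace_scale)
qed simp

text \<open>Applying the adjacency matrix to a rung and projecting to a neighboring level isolates
  the next rung with a nonzero coefficient. One rung therefore generates all others, upwards and
  downwards.\<close>

lemma ladder_submodule_contains:
  assumes U: "is_module (terwilliger_algebra adj x) U" and i: "lo \<le> i" "i \<le> hi" "c i \<in> U"
  shows "ladder_space c \<subseteq> U"
proof -
  have sub: "vec.subspace U" using U by (simp add: is_module_def)
  have step: "dual_idempotent adj x j *v (adj_matrix adj *v c k) \<in> U" if "c k \<in> U" "j \<le> gdiameter adj" for j k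
    using U that unfolding is_module_terwilliger_iff by blast
  have scale: "w \<in> U" if "a *s w \<in> U" "a \<noteq> 0" for a w
    using vec.subspace_scale[OF sub that(1), of "inverse a"] that(2) by simp
  have up: "c (i + n) \<in> U" if "i + n \<le> hi" for n
    using that
  proof (induction n)
    case (Suc n)
    then have "dual_idempotent adj x (i + n + 1) *v (adj_matrix adj *v c (i + n)) \<in> U"
      using ladder_levels by (intro step) auto
    moreover have "dual_idempotent adj x (i + n + 1) *v (adj_matrix adj *v c (i + n))
        = up (i + n) *s c (i + n + 1)"
      using Suc(2) i(1) by (simp add: ladder_adj matrix_vector_right_distrib vec.scale ladder_dual) arith
    moreover have "up (i + n) \<noteq> 0" using ladder Suc(2) i(1) by (simp add: ladder_def)
    ultimately show ?case using scale by simp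
  qed (use i in simp)
  have down: "c (i - n) \<in> U" if "lo + n \<le> i" for n
    using that
  proof (induction n)
    case (Suc n)
    define k where "k = i - n"
    have k: "lo < k" "k \<le> hi" "i - Suc n = k - 1" "c k \<in> U"
      using Suc i by (auto simp: k_def)
    have "dual_idempotent adj x (k - 1) *v (adj_matrix adj *v c k) \<in> U"
      using ladder_levels k by (intro step) auto
    moreover have "dual_idempotent adj x (k - 1) *v (adj_matrix adj *v c k) = down k *s c (k - 1)"
      using k by (simp add: ladder_adj matrix_vector_right_distrib vec.scale ladder_dual)
    moreover have "down k \<noteq> 0" using ladder k by (simp add: ladder_def)
    ultimately show ?case using scale k by simp
  qed (use i in simp)
  have "c j \<in> U" if "j \<in> {lo..hi}" for j
    using up[of "j - i"] down[of "i - j"] that i by (cases "i \<le> j") auto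
  then show ?thesis unfolding ladder_space_eq by (intro vec.span_minimal sub) auto
qed

lemma ladder_zero_if_components_zero:
  assumes "w \<in> ladder_space c" "\<And>i. i \<in> {lo..hi} \<Longrightarrow> dual_idempotent adj x i *v w = 0"
  shows "w = 0"
proof -
  have "w = (\<Sum>i\<in>{lo..hi}. dual_idempotent adj x i *v w)"
    using assms(1)
  proof (induction rule: ladder_space_induct)
    case (add a j w)
    have "(\<Sum>i\<in>{lo..hi}. dual_idempotent adj x i *v c j) = c j"
      using ladder_eq_0_iff[of j] by (auto simp: ladder_dual)
    then have "(\<Sum>i\<in>{lo..hi}. dual_idempotent adj x i *v (a *s c j)) = a *s c j"
      by (simp add: vec.scale vec.scale_sum_right[symmetric])
    with add show ?case by (simp add: matrix_vector_right_distrib sum.distrib)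
  qed simp
  then show ?thesis using assms(2) by simp
qed

text \<open>A nonzero submodule contains a nonzero component of one of its vectors; by thinness that
  component is a multiple of a rung, and a single rung generates the ladder.\<close>

lemma ladder_irreducible: "irreducible_module (terwilliger_algebra adj x) (ladder_space c)"
  unfolding irreducible_module_def
proof (intro conjI notI)
  have "c lo \<noteq> 0" using ladder by (simp add: ladder_def)
  then show "ladder_space c = {0} \<Longrightarrow> False" using in_ladder_space[of c lo] by auto
next
  assume "\<exists>U. is_module (terwilliger_algebra adj x) U \<and> U \<noteq> {0} \<and> U \<subset> ladder_space c"
  then obtain U where U: "is_module (terwilliger_algebra adj x) U" "U \<noteq> {0}" "U \<subset> ladder_space c" by blast
  have sub: "vec.subspace U" using U by (simp add: is_module_def)
  obtain w where w: "w \<in> U" "w \<noteq> 0" using U(2) vec.subspace_0[OF sub] by blast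
  then obtain i where i: "i \<in> {lo..hi}" "dual_idempotent adj x i *v w \<noteq> 0"
    using ladder_zero_if_components_zero U(3) by blast
  obtain a where a: "dual_idempotent adj x i *v w = a *s c i" using ladder_component w U(3) by blast
  have "a *s c i \<in> U"
    using U(1) w i ladder_levels unfolding is_module_terwilliger_iff a[symmetric] by auto
  moreover have "a \<noteq> 0" using a i by auto
  ultimately have "c i \<in> U" using vec.subspace_scale[OF sub, of "a *s c i" "inverse a"] by simp
  then show False using ladder_submodule_contains[OF U(1)] i U(3) by auto
qed (rule ladder_module)

lemma ladder_module_component: "module_component adj x i (ladder_space c) = vec.span {c i}"
proof -
  have "module_component adj x i (ladder_space c) = {a *s c i | a. True}"
  proof (intro equalityI subsetI)
    fix v assume "v \<in> {a *s c i | a. True}"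
    then obtain a where v: "v = a *s c i" by auto
    then have "v = dual_idempotent adj x i *v (a *s c i)" by (simp add: vec.scale ladder_dual)
    then show "v \<in> module_component adj x i (ladder_space c)"
      unfolding module_component_def by (metis image_eqI in_ladder_space subspace_ladder_space vec.subspace_scale)
  qed (use ladder_component in \<open>auto simp: module_component_def\<close>)
  then show ?thesis unfolding vec.span_singleton by blast
qed

lemma ladder_supports: "module_supports adj x (ladder_space c) = {lo..hi}"
proof -
  have "vec.span {c i} = {0} \<longleftrightarrow> c i = 0" for i
    using vec.span_base[of "c i" "{c i}"] by auto
  then show ?thesis
    using ladder_levels ladder_eq_0_iff unfolding module_supports_def ladder_module_component
    by (intro Set.set_eqI) (simp, linarith)
qed

lemma ladder_endpoint: "module_endpoint adj x (ladder_space c) = lo"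
  using ladder_levels by (auto simp: module_endpoint_def ladder_supports intro!: Min_eqI)

lemma ladder_diameter: "module_diameter adj x (ladder_space c) = hi - lo"
  using ladder_levels by (simp add: module_diameter_def ladder_supports)

lemma ladder_shape: "module_shape adj x (ladder_space c) = replicate (hi - lo + 1) 1"
proof -
  have "vec.dim (vec.span {c i}) = 1" if "i \<in> set [lo..<lo + (hi - lo) + 1]" for i
    using that ladder_levels ladder_eq_0_iff[of i] by auto
  then have "map (\<lambda>i. vec.dim (vec.span {c i})) [lo..<lo + (hi - lo) + 1] = map (\<lambda>i. 1) [lo..<lo + (hi - lo) + 1]"
    by (intro map_cong refl) auto
  then show ?thesis unfolding module_shape_def ladder_endpoint ladder_diameter ladder_module_component
    using ladder_levels(1) by (simp add: map_replicate_const Suc_diff_le del: upt_Suc)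
qed

lemma ladder_pure: "i \<in> {lo..hi} \<Longrightarrow> pure_vector adj x i (c i)"
  using ladder_levels ladder_eq_0_iff[of i] ladder_dual[of i i]
  by (auto simp: pure_vector_def module_component_def image_iff intro!: exI[of _ "c i"])

lemma ladder_pure_basis: "pure_basis adj x (ladder_space c) (map c [lo..<hi + 1])"
  unfolding pure_basis_def
proof (intro conjI)
  have s: "set [lo..<hi + 1] = {lo..hi}" by auto
  show "distinct (map c [lo..<hi + 1])"
    using orthogonal_family_inj_on[OF ladder_orthogonal_family]
    unfolding distinct_map s by auto
  show "vec.independent (set (map c [lo..<hi + 1]))"
    using orthogonal_family_independent[OF ladder_orthogonal_family] unfolding set_map s .
  show "vec.span (set (map c [lo..<hi + 1])) = ladder_space c"
    unfolding ladder_space_eq set_map s ..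
  show "\<exists>ss. sorted ss \<and> list_all2 (pure_vector adj x) ss (map c [lo..<hi + 1])"
    by (rule exI[of _ "[lo..<hi + 1]"]) (auto simp: list_all2_conv_all_nth ladder_pure simp del: upt_Suc)
qed

lemma ladder_seed: "seed_vector adj x (ladder_space c) (c lo)"
  using ladder_levels by (simp add: seed_vector_def ladder_endpoint ladder_pure ladder_module_component)

end

text \<open>The isomorphism sends each rung of \<open>c\<close> to the rung of \<open>d\<close> at
  the same level. Both maps are written through orthogonal coordinates on the whole standard module,
  which makes their linearity immediate; equal coefficients make them commute with the
  generators.\<close>

lemma ladder_isomorphic:
  fixes c d :: "nat \<Rightarrow> complex ^ 'v::finite"
  assumes c: "ladder adj x lo hi up down c" and d: "ladder adj x lo hi up down d"
  shows "module_isomorphic (terwilliger_algebra adj x) (ladder_space c) (ladder_space d)"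
proof -
  define co where "co = (\<lambda>(c :: nat \<Rightarrow> complex ^ 'v) v i. hermitian_inner v (c i) / hermitian_inner (c i) (c i))"
  define \<phi> where "\<phi> = (\<lambda>v. \<Sum>i\<in>{lo..hi}. co c v i *s d i)"
  define \<psi> where "\<psi> = (\<lambda>v. \<Sum>i\<in>{lo..hi}. co d v i *s c i)"
  have co_add: "co c (v + w) i = co c v i + co c w i" for c v w i
    by (simp add: co_def hermitian_inner_add_left add_divide_distrib)
  have co_scale: "co c (a *s v) i = a * co c v i" for c v a i
    by (simp add: co_def hermitian_inner_scale_left)
  have co_ladder: "co e (e j) i = (if i = j \<and> i \<in> {lo..hi} then 1 else 0)"
    if e: "ladder adj x lo hi up down e" for e i j
    using ladder_orthogonal_family[OF e] ladder_eq_0_iff[OF e, of i] ladder_eq_0_iff[OF e, of j]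
    by (cases "i \<in> {lo..hi}"; cases "j \<in> {lo..hi}") (auto simp: co_def orthogonal_family_def)
  have \<phi>_add: "\<phi> (v + w) = \<phi> v + \<phi> w" and \<psi>_add: "\<psi> (v + w) = \<psi> v + \<psi> w" for v w
    by (simp_all add: \<phi>_def \<psi>_def co_add vec.scale_left_distrib sum.distrib)
  have \<phi>_scale: "\<phi> (a *s v) = a *s \<phi> v" and \<psi>_scale: "\<psi> (a *s v) = a *s \<psi> v" for a v
    by (simp_all add: \<phi>_def \<psi>_def co_scale vec.scale_sum_right)
  have \<phi>_c: "\<phi> (c j) = d j" and \<psi>_d: "\<psi> (d j) = c j" for j
    using ladder_eq_0_iff[OF c, of j] ladder_eq_0_iff[OF d, of j]
    by (auto simp: \<phi>_def \<psi>_def co_ladder[OF c] co_ladder[OF d] if_distrib[of "\<lambda>a. a *s _"] cong: if_cong)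
  have \<phi>_0: "\<phi> 0 = 0" and \<psi>_0: "\<psi> 0 = 0" by (simp_all add: \<phi>_def \<psi>_def co_def)
  have \<phi>_in: "\<phi> v \<in> ladder_space d" and \<psi>_in: "\<psi> v \<in> ladder_space c" for v
    by (auto simp: \<phi>_def \<psi>_def intro!: vec.subspace_sum vec.subspace_scale)
  have \<psi>\<phi>: "\<psi> (\<phi> v) = v" if "v \<in> ladder_space c" for v
    using that by (induction rule: ladder_space_induct[OF c, consumes 1])
      (simp_all add: \<phi>_add \<psi>_add \<phi>_scale \<psi>_scale \<phi>_c \<psi>_d \<phi>_0 \<psi>_0)
  have \<phi>\<psi>: "\<phi> (\<psi> v) = v" if "v \<in> ladder_space d" for v
    using that by (induction rule: ladder_space_induct[OF d, consumes 1])
      (simp_all add: \<phi>_add \<psi>_add \<phi>_scale \<psi>_scale \<phi>_c \<psi>_d \<phi>_0 \<psi>_0)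
  have bij: "bij_betw \<phi> (ladder_space c) (ladder_space d)"
    by (rule bij_betw_byWitness[where f' = \<psi>]) (use \<psi>\<phi> \<phi>\<psi> \<phi>_in \<psi>_in in auto)
  have comm: "\<phi> (B *v w) = B *v \<phi> w"
    if B: "B \<in> terwilliger_algebra adj x" and w: "w \<in> ladder_space c" for B w
  proof -
    \<comment> \<open>Invariance is carried along in the induction: for a product, the commutation
      of the left factor is applied to the image under the right one.\<close>
    have "\<forall>w\<in>ladder_space c. B *v w \<in> ladder_space c \<and> \<phi> (B *v w) = B *v \<phi> w"
      using B
    proof (induction rule: terwilliger_induct)
      case adj
      have gen: "\<phi> (adj_matrix adj *v c i) = adj_matrix adj *v d i" for i
        by (simp add: ladder_adj[OF c] ladder_adj[OF d] \<phi>_add \<phi>_scale \<phi>_c \<phi>_0)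
      have "\<phi> (adj_matrix adj *v w) = adj_matrix adj *v \<phi> w" if "w \<in> ladder_space c" for w
        using that by (induction rule: ladder_space_induct[OF c, consumes 1])
          (simp_all add: gen \<phi>_add \<phi>_scale \<phi>_c \<phi>_0 matrix_vector_right_distrib vec.scale)
      then show ?case
        using ladder_module[OF c] adj_matrix_in_terwilliger by (auto simp: is_module_def)
    next
      case (dual i)
      have gen: "\<phi> (dual_idempotent adj x i *v c j) = dual_idempotent adj x i *v d j" for j
        by (simp add: ladder_dual[OF c] ladder_dual[OF d] \<phi>_c \<phi>_0)
      have "\<phi> (dual_idempotent adj x i *v w) = dual_idempotent adj x i *v \<phi> w" if "w \<in> ladder_space c" for w
        using that by (induction rule: ladder_space_induct[OF c, consumes 1])
          (simp_all add: gen \<phi>_add \<phi>_scale \<phi>_c \<phi>_0 matrix_vector_right_distrib vec.scale)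
      then show ?case
        using ladder_module[OF c] dual_idempotent_in_terwilliger[OF dual] by (auto simp: is_module_def)
    qed (auto simp: matrix_vector_mult_add_rdistrib cmat_scale_mult_vec matrix_vector_mul_assoc[symmetric]
        \<phi>_add \<phi>_scale intro: vec.subspace_add vec.subspace_scale)
    then show ?thesis using w by blast
  qed
  show ?thesis unfolding module_isomorphic_def
    using bij \<phi>_add \<phi>_scale comm by blast
qed

text \<open>An isomorphism commutes with \<open>F\<close> and sends only 0 to 0, so it preserves the
  kernel of \<open>F\<close>. This is the invariant that tells the types apart.\<close>

lemma module_isomorphic_components:
  assumes "module_isomorphic (terwilliger_algebra adj x) W U" "0 \<in> W"
    and F: "F \<in> terwilliger_algebra adj x" and UW: "is_module (terwilliger_algebra adj x) W" 
  shows "(\<exists>w\<in>W. F *v w \<noteq> 0) \<longleftrightarrow> (\<exists>u\<in>U. F *v u \<noteq> 0)"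
proof -
  obtain \<phi> where bij: "bij_betw \<phi> W U"
    and sc: "\<And>c w. w \<in> W \<Longrightarrow> \<phi> (c *s w) = c *s \<phi> w"
    and comm: "\<And>B w. B \<in> terwilliger_algebra adj x \<Longrightarrow> w \<in> W \<Longrightarrow> \<phi> (B *v w) = B *v \<phi> w"
    using assms(1) by (auto simp: module_isomorphic_def)
  have \<phi>0: "\<phi> 0 = 0" using sc[OF assms(2), of 0] by simp
  have "F *v w = 0 \<longleftrightarrow> F *v \<phi> w = 0" if "w \<in> W" for w
  proof -
    have "F *v w \<in> W" using UW F that by (simp add: is_module_def)
    then have "F *v w = 0 \<longleftrightarrow> \<phi> (F *v w) = \<phi> 0"
      using bij assms(2) by (metis bij_betw_imp_inj_on inj_on_eq_iff)
    then show ?thesis using comm[OF F that] \<phi>0 by simp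
  qed
  then show ?thesis using bij by (auto simp: bij_betw_def)
qed

section \<open>Decompositions of the standard module into ladders\<close>

text \<open>Vectors at different levels have disjoint supports, so \<open>orth\<close> compares
  equal levels only. With \<open>count\<close>, orthogonality turns the ladder vectors into a basis.
  The bounds and coefficients depend on a summand only through its type.\<close>

locale ladder_decomposition =
  fixes adj :: "'v::finite \<Rightarrow> 'v \<Rightarrow> bool" and x :: 'v
    and tp :: "'k::finite \<Rightarrow> 't" and lo hi :: "'t \<Rightarrow> nat" and up down :: "'t \<Rightarrow> nat \<Rightarrow> complex"
    and b :: "'k \<Rightarrow> nat \<Rightarrow> complex ^ 'v"
  assumes ladder_b: "ladder adj x (lo (tp k)) (hi (tp k)) (up (tp k)) (down (tp k)) (b k)"
    and orth: "k \<noteq> l \<Longrightarrow> hermitian_inner (b k i) (b l i) = 0"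
    and count: "(\<Sum>k\<in>UNIV. hi (tp k) + 1 - lo (tp k)) = CARD('v)"
begin

abbreviation "lev t \<equiv> {lo t..hi t}"

abbreviation "T \<equiv> terwilliger_algebra adj x"

definition idx :: "('k \<times> nat) set" where "idx = (SIGMA k:UNIV. lev (tp k))"

lemma finite_idx: "finite idx" by (simp add: idx_def)

lemma card_idx: "card idx = CARD('v)"
  unfolding idx_def by (subst card_SigmaI) (auto simp: count[simplified])

lemma b_eq_0_iff: "b k i = 0 \<longleftrightarrow> i \<notin> lev (tp k)"
  using ladder_eq_0_iff[OF ladder_b] by simp

lemma inner_b: "(k, i) \<noteq> (l, j) \<Longrightarrow> hermitian_inner (b k i) (b l j) = 0"
proof (cases "i = j")
  case False
  show ?thesis
    by (rule hermitian_inner_different_levels[OF _ _ False, of adj x]) (simp_all add: ladder_dual[OF ladder_b])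
qed (use orth in auto)

lemma orthogonal_family_b: "orthogonal_family idx (case_prod b)"
  unfolding orthogonal_family_def using inner_b by (auto simp: finite_idx b_eq_0_iff) (auto simp: idx_def)

lemma span_b: "vec.span (case_prod b ` idx) = UNIV"
  by (rule orthogonal_family_span_UNIV[OF orthogonal_family_b card_idx])

lemma vec_induct_b:
  assumes "P 0" "\<And>a k i w. i \<in> lev (tp k) \<Longrightarrow> P w \<Longrightarrow> P (a *s b k i + w)"
  shows "P v"
proof -
  have "v \<in> vec.span (case_prod b ` idx)" by (simp add: span_b)
  then show ?thesis
    by (induction rule: vec.span_induct_alt) (use assms in \<open>auto simp: idx_def\<close>)
qed

lemma matrix_eqI_b:
  fixes M N :: "complex ^ 'v ^ 'v"
  assumes "\<And>k i. i \<in> lev (tp k) \<Longrightarrow> M *v b k i = N *v b k i"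
  shows "M = N"
proof -
  have "M *v v = N *v v" for v
    by (induction v rule: vec_induct_b) (simp_all add: matrix_vector_right_distrib vec.scale assms)
  then show ?thesis by (simp add: matrix_eq)
qed

lemma orthogonal_direct_sum_b: "orthogonal_direct_sum UNIV (\<lambda>k. ladder_space (b k))"
  unfolding orthogonal_direct_sum_def
proof (intro conjI ballI impI allI)
  fix k l u v assume kl: "k \<noteq> (l :: 'k)" and u: "u \<in> ladder_space (b k)" and v: "v \<in> ladder_space (b l)"
  have "hermitian_inner (b k i) v = 0" for i
    using v
  proof (induction rule: ladder_space_induct[OF ladder_b, consumes 1, case_names zero add])
    case (add a j w)
    then show ?case
      using inner_b[of k i l j] kl
      by (simp add: hermitian_inner_add_right hermitian_inner_scale_right)
  qed simp
  with u show "hermitian_inner u v = 0"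
    by (induction rule: ladder_space_induct[OF ladder_b, consumes 1, case_names zero add])
      (simp_all add: hermitian_inner_add_left hermitian_inner_scale_left)
next
  fix v :: "complex ^ 'v"
  show "\<exists>f. (\<forall>k\<in>UNIV. f k \<in> ladder_space (b k)) \<and> v = (\<Sum>k\<in>UNIV. f k)"
  proof (induction v rule: vec_induct_b)
    case 1
    show ?case by (rule exI[of _ "\<lambda>_. 0"]) (simp add: vec.subspace_0)
  next
    case (2 a k i w)
    then obtain f where f: "\<And>k. f k \<in> ladder_space (b k)" "w = (\<Sum>k\<in>UNIV. f k)" by auto
    show ?case
    proof (rule exI[of _ "\<lambda>l. (if l = k then a *s b k i else 0) + f l"], intro conjI ballI)
      fix l
      show "(if l = k then a *s b k i else 0) + f l \<in> ladder_space (b l)"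
        using f(1) by (auto intro!: vec.subspace_add vec.subspace_scale)
    qed (simp add: f(2) sum.distrib)
  qed
qed auto

definition coord :: "'k \<Rightarrow> nat \<Rightarrow> complex ^ 'v \<Rightarrow> complex" where
  "coord k i v = hermitian_inner v (b k i) / hermitian_inner (b k i) (b k i)"

lemma coord_b: "coord k i (b l j) = (if k = l \<and> i = j \<and> i \<in> lev (tp k) then 1 else 0)"
  using inner_b[of l j k i] by (auto simp: coord_def b_eq_0_iff)

text \<open>A matrix unit acting simultaneously on all summands of type \<open>t\<close>.\<close>

definition unit :: "'t \<Rightarrow> nat \<Rightarrow> nat \<Rightarrow> complex ^ 'v ^ 'v" where
  "unit t i j = (\<chi> u v. \<Sum>k\<in>{k. tp k = t}. b k i $ u * cnj (b k j $ v) / hermitian_inner (b k j) (b k j))"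

lemma unit_mult_vec: "unit t i j *v v = (\<Sum>k\<in>{k. tp k = t}. coord k j v *s b k i)"
proof -
  have "(unit t i j *v v) $ u = (\<Sum>k\<in>{k. tp k = t}. coord k j v * b k i $ u)" for u
  proof -
    have "(unit t i j *v v) $ u =
      (\<Sum>w\<in>UNIV. \<Sum>k\<in>{k. tp k = t}. b k i $ u * cnj (b k j $ w) / hermitian_inner (b k j) (b k j) * v $ w)"
      by (simp add: unit_def matrix_vector_mult_def sum_distrib_right)
    also have "\<dots> = (\<Sum>k\<in>{k. tp k = t}. \<Sum>w\<in>UNIV. b k i $ u * cnj (b k j $ w) / hermitian_inner (b k j) (b k j) * v $ w)"
      by (rule sum.swap)
    also have "\<dots> = (\<Sum>k\<in>{k. tp k = t}. coord k j v * b k i $ u)"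
    proof (rule sum.cong[OF refl])
      fix k
      have "coord k j v * b k i $ u = (\<Sum>w\<in>UNIV. (v $ w * cnj (b k j $ w)) * (b k i $ u / hermitian_inner (b k j) (b k j)))"
        unfolding coord_def hermitian_inner_def[of v] sum_divide_distrib sum_distrib_right by simp
      then show "(\<Sum>w\<in>UNIV. b k i $ u * cnj (b k j $ w) / hermitian_inner (b k j) (b k j) * v $ w) = coord k j v * b k i $ u"
        by (simp add: mult_ac)
    qed
    finally show ?thesis .
  qed
  then show ?thesis by (simp add: Finite_Cartesian_Product.vec_eq_iff)
qed

lemma unit_b:
  "unit t i j *v b l n = (if tp l = t \<and> n = j \<and> j \<in> lev t then b l i else 0)"
proof -
  have "unit t i j *v b l n = (\<Sum>k\<in>{k. tp k = t}. if k = l then (if n = j \<and> j \<in> lev t then b l i else 0) else 0)"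
    unfolding unit_mult_vec by (rule sum.cong) (auto simp: coord_b)
  then show ?thesis by simp
qed

lemma unit_eqI:
  assumes "\<And>k n. n \<in> lev (tp k) \<Longrightarrow> M *v b k n = (if tp k = t \<and> n = j then b k i else 0)"
  shows "M = unit t i j"
  by (rule matrix_eqI_b) (auto simp: assms unit_b)

definition comb :: "'t \<Rightarrow> ('k \<Rightarrow> complex) \<Rightarrow> nat \<Rightarrow> complex ^ 'v" where
  "comb t \<alpha> i = (\<Sum>k\<in>{k. tp k = t}. \<alpha> k *s b k i)"

lemma coord_zero: "coord k i 0 = 0"
  by (simp add: coord_def)

lemma coord_sum: "coord k i (\<Sum>a\<in>A. f a) = (\<Sum>a\<in>A. coord k i (f a))"
  by (simp add: coord_def hermitian_inner_sum_left sum_divide_distrib)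

lemma coord_scale: "coord k i (a *s v) = a * coord k i v"
  by (simp add: coord_def hermitian_inner_scale_left)

lemma coord_comb:
  assumes "tp k = t" "i \<in> lev t"
  shows "coord k i (comb t \<alpha> i) = \<alpha> k"
proof -
  have "coord k i (comb t \<alpha> i) = (\<Sum>l\<in>{l. tp l = t}. if l = k then \<alpha> k else 0)"
    unfolding comb_def coord_sum by (rule sum.cong) (use assms in \<open>auto simp: coord_scale coord_b\<close>)
  then show ?thesis using assms by simp
qed

text \<open>Ladders of one type obey the same linear relations, so a combination with the same
  coefficients at every level obeys them too. Later every irreducible module of type
  \<open>t\<close>, in any decomposition, is recognized as such a combination.\<close>

lemma ladder_comb:
  assumes k: "tp k = t" "\<alpha> k \<noteq> 0"
  shows "ladder adj x (lo t) (hi t) (up t) (down t) (comb t \<alpha>)"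
  unfolding ladder_def
proof (intro conjI allI impI)
  have l: "ladder adj x (lo t) (hi t) (up t) (down t) (b k)" using ladder_b[of k] k by simp
  show "lo t \<le> hi t" "hi t \<le> gdiameter adj" using ladder_levels[OF l] by auto
  show "lo t \<le> i \<and> i < hi t \<Longrightarrow> up t i \<noteq> 0" "lo t < i \<and> i \<le> hi t \<Longrightarrow> down t i \<noteq> 0" for i
    using l by (auto simp: ladder_def)
  show "comb t \<alpha> i \<noteq> 0 \<longleftrightarrow> lo t \<le> i \<and> i \<le> hi t" for i
  proof
    assume "comb t \<alpha> i \<noteq> 0"
    then have "\<exists>k\<in>{k. tp k = t}. \<alpha> k *s b k i \<noteq> 0"
      unfolding comb_def by (meson sum.neutral)
    then show "lo t \<le> i \<and> i \<le> hi t" using b_eq_0_iff by fastforce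
  next
    assume "lo t \<le> i \<and> i \<le> hi t"
    then have "coord k i (comb t \<alpha> i) \<noteq> 0" using coord_comb[OF k(1)] k(2) by simp
    then show "comb t \<alpha> i \<noteq> 0" by (auto simp: coord_def)
  qed
  show "dual_idempotent adj x i *v comb t \<alpha> i = comb t \<alpha> i" for i
    by (simp add: comb_def vec.sum vec.scale ladder_dual[OF ladder_b])
  fix i assume i: "lo t \<le> i \<and> i \<le> hi t"
  have "adj_matrix adj *v comb t \<alpha> i = (\<Sum>k\<in>{k. tp k = t}. \<alpha> k *s (up t i *s b k (i + 1) + (if i = lo t then 0 else down t i *s b k (i - 1))))"
    unfolding comb_def vec.sum vec.scale using i by (intro sum.cong) (auto simp: ladder_adj[OF ladder_b])
  then show "adj_matrix adj *v comb t \<alpha> i =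
      up t i *s comb t \<alpha> (i + 1) + (if i = lo t then 0 else down t i *s comb t \<alpha> (i - 1))"
    by (simp add: comb_def vec.scale_right_distrib sum.distrib vec.scale_sum_right mult.commute)
qed

text \<open>Multiplying from the left by a dual idempotent after the adjacency matrix raises the row
  index of a unit, at the cost of a factor \<open>up\<close>; the mirrored product on the right
  raises the column index, at the cost of a factor \<open>down\<close>. Both factors are nonzero
  inside the ladder, so everything grows out of the bottom unit.\<close>

lemma unit_in_T:
  assumes t: "t \<in> range tp" and lo: "unit t (lo t) (lo t) \<in> T" and i: "i \<in> lev t" and j: "j \<in> lev t"
  shows "unit t i j \<in> T"
proof -
  obtain k where k: "tp k = t" using t by auto
  have l: "ladder adj x (lo t) (hi t) (up t) (down t) (b k)" using ladder_b[of k] k by simp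
  have scaled: "M \<in> T" if "cmat_scale a M \<in> T" "a \<noteq> 0" for a M
    using cmat.subspace_scale[OF terwilliger_subspace that(1), of "inverse a"] that(2) by simp
  have col: "unit t (lo t + n) (lo t) \<in> T" if "lo t + n \<le> hi t" for n
    using that
  proof (induction n)
    case (Suc n)
    let ?i = "lo t + n"
    have "dual_idempotent adj x (?i + 1) ** adj_matrix adj ** unit t ?i (lo t) = cmat_scale (up t ?i) (unit t (?i + 1) (lo t))"
      using Suc(2)
      by (intro matrix_eqI_b)
        (auto simp: matrix_vector_mul_assoc[symmetric] cmat_scale_mult_vec unit_b ladder_adj[OF ladder_b]
          ladder_dual[OF ladder_b] matrix_vector_right_distrib vec.scale)
    moreover have "dual_idempotent adj x (?i + 1) ** adj_matrix adj ** unit t ?i (lo t) \<in> T"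
      using Suc ladder_levels[OF l]
      by (intro terwilliger_mult dual_idempotent_in_terwilliger adj_matrix_in_terwilliger) auto
    moreover have "up t ?i \<noteq> 0" using l Suc(2) by (simp add: ladder_def)
    ultimately show ?case using scaled by simp
  qed (use lo in simp)
  have row: "unit t i (lo t + n) \<in> T" if "lo t + n \<le> hi t" for n
    using that
  proof (induction n)
    case 0
    then show ?case using col[of "i - lo t"] i by simp
  next
    case (Suc n)
    let ?j = "lo t + n"
    have "unit t i ?j ** adj_matrix adj ** dual_idempotent adj x (?j + 1) = cmat_scale (down t (?j + 1)) (unit t i (?j + 1))"
      using Suc(2)
      by (intro matrix_eqI_b)
        (auto simp: matrix_vector_mul_assoc[symmetric] cmat_scale_mult_vec unit_b ladder_adj[OF ladder_b]
          ladder_dual[OF ladder_b] matrix_vector_right_distrib vec.scale)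
    moreover have "unit t i ?j ** adj_matrix adj ** dual_idempotent adj x (?j + 1) \<in> T"
      using Suc ladder_levels[OF l]
      by (intro terwilliger_mult dual_idempotent_in_terwilliger adj_matrix_in_terwilliger) auto
    moreover have "down t (?j + 1) \<noteq> 0" using l Suc(2) by (simp add: ladder_def)
    ultimately show ?case using scaled by simp
  qed
  show ?thesis using row[of "j - lo t"] j by simp
qed

end

text \<open>
  The units at the bottom level separate the types; once they lie in the Terwilliger algebra,
  so do all units, and they form a basis of it.
\<close>

locale separated_ladders = ladder_decomposition +
  assumes unit_lo: "t \<in> range tp \<Longrightarrow> unit t (lo t) (lo t) \<in> terwilliger_algebra adj x"
begin

text \<open>The bottom unit of a type acts nontrivially on the ladders of that type and as 0 on all
  others.\<close>

lemma ladder_b_isomorphic_iff: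
  "module_isomorphic T (ladder_space (b k)) (ladder_space (b l)) \<longleftrightarrow> tp k = tp l"
proof
  assume "tp k = tp l"
  then show "module_isomorphic T (ladder_space (b k)) (ladder_space (b l))"
    using ladder_b[of k] ladder_b[of l] by (auto intro: ladder_isomorphic)
next
  assume iso: "module_isomorphic T (ladder_space (b k)) (ladder_space (b l))"
  let ?F = "unit (tp k) (lo (tp k)) (lo (tp k))"
  have "lo (tp k) \<in> lev (tp k)" using ladder_levels[OF ladder_b[of k]] by simp
  then have "?F *v b k (lo (tp k)) \<noteq> 0" by (simp add: unit_b b_eq_0_iff)
  then have "\<exists>w\<in>ladder_space (b k). ?F *v w \<noteq> 0" using in_ladder_space by blast
  then have "\<exists>u\<in>ladder_space (b l). ?F *v u \<noteq> 0"
    by (subst module_isomorphic_components[OF iso vec.subspace_0 unit_lo ladder_module[OF ladder_b], symmetric]) simp_all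
  then obtain u where u: "u \<in> ladder_space (b l)" "?F *v u \<noteq> 0" by blast
  show "tp k = tp l"
  proof (rule ccontr)
    assume "tp k \<noteq> tp l"
    with u(1) have "?F *v u = 0"
      by (induction rule: ladder_space_induct[OF ladder_b, consumes 1])
        (simp_all add: matrix_vector_right_distrib vec.scale unit_b)
    with u(2) show False by simp
  qed
qed

text \<open>\<open>irreducible_decomposition\<close> speaks of a set of subspaces, so the family
  must be shown injective: two equal summands with different indices would be orthogonal to
  themselves.\<close>

lemma irreducible_decomposition_b: "irreducible_decomposition T (range (\<lambda>k. ladder_space (b k)))"
proof -
  let ?W = "\<lambda>k. ladder_space (b k)"
  have orthW: "hermitian_inner u v = 0" if "u \<in> ?W k" "v \<in> ?W l" "k \<noteq> l" for u v k l
    using orthogonal_direct_sum_b that unfolding orthogonal_direct_sum_def by blast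
  have inj: "inj ?W"
  proof (rule injI, rule ccontr)
    fix k l assume *: "?W k = ?W l" "k \<noteq> l"
    have "b k (lo (tp k)) \<noteq> 0" using ladder_levels[OF ladder_b[of k]] by (simp add: b_eq_0_iff)
    then have "hermitian_inner (b k (lo (tp k))) (b k (lo (tp k))) \<noteq> 0" by simp
    moreover have "b k (lo (tp k)) \<in> ?W l" using *(1) by (metis in_ladder_space)
    ultimately show False using orthW[of "b k (lo (tp k))" k "b k (lo (tp k))" l] *(2) by simp
  qed
  have inv: "inv_into UNIV ?W (?W k) = k" for k by (rule inv_f_f[OF inj])
  have "\<exists>f. (\<forall>U\<in>range ?W. f U \<in> U) \<and> v = (\<Sum>U\<in>range ?W. f U)" for v
  proof -
    obtain f where f: "\<And>k. f k \<in> ?W k" "v = (\<Sum>k\<in>UNIV. f k)"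
      using orthogonal_direct_sum_b unfolding orthogonal_direct_sum_def by (metis UNIV_I)
    then show ?thesis
      by (intro exI[of _ "\<lambda>U. f (inv_into UNIV ?W U)"]) (simp add: sum.reindex[OF inj] inv)
  qed
  moreover have "\<forall>U\<in>range ?W. \<forall>U'\<in>range ?W. U \<noteq> U' \<longrightarrow> (\<forall>u\<in>U. \<forall>v\<in>U'. hermitian_inner u v = 0)"
    using orthW by blast
  ultimately have "orthogonal_direct_sum (range ?W) (\<lambda>U. U)"
    unfolding orthogonal_direct_sum_def by auto
  then show ?thesis
    unfolding irreducible_decomposition_def using ladder_irreducible[OF ladder_b] by auto
qed

text \<open>
  The number of summands of type \<open>t\<close> in an arbitrary decomposition is the rank of the
  bottom unit of that type.
\<close>

lemma multiplicity_b: "has_multiplicity T (ladder_space (b k)) (card {l. tp l = tp k})"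
  unfolding has_multiplicity_def
proof (intro conjI allI impI)
  show "\<exists>\<D>. irreducible_decomposition T \<D>" using irreducible_decomposition_b by blast
next
  fix \<D> assume D: "irreducible_decomposition T \<D>"
  define t where "t = tp k"
  define F where "F = unit t (lo t) (lo t)"
  have F: "F \<in> T" unfolding F_def t_def by (rule unit_lo) simp
  have lev: "lo t \<in> lev t" using ladder_levels[OF ladder_b[of k]] by (simp add: t_def)
  have F_comb: "F *v v = comb t (\<lambda>l. coord l (lo t) v) (lo t)" for v
    by (simp add: F_def unit_mult_vec comb_def)
  define S where "S = {U \<in> \<D>. module_isomorphic T U (ladder_space (b k))}"
  have irr: "irreducible_module T U" and modU: "is_module T U" and subU: "vec.subspace U" if "U \<in> \<D>" for U
    using D that unfolding irreducible_decomposition_def irreducible_module_def is_module_def by auto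
  \<comment> \<open>If \<open>F\<close> does not kill \<open>u\<close>, then \<open>F *v u\<close>
    is the bottom rung of the combination whose coefficients are the bottom coordinates of
    \<open>u\<close>. Its ladder space lies in \<open>U\<close>, hence equals \<open>U\<close> by
    irreducibility.\<close>
  have core: "ladder adj x (lo t) (hi t) (up t) (down t) (comb t (\<lambda>l. coord l (lo t) u)) \<and>
      ladder_space (comb t (\<lambda>l. coord l (lo t) u)) = U"
    if U: "U \<in> \<D>" and u: "u \<in> U" "F *v u \<noteq> 0" for U u
  proof -
    define \<alpha> where "\<alpha> = (\<lambda>l. coord l (lo t) u)"
    have v: "F *v u = comb t \<alpha> (lo t)" by (simp add: F_comb \<alpha>_def)
    have "\<exists>l\<in>{l. tp l = t}. \<alpha> l *s b l (lo t) \<noteq> 0"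
      using u(2) unfolding v comb_def by (meson sum.neutral)
    then obtain l where l: "tp l = t" "\<alpha> l \<noteq> 0" by auto
    note lc = ladder_comb[of l t \<alpha>, OF l]
    have "comb t \<alpha> (lo t) \<in> U" using modU[OF U] F u(1) unfolding is_module_def v[symmetric] by blast
    then have "ladder_space (comb t \<alpha>) \<subseteq> U"
      using ladder_submodule_contains[OF lc modU[OF U], of "lo t"] lev by simp
    moreover have "ladder_space (comb t \<alpha>) \<noteq> {0}"
      using in_ladder_space[of "comb t \<alpha>" "lo t"] u(2) unfolding v by blast
    ultimately have "ladder_space (comb t \<alpha>) = U"
      using irr[OF U] ladder_module[OF lc] unfolding irreducible_module_def by blast
    then show ?thesis using lc by (simp add: \<alpha>_def)
  qed
  \<comment> \<open>On a summand isomorphic to the given one, \<open>F\<close> is a projection of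
    rank one onto the bottom rung.\<close>
  have ex_v: "\<exists>v\<in>U. v \<noteq> 0 \<and> F *v v = v \<and> (\<forall>u\<in>U. F *v u \<in> vec.span {v})" if "U \<in> S" for U
  proof -
    have U: "U \<in> \<D>" and iso: "module_isomorphic T U (ladder_space (b k))" using that by (auto simp: S_def)
    have "F *v b k (lo t) \<noteq> 0" using lev by (simp add: F_def unit_b t_def b_eq_0_iff)
    then have "\<exists>u\<in>U. F *v u \<noteq> 0"
      using module_isomorphic_components[OF iso vec.subspace_0[OF subU[OF U]] F modU[OF U]] by auto
    then obtain u where u: "u \<in> U" "F *v u \<noteq> 0" by blast
    define c where "c = comb t (\<lambda>l. coord l (lo t) u)"
    have lc: "ladder adj x (lo t) (hi t) (up t) (down t) c" and eq: "ladder_space c = U"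
      using core[OF U u] by (auto simp: c_def)
    have Fc: "F *v c i = (if i = lo t then c i else 0)" for i
      unfolding comb_def c_def F_def vec.sum vec.scale using lev
      by (auto simp: unit_b intro!: sum.cong sum.neutral)
    have "F *v w \<in> vec.span {c (lo t)}" if "w \<in> ladder_space c" for w
      using that
    proof (induction rule: ladder_space_induct[OF lc, consumes 1, case_names zero add])
      case (add a i w)
      then show ?case
        by (auto simp: matrix_vector_right_distrib vec.scale Fc intro: vec.span_add vec.span_scale vec.span_base)
    qed (simp add: vec.span_zero)
    moreover have "c (lo t) \<noteq> 0" using ladder_eq_0_iff[OF lc] lev by simp
    moreover have "c (lo t) \<in> U" unfolding eq[symmetric] by simp
    ultimately show ?thesis using Fc[of "lo t"] by (auto simp: eq)
  qed
  \<comment> \<open>A summand on which \<open>F\<close> is nonzero is a ladder of type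
    \<open>t\<close> and so belongs to \<open>S\<close>.\<close>
  have kills: "F *v u = 0" if "U \<in> \<D>" "U \<notin> S" "u \<in> U" for U u
  proof (rule ccontr)
    assume "F *v u \<noteq> 0"
    note c = core[OF that(1,3) this]
    have "module_isomorphic T U (ladder_space (b k))"
      using ladder_isomorphic[of adj x "lo t" "hi t" "up t" "down t" _ "b k"] c ladder_b[of k] by (auto simp: t_def)
    then show False using that by (simp add: S_def)
  qed
  have "\<forall>U\<in>S. \<exists>v. v \<in> U \<and> v \<noteq> 0 \<and> F *v v = v \<and> (\<forall>u\<in>U. F *v u \<in> vec.span {v})"
    using ex_v by blast
  from bchoice[OF this] obtain vv where
    vv': "\<forall>U\<in>S. vv U \<in> U \<and> vv U \<noteq> 0 \<and> F *v vv U = vv U \<and> (\<forall>u\<in>U. F *v u \<in> vec.span {vv U})" ..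
  then have vv: "\<And>U. U \<in> S \<Longrightarrow> vv U \<in> U" "\<And>U. U \<in> S \<Longrightarrow> vv U \<noteq> 0"
      "\<And>U. U \<in> S \<Longrightarrow> F *v vv U = vv U" "\<And>U u. U \<in> S \<Longrightarrow> u \<in> U \<Longrightarrow> F *v u \<in> vec.span {vv U}"
    by blast+
  have ods: "orthogonal_direct_sum \<D> (\<lambda>U. U)" using D by (simp add: irreducible_decomposition_def)
  have orthD: "hermitian_inner u v = 0" if "U \<in> \<D>" "U' \<in> \<D>" "U \<noteq> U'" "u \<in> U" "v \<in> U'" for U U' u v
    using ods that by (simp add: orthogonal_direct_sum_def)
  have SD: "S \<subseteq> \<D>" by (auto simp: S_def)
  have of: "orthogonal_family S vv"
    unfolding orthogonal_family_def
  proof (intro conjI ballI impI)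
    show "finite S" using ods SD by (auto simp: orthogonal_direct_sum_def intro: finite_subset)
    fix U U' assume "U \<in> S" "U' \<in> S" "U \<noteq> U'"
    then show "hermitian_inner (vv U) (vv U') = 0"
      by (intro orthD[of U U']) (use vv(1) SD in auto)
  qed (rule vv(2))
  \<comment> \<open>The image of \<open>F\<close> is computed twice: one dimension from each member
    of \<open>S\<close>, and one from each explicit ladder of type \<open>t\<close>.\<close>
  have range1: "range ((*v) F) = vec.span (vv ` S)"
  proof (intro equalityI subsetI)
    fix w assume "w \<in> range ((*v) F)"
    then obtain v where w: "w = F *v v" by auto
    have "\<exists>f. (\<forall>U\<in>\<D>. f U \<in> U) \<and> v = (\<Sum>U\<in>\<D>. f U)"
      using ods by (simp add: orthogonal_direct_sum_def)
    then obtain f where "(\<forall>U\<in>\<D>. f U \<in> U) \<and> v = (\<Sum>U\<in>\<D>. f U)" ..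
    then have f: "\<And>U. U \<in> \<D> \<Longrightarrow> f U \<in> U" and fv: "v = (\<Sum>U\<in>\<D>. f U)" by auto
    have "F *v f U \<in> vec.span (vv ` S)" if "U \<in> \<D>" for U
    proof (cases "U \<in> S")
      case True
      then have "vec.span {vv U} \<subseteq> vec.span (vv ` S)" by (intro vec.span_mono) auto
      then show ?thesis using vv(4)[OF True f[OF that]] by blast
    next
      case False
      then show ?thesis using kills[OF that False f[OF that]] by (simp add: vec.span_zero)
    qed
    then show "w \<in> vec.span (vv ` S)" unfolding w fv vec.sum by (intro vec.span_sum)
  next
    fix w assume "w \<in> vec.span (vv ` S)"
    then have "F *v w = w"
    proof (induction rule: vec.span_induct_alt)
      case (step c u w)
      then show ?case using vv(3) by (auto simp: matrix_vector_right_distrib vec.scale)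
    qed simp
    then show "w \<in> range ((*v) F)" by (metis rangeI)
  qed
  have of': "orthogonal_family {l. tp l = t} (\<lambda>l. b l (lo t))"
    unfolding orthogonal_family_def using inner_b lev by (auto simp: b_eq_0_iff)
  have range2: "range ((*v) F) = vec.span ((\<lambda>l. b l (lo t)) ` {l. tp l = t})"
  proof (intro equalityI subsetI)
    fix w assume "w \<in> range ((*v) F)"
    then show "w \<in> vec.span ((\<lambda>l. b l (lo t)) ` {l. tp l = t})"
      by (auto simp: F_def unit_mult_vec intro: vec.span_sum vec.span_scale vec.span_base)
  next
    fix w assume "w \<in> vec.span ((\<lambda>l. b l (lo t)) ` {l. tp l = t})"
    then have "F *v w = w"
    proof (induction rule: vec.span_induct_alt)
      case (step c u w)
      then show ?case using lev by (auto simp: matrix_vector_right_distrib vec.scale F_def unit_b)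
    qed simp
    then show "w \<in> range ((*v) F)" by (metis rangeI)
  qed
  have "card S = vec.dim (vec.span (vv ` S))"
    using of by (simp add: vec.dim_eq_card_independent orthogonal_family_independent card_image orthogonal_family_inj_on)
  also have "\<dots> = vec.dim (vec.span ((\<lambda>l. b l (lo t)) ` {l. tp l = t}))"
    using range1 range2 by simp
  also have "\<dots> = card {l. tp l = t}"
    using of' by (simp add: vec.dim_eq_card_independent orthogonal_family_independent card_image orthogonal_family_inj_on)
  finally show "card {U \<in> \<D>. module_isomorphic T U (ladder_space (b k))} = card {l. tp l = tp k}"
    by (simp add: S_def t_def)
qed

text \<open>The coefficient matrix \<open>m\<close> is chosen before the summand, so it is shared by
  all ladders of a type. Generators have this form, and sums, multiples and products preserve it;
  this is the upper bound for the dimension.\<close>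

lemma terwilliger_on_b:
  assumes "M \<in> T"
  shows "\<exists>m. \<forall>k. \<forall>j\<in>lev (tp k). M *v b k j = (\<Sum>i\<in>lev (tp k). m (tp k) i j *s b k i)"
  using assms
proof (induction rule: terwilliger_induct)
  case adj
  have "adj_matrix adj *v b k j = (\<Sum>i\<in>lev (tp k). ((if i = j + 1 then up (tp k) j else 0) +
      (if i + 1 = j then down (tp k) j else 0)) *s b k i)" if "j \<in> lev (tp k)" for k j
  proof -
    have "(\<Sum>i\<in>lev (tp k). (if i = j + 1 then up (tp k) j else 0) *s b k i) = up (tp k) j *s b k (j + 1)"
      using b_eq_0_iff[of k "j + 1"] by (auto simp: if_distrib[of "\<lambda>a. a *s _"] cong: if_cong)
    moreover have "(\<Sum>i\<in>lev (tp k). (if i + 1 = j then down (tp k) j else 0) *s b k i)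
        = (if j = lo (tp k) then 0 else down (tp k) j *s b k (j - 1))"
    proof (cases "j = lo (tp k)")
      case False
      have "(\<Sum>i\<in>lev (tp k). (if i + 1 = j then down (tp k) j else 0) *s b k i)
          = (\<Sum>i\<in>lev (tp k). if i = j - 1 then down (tp k) j *s b k (j - 1) else 0)"
        using False that by (intro sum.cong) auto
      then show ?thesis using False that by auto
    qed (auto intro!: sum.neutral)
    ultimately show ?thesis
      using that by (simp add: ladder_adj[OF ladder_b] vec.scale_left_distrib sum.distrib)
  qed
  then show ?case by (intro exI[of _ "\<lambda>t i j. (if i = j + 1 then up t j else 0) + (if i + 1 = j then down t j else 0)"]) blast
next
  case (dual n)
  show ?case
    by (rule exI[of _ "\<lambda>t i j. if i = j \<and> j = n then 1 else 0"])
      (auto simp: ladder_dual[OF ladder_b] if_distrib[of "\<lambda>a. a *s _"] cong: if_cong intro!: sum.neutral)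
next
  case one
  show ?case
    by (rule exI[of _ "\<lambda>t i j. if i = j then 1 else 0"])
      (auto simp: if_distrib[of "\<lambda>a. a *s _"] cong: if_cong)
next
  case (add M N)
  then obtain m n where
    "\<forall>k. \<forall>j\<in>lev (tp k). M *v b k j = (\<Sum>i\<in>lev (tp k). m (tp k) i j *s b k i)"
    "\<forall>k. \<forall>j\<in>lev (tp k). N *v b k j = (\<Sum>i\<in>lev (tp k). n (tp k) i j *s b k i)" by blast
  then show ?case
    by (intro exI[of _ "\<lambda>t i j. m t i j + n t i j"])
      (simp add: matrix_vector_mult_add_rdistrib vec.scale_left_distrib sum.distrib)
next
  case (scale c M)
  then obtain m where
    "\<forall>k. \<forall>j\<in>lev (tp k). M *v b k j = (\<Sum>i\<in>lev (tp k). m (tp k) i j *s b k i)" by blast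
  then show ?case
    by (intro exI[of _ "\<lambda>t i j. c * m t i j"]) (simp add: cmat_scale_mult_vec vec.scale_sum_right)
next
  case (mult M N)
  then obtain m n where
    m: "\<forall>k. \<forall>j\<in>lev (tp k). M *v b k j = (\<Sum>i\<in>lev (tp k). m (tp k) i j *s b k i)" and
    n: "\<forall>k. \<forall>j\<in>lev (tp k). N *v b k j = (\<Sum>i\<in>lev (tp k). n (tp k) i j *s b k i)" by blast
  have "(M ** N) *v b k j = (\<Sum>i\<in>lev (tp k). (\<Sum>l\<in>lev (tp k). m (tp k) i l * n (tp k) l j) *s b k i)"
    if "j \<in> lev (tp k)" for k j
  proof -
    have "(M ** N) *v b k j = (\<Sum>l\<in>lev (tp k). n (tp k) l j *s (\<Sum>i\<in>lev (tp k). m (tp k) i l *s b k i))"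
      using that m n by (simp add: matrix_vector_mul_assoc[symmetric] vec.sum vec.scale)
    also have "\<dots> = (\<Sum>l\<in>lev (tp k). \<Sum>i\<in>lev (tp k). (m (tp k) i l * n (tp k) l j) *s b k i)"
      by (simp add: vec.scale_sum_right mult.commute)
    also have "\<dots> = (\<Sum>i\<in>lev (tp k). \<Sum>l\<in>lev (tp k). (m (tp k) i l * n (tp k) l j) *s b k i)"
      by (rule sum.swap)
    finally show ?thesis by (simp add: vec.scale_sum_left)
  qed
  then show ?case by (intro exI[of _ "\<lambda>t i j. \<Sum>l\<in>lev t. m t i l * n t l j"]) blast
qed

text \<open>The algebra is a direct sum of full matrix blocks, one for each type, whose size is the
  number of levels of that type; the units form a basis.\<close>

lemma dim_T: "cmat.dim T = (\<Sum>t\<in>range tp. (hi t + 1 - lo t)\<^sup>2)"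
proof -
  define J where "J = (SIGMA t:range tp. lev t \<times> lev t)"
  define F where "F = (\<lambda>(t, i, j). unit t i j)"
  have fin: "finite J" by (simp add: J_def)
  have unit_b': "F q *v b k j = (if fst q = tp k \<and> snd (snd q) = j then b k (fst (snd q)) else 0)"
    if "q \<in> J" for q k j
    using that by (auto simp: F_def J_def unit_b)
  have inj: "inj_on F J"
  proof (rule inj_onI)
    fix p q assume pq: "p \<in> J" "q \<in> J" "F p = F q"
    obtain t i j where p: "p = (t, i, j)" by (cases p)
    obtain t' i' j' where q: "q = (t', i', j')" by (cases q)
    obtain k where k: "tp k = t" and ij: "i \<in> lev t" "j \<in> lev t" using pq by (auto simp: J_def p)
    have 1: "F p *v b k j = b k i" by (subst unit_b'[OF pq(1)]) (auto simp: p k)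
    have 2: "F q *v b k j = (if t' = t \<and> j' = j then b k i' else 0)" by (subst unit_b'[OF pq(2)]) (auto simp: q k)
    have nz: "b k i \<noteq> 0" using ij k by (simp add: b_eq_0_iff)
    then have *: "t' = t" "j' = j" "b k i = b k i'" using 1 2 pq(3) by (auto split: if_splits)
    then have "coord k i (b k i') = 1" using coord_b[of k i k i] ij k by simp
    then show "p = q" using * by (auto simp: p q coord_b split: if_splits)
  qed
  have "cmat.dim T = card (F ` J)"
  proof (rule cmat.dim_unique[OF _ _ _ refl])
    show "F ` J \<subseteq> T" using unit_in_T[OF _ unit_lo] by (auto simp: F_def J_def)
    show "T \<subseteq> cmat.span (F ` J)"
    proof
      fix M assume "M \<in> T"
      then obtain m where m: "\<And>k j. j \<in> lev (tp k) \<Longrightarrow> M *v b k j = (\<Sum>i\<in>lev (tp k). m (tp k) i j *s b k i)"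
        using terwilliger_on_b by blast
      have "M = (\<Sum>q\<in>J. cmat_scale (case q of (t, i, j) \<Rightarrow> m t i j) (F q))"
      proof (rule matrix_eqI_b)
        fix k j assume j: "j \<in> lev (tp k)"
        let ?t = "tp k"
        have "(\<Sum>q\<in>J. cmat_scale (case q of (t, i, j) \<Rightarrow> m t i j) (F q)) *v b k j
            = (\<Sum>q\<in>J. (case q of (t, i, j) \<Rightarrow> m t i j) *s (F q *v b k j))"
          by (simp add: matrix_vector_mult_sum_left cmat_scale_mult_vec)
        \<comment> \<open>Only the units of type \<open>tp k\<close> in column \<open>j\<close> act
          nontrivially on \<open>b k j\<close>.\<close>
        also have "\<dots> = (\<Sum>q\<in>(\<lambda>i. (?t, i, j)) ` lev ?t. (case q of (t, i, j) \<Rightarrow> m t i j) *s (F q *v b k j))"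
          using j unit_b' by (intro sum.mono_neutral_right fin) (auto simp: J_def image_iff)
        also have "\<dots> = (\<Sum>i\<in>lev ?t. m ?t i j *s b k i)"
          using j by (subst sum.reindex) (auto simp: inj_on_def F_def unit_b)
        finally show "M *v b k j = (\<Sum>q\<in>J. cmat_scale (case q of (t, i, j) \<Rightarrow> m t i j) (F q)) *v b k j"
          using m[OF j] by simp
      qed
      then show "M \<in> cmat.span (F ` J)"
        by (metis (no_types, lifting) cmat.span_base cmat.span_scale cmat.span_sum image_eqI)
    qed
    show "cmat.independent (F ` J)"
    proof (rule cmat.independent_if_scalars_zero)
      show "finite (F ` J)" using fin by simp
    next
      fix c M assume s: "(\<Sum>M\<in>F ` J. cmat_scale (c M) M) = 0" and "M \<in> F ` J"
      then obtain t i j where tij: "(t, i, j) \<in> J" "M = F (t, i, j)" by auto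
      obtain k where k: "tp k = t" and ij: "i \<in> lev t" "j \<in> lev t" using tij by (auto simp: J_def)
      \<comment> \<open>Applying the relation to \<open>b k j\<close> and reading off the coordinate
        at \<open>b k i\<close> isolates the coefficient of the unit
        \<open>(t, i, j)\<close>.\<close>
      have "0 = coord k i ((\<Sum>M\<in>F ` J. cmat_scale (c M) M) *v b k j)" by (simp add: s coord_zero)
      also have "\<dots> = (\<Sum>q\<in>J. c (F q) * coord k i (F q *v b k j))"
        by (simp add: sum.reindex[OF inj] matrix_vector_mult_sum_left cmat_scale_mult_vec coord_sum coord_scale)
      also have "\<dots> = (\<Sum>q\<in>J. if q = (t, i, j) then c (F q) else 0)"
        using k ij by (intro sum.cong refl) (auto simp: unit_b' coord_b coord_zero)
      also have "\<dots> = c M" using tij fin by simp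
      finally show "c M = 0" by simp
    qed
  qed
  also have "\<dots> = card J" by (rule card_image[OF inj])
  also have "\<dots> = (\<Sum>t\<in>range tp. (hi t + 1 - lo t)\<^sup>2)"
    unfolding J_def by (subst card_SigmaI) (auto simp: power2_eq_square)
  finally show ?thesis .
qed

end

section \<open>The fixed labelled graph and the evaluation of its ladder vectors\<close>

definition nbr_table :: "nat list list" where
  "nbr_table = [[1, 2, 3],
    [0, 4, 5], [0, 6, 7], [0, 8, 9],
    [1, 10, 11], [1, 12, 13], [2, 14, 15], [2, 16, 17], [3, 18, 19], [3, 20, 21],
    [4, 22, 27], [4, 23, 26], [5, 24, 29], [5, 25, 28], [6, 22, 29], [6, 25, 26],
    [7, 24, 27], [7, 23, 28], [8, 22, 28], [8, 24, 26], [9, 25, 27], [9, 23, 29],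
    [10, 14, 18], [11, 17, 21], [12, 16, 19], [13, 15, 20],
    [11, 15, 19], [10, 16, 20], [13, 17, 18], [12, 14, 21]]"

text \<open>Label 0 is the base vertex and 1 to 3 are its neighbors; \<open>y j\<close> gets label
  \<open>j + 3\<close> and \<open>z j\<close> label \<open>j + 9\<close>. The two classes at
  distance 4 occupy 22 to 25 and 26 to 29.\<close>

definition levels :: "nat list" where
  "levels = [0] @ replicate 3 1 @ replicate 6 2 @ replicate 12 3 @ replicate 8 4"

definition proj :: "nat \<Rightarrow> int list \<Rightarrow> int list" where
  "proj i l = map2 (\<lambda>j a. if j = i then a else 0) levels l"

definition apply_adj :: "int list \<Rightarrow> int list" where
  "apply_adj l = map (\<lambda>ns. sum_list (map ((!) l) ns)) nbr_table"

definition dot :: "int list \<Rightarrow> int list \<Rightarrow> int" where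
  "dot l m = sum_list (map2 (*) l m)"

definition at_level :: "nat \<Rightarrow> int list \<Rightarrow> int list" where
  "at_level i l = concat (map (\<lambda>j. if j = i then l else replicate ([1, 3, 6, 12, 8] ! j) 0) [0..<5])"

text \<open>
  The entry \<open>s ! j\<close> is the number, starting from 0 and in the given order of the vertices at
  distance 1, of the vertex with label \<open>j + 1\<close>.
\<close>

fun seed :: "nat list \<Rightarrow> summand \<Rightarrow> int list" where
  "seed s W0 = at_level 0 [1]"
| "seed s W1a = at_level 1 (map ((!) [1, -1, 0]) s)"
| "seed s W1b = at_level 1 (map ((!) [1, 1, -2]) s)"
| "seed s W2a = at_level 2 [1, -1, 0, 0, 0, 0]"
| "seed s W2b = at_level 2 [0, 0, 1, -1, 0, 0]"
| "seed s W2c = at_level 2 [0, 0, 0, 0, 1, -1]"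
| "seed s W3a = at_level 3 [2, -2, 0, 0, -1, 1, -1, 1, -1, 1, -1, 1]"
| "seed s W3b = at_level 3 [0, 0, 2, -2, -1, 1, -1, 1, 1, -1, 1, -1]"
| "seed s W3c = at_level 3 [0, 0, 0, 0, -1, 1, 1, -1, 1, -1, -1, 1]"
| "seed s W3d = at_level 3 [-1, 1, -1, 1, -1, 1, -1, 1, 0, 0, 0, 0]"
| "seed s W3e = at_level 3 [-1, 1, 1, -1, -1, 1, 1, -1, -2, 2, 0, 0]"
| "seed s W3f = at_level 3 [-1, 1, 1, -1, 1, -1, -1, 1, 0, 0, -2, 2]"
| "seed s W4 = at_level 4 [1, 1, 1, 1, -1, -1, -1, -1]"

fun type_lo :: "module_type \<Rightarrow> nat" where
  "type_lo TypeI = 0" | "type_lo TypeII = 1" | "type_lo TypeIII = 2"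
| "type_lo TypeIV = 3" | "type_lo TypeV = 3" | "type_lo TypeVI = 4"

fun type_hi :: "module_type \<Rightarrow> nat" where
  "type_hi TypeI = 4" | "type_hi TypeII = 3" | "type_hi TypeIII = 4"
| "type_hi TypeIV = 3" | "type_hi TypeV = 4" | "type_hi TypeVI = 4"

text \<open>The basis of type I is prescribed as the sphere vectors, whose upward coefficients are
  \<open>c_1, ..., c_4\<close> = 1, 1, 1, 3. In the other types each rung is the projected image of
  the one below, which makes the coefficient 1.\<close>

fun type_up :: "module_type \<Rightarrow> nat \<Rightarrow> int" where
  "type_up t i = (if t = TypeI \<and> i = 3 then 3 else 1)"

text \<open>In type I these are \<open>b_0, ..., b_3\<close> = 3, 2, 2, 2. In the longer ladders of
  the other types the adjacency matrix is symmetric and the upward coefficient is 1, so the value is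
  the ratio of the squared norms of the rungs \<open>i\<close> and \<open>i - 1\<close>.\<close>

fun type_down :: "module_type \<Rightarrow> nat \<Rightarrow> int" where
  "type_down t i = (if t = TypeI \<and> i = 1 then 3 else if t = TypeV then 4 else 2)"

text \<open>\<open>W0\<close> is treated apart because pushing its seed upwards would give 3 times
  the sphere vector at level 4.\<close>

fun blist :: "nat list \<Rightarrow> summand \<Rightarrow> nat \<Rightarrow> int list" where
  "blist s k i =
     (if k = W0 then map (\<lambda>j. if j = i then 1 else 0) levels
      else if i = type_lo (summand_type k) then seed s k
      else case i of 0 \<Rightarrow> replicate 30 0 | Suc j \<Rightarrow> proj i (apply_adj (blist s k j)))"

definition summands :: "summand list" where
  "summands = [W0, W1a, W1b, W2a, W2b, W2c, W3a, W3b, W3c, W3d, W3e, W3f, W4]"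

text \<open>Level 5 is included because the relation at level 4 refers to the next rung, which has
  to be zero.\<close>

definition check_ladder :: "nat list \<Rightarrow> summand \<Rightarrow> bool" where
  "check_ladder s k \<longleftrightarrow> (let t = summand_type k; bs = map (blist s k) [0..<6] in
     \<forall>i\<in>set [0..<6]. length (bs ! i) = 30 \<and> proj i (bs ! i) = bs ! i \<and>
       ((\<exists>a\<in>set (bs ! i). a \<noteq> 0) \<longleftrightarrow> type_lo t \<le> i \<and> i \<le> type_hi t) \<and>
       (type_lo t \<le> i \<and> i \<le> type_hi t \<longrightarrow> apply_adj (bs ! i) = 
         map2 (\<lambda>p q. type_up t i * p + q) (bs ! (i + 1))
           (if i = type_lo t then replicate 30 0 else map ((*) (type_down t i)) (bs ! (i - 1)))))"

declare blist.simps [simp del]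

text \<open>The partners may depend on the first index: for one permutation half of all pairs
  suffice by symmetry, while for each permutation the two type II summands are compared with all the
  others.\<close>

definition check_orth :: "nat list \<Rightarrow> nat \<Rightarrow> nat list \<Rightarrow> (nat \<Rightarrow> nat list) \<Rightarrow> bool" where
  "check_orth s i ps qs \<longleftrightarrow> (let bs = map (\<lambda>k. blist s k i) summands in
     \<forall>p\<in>set ps. \<forall>q\<in>set (qs p). dot (bs ! p) (bs ! q) = 0)"

definition perms :: "nat list list" where
  "perms = [[0, 1, 2], [0, 2, 1], [1, 0, 2], [1, 2, 0], [2, 0, 1], [2, 1, 0]]"

lemma blist_perm: "k \<notin> {W1a, W1b} \<Longrightarrow> blist s k i = blist s' k i"
proof (induction i)
  case 0
  then show ?case by (cases k) (simp_all add: blist.simps[of _ _ 0])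
next
  case (Suc i)
  have "seed s k = seed s' k" using Suc.prems by (cases k) simp_all
  then show ?case using Suc by (simp add: blist.simps[of _ _ "Suc i"])
qed

text \<open>Only the vectors of type II depend on \<open>s\<close>, which keeps the evaluations small.\<close>

lemma check_ladder_id: "\<forall>k\<in>set summands. check_ladder [0, 1, 2] k"
  by code_simp

lemma check_ladder_W1: "\<forall>s\<in>set perms. check_ladder s W1a \<and> check_ladder s W1b"
  by code_simp

lemma check_orth_id: "\<forall>i\<in>set [0..<5]. check_orth [0, 1, 2] i [0..<13] (\<lambda>p. [0..<p])"
  by code_simp

lemma check_orth_W1:
  "\<forall>s\<in>set perms. \<forall>i\<in>set [1..<4]. check_orth s i [1, 2] (\<lambda>p. remove1 p [0..<13])"
  by code_simp

lemma check_nbr_table: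
  "\<forall>i\<in>set [0..<30]. length (nbr_table ! i) = 3 \<and> distinct (nbr_table ! i) \<and>
     (\<forall>j\<in>set (nbr_table ! i). j < 30 \<and> i \<in> set (nbr_table ! j) \<and> i \<noteq> j)"
  by code_simp

text \<open>Each edge appears once, from the smaller label to the larger. In a cubic graph these 45
  adjacencies already determine all neighborhoods.\<close>

definition edges :: "(nat \<times> nat) list" where
  "edges = concat (map (\<lambda>i. map (Pair i) (filter ((<) i) (nbr_table ! i))) [0..<30])"

lemma edges_eq:
  "edges = [(0, 1), (0, 2), (0, 3), (1, 4), (1, 5), (2, 6), (2, 7), (3, 8), (3, 9), (4, 10), (4, 11),
    (5, 12), (5, 13), (6, 14), (6, 15), (7, 16), (7, 17), (8, 18), (8, 19), (9, 20), (9, 21),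
    (10, 22), (10, 27), (11, 23), (11, 26), (12, 24), (12, 29), (13, 25), (13, 28), (14, 22),
    (14, 29), (15, 25), (15, 26), (16, 24), (16, 27), (17, 23), (17, 28), (18, 22), (18, 28),
    (19, 24), (19, 26), (20, 25), (20, 27), (21, 23), (21, 29)]"
  by code_simp

section \<open>Distances\<close>

lemma relpowp_symp:
  assumes "symp adj" shows "(adj ^^ n) y z \<Longrightarrow> (adj ^^ n) z y"
proof (induction n arbitrary: z)
  case (Suc n)
  then obtain v where "(adj ^^ n) y v" "adj v z" by auto
  then show ?case using Suc.IH assms by (metis relpowp_Suc_I2 sympD)
qed simp

context
  fixes adj :: "'v::finite \<Rightarrow> 'v \<Rightarrow> bool"
  assumes conn: "connected_graph adj" and graph: "simple_graph adj"
begin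

lemma relpowp_gdist: "(adj ^^ gdist adj y z) y z"
proof -
  have "\<exists>n. (adj ^^ n) y z" using conn by (simp only: connected_graph_def rtranclp_power)
  then show ?thesis unfolding gdist_def by (rule LeastI_ex)
qed

lemma gdist_le: "(adj ^^ n) y z \<Longrightarrow> gdist adj y z \<le> n"
  unfolding gdist_def by (rule Least_le)

lemma gdist_self: "gdist adj y y = 0"
  using gdist_le[of 0 y y] by simp

lemma gdist_eq_0_iff: "gdist adj y z = 0 \<longleftrightarrow> y = z"
  using relpowp_gdist[of y z] gdist_self by (cases "gdist adj y z = 0") auto

lemma gdist_commute: "gdist adj y z = gdist adj z y"
proof -
  have "gdist adj y z \<le> gdist adj z y" for y z
    using graph by (intro gdist_le relpowp_symp[OF _ relpowp_gdist]) (simp add: simple_graph_def)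
  then show ?thesis by (simp add: eq_iff)
qed

lemma gdist_step: "adj v w \<Longrightarrow> gdist adj y w \<le> gdist adj y v + 1"
  using gdist_le[of "Suc (gdist adj y v)" y w] relpowp_gdist[of y v] by auto

lemma gdist_eq_1_iff: "gdist adj y z = Suc 0 \<longleftrightarrow> adj y z"
proof
  assume "gdist adj y z = Suc 0"
  then show "adj y z" using relpowp_gdist[of y z] by (simp add: eq_OO)
next
  assume a: "adj y z"
  then have "y \<noteq> z" using graph by (auto simp: simple_graph_def irreflp_def)
  then have "gdist adj y z \<noteq> 0" by (simp add: gdist_eq_0_iff)
  moreover have "gdist adj y z \<le> 1" using a gdist_le[of 1 y z] by (simp add: eq_OO)
  ultimately show "gdist adj y z = Suc 0" by simp
qed

lemma gsphere_1: "gsphere adj (Suc 0) y = neighbors adj y"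
  by (simp add: gsphere_def neighbors_def gdist_eq_1_iff)

lemma gdist_pred:
  assumes "gdist adj y z = Suc n"
  shows "\<exists>v. gdist adj y v = n \<and> adj v z"
proof -
  obtain v where v: "(adj ^^ n) y v" "adj v z" using relpowp_gdist[of y z] assms by auto
  then have "gdist adj y v = n" using gdist_le[OF v(1)] gdist_step[OF v(2), of y] assms by simp
  then show ?thesis using v by blast
qed

lemma finite_gdists: "finite {gdist adj y z |y z. True}"
proof (rule finite_subset)
  show "{gdist adj y z |y z. True} \<subseteq> range (case_prod (gdist adj))"
  proof
    fix n assume "n \<in> {gdist adj y z |y z. True}"
    then obtain y z where "n = gdist adj y z" by blast
    then show "n \<in> range (case_prod (gdist adj))" using rangeI[of "case_prod (gdist adj)" "(y, z)"] by simp
  qed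
qed (rule finite_imageI, rule finite)

lemma gdist_le_diameter: "gdist adj y z \<le> gdiameter adj"
  unfolding gdiameter_def by (rule Max_ge[OF finite_gdists]) (rule CollectI, intro exI conjI TrueI, rule refl)

end

lemma card_gsphere_intersection:
  assumes "distance_regular adj" "i \<le> gdiameter adj" "j \<le> gdiameter adj" "gdist adj y z \<le> gdiameter adj"
  shows "card (gsphere adj i y \<inter> gsphere adj j z) = intersection_number adj (gdist adj y z) i j"
proof -
  obtain p where p: "\<forall>y' z'. gdist adj y' z' = gdist adj y z \<longrightarrow> card (gsphere adj i y' \<inter> gsphere adj j z') = p"
    using assms unfolding distance_regular_def by blast
  \<comment> \<open>The pair \<open>y\<close>, \<open>z\<close> itself realizes the distance, so the
    number under \<open>THE\<close> is unique.\<close>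
  then have "intersection_number adj (gdist adj y z) i j = p"
    unfolding intersection_number_def by (intro the_equality) blast+
  then show ?thesis using p by blast
qed


section \<open>Graphs with the intersection array of Tutte's 8-cage\<close>

lemma card_2_other: "card A = 2 \<Longrightarrow> a \<in> A \<Longrightarrow> \<exists>b. A = {a, b} \<and> a \<noteq> b"
proof -
  assume "card A = 2" "a \<in> A"
  then have "card (A - {a}) = 1" by simp
  then obtain b where "A - {a} = {b}" by (rule card_1_singletonE)
  then have "A = {a, b} \<and> a \<noteq> b" using \<open>a \<in> A\<close> by blast
  then show ?thesis ..
qed

locale tutte_graph =
  fixes adj :: "'v::finite \<Rightarrow> 'v \<Rightarrow> bool"
  assumes drg: "distance_regular adj"
    and arr: "intersection_array adj = ([3, 2, 2, 2], [1, 1, 1, 3])"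
begin

abbreviation "d \<equiv> gdist adj"
abbreviation "N \<equiv> neighbors adj"
abbreviation "S \<equiv> gsphere adj"

lemma conn: "connected_graph adj" and graph: "simple_graph adj"
  using drg by (simp_all add: distance_regular_def)

lemma adj_sym: "adj v w \<Longrightarrow> adj w v"
  using graph unfolding simple_graph_def by (metis sympD)

lemma diameter: "gdiameter adj = 4"
proof -
  have "length (fst (intersection_array adj)) = 4" by (simp add: arr)
  then show ?thesis by (simp add: intersection_array_def)
qed

lemma d_le: "d y z \<le> 4"
  using gdist_le_diameter[OF conn graph] diameter by simp

lemmas d_self = gdist_self[OF conn graph]
lemmas d_0 = gdist_eq_0_iff[OF conn graph]
lemmas d_1 = gdist_eq_1_iff[OF conn graph]
lemmas d_commute = gdist_commute[OF conn graph]

lemma intersection_number_b: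
  assumes "i < 4" shows "intersection_number adj i 1 (i + 1) = [3, 2, 2, 2] ! i"
proof -
  have "map (\<lambda>i. intersection_number adj i 1 (i + 1)) [0..<4] = [3, 2, 2, 2]"
    using arr unfolding intersection_array_def diameter by (simp only: prod.inject)
  then have "map (\<lambda>i. intersection_number adj i 1 (i + 1)) [0..<4] ! i = [3, 2, 2, 2] ! i"
    by (rule arg_cong)
  moreover have "i < length [0..<4]" "[0..<4] ! i = i" using assms by auto
  ultimately show ?thesis by (simp only: nth_map)
qed

lemma intersection_number_c:
  assumes "1 \<le> i" "i \<le> 4" shows "intersection_number adj i 1 (i - 1) = [1, 1, 1, 3] ! (i - 1)"
proof -
  have "map (\<lambda>i. intersection_number adj i 1 (i - 1)) [1..<4 + 1] = [1, 1, 1, 3]"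
    using arr unfolding intersection_array_def diameter by (simp only: prod.inject)
  then have "map (\<lambda>i. intersection_number adj i 1 (i - 1)) [1..<4 + 1] ! (i - 1) = [1, 1, 1, 3] ! (i - 1)"
    by (rule arg_cong)
  moreover have "i - 1 < length [1..<4 + 1]" "[1..<4 + 1] ! (i - 1) = i" using assms by auto
  ultimately show ?thesis by (simp only: nth_map)
qed

lemma card_up:
  assumes "d x v = i" "i < 4"
  shows "card (N v \<inter> S (i + 1) x) = (if i = 0 then 3 else 2)"
proof -
  have "card (N v \<inter> S (i + 1) x) = [3, 2, 2, 2] ! i"
    using card_gsphere_intersection[OF drg, of 1 "i + 1" v x] assms d_commute[of v x]
      intersection_number_b[OF assms(2)]
    by (simp add: diameter gsphere_1[OF conn graph])
  moreover have "i = 0 \<or> i = 1 \<or> i = 2 \<or> i = 3" using assms by linarith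
  ultimately show ?thesis by (elim disjE) simp_all
qed

lemma card_down:
  assumes "d x v = i" "1 \<le> i"
  shows "card (N v \<inter> S (i - 1) x) = (if i = 4 then 3 else 1)"
proof -
  have i: "i \<le> 4" using d_le[of x v] assms by simp
  then have "card (N v \<inter> S (i - 1) x) = [1, 1, 1, 3] ! (i - 1)"
    using card_gsphere_intersection[OF drg, of 1 "i - 1" v x] assms d_commute[of v x]
      intersection_number_c[OF assms(2)]
    by (simp add: diameter gsphere_1[OF conn graph])
  moreover have "i = 1 \<or> i = 2 \<or> i = 3 \<or> i = 4" using assms i by linarith
  ultimately show ?thesis by (elim disjE) simp_all
qed

lemma card_N: "card (N v) = 3"
  using card_up[of v v 0] by (simp add: d_self gsphere_1[OF conn graph])

lemma N_eq: "adj v a \<Longrightarrow> adj v b \<Longrightarrow> adj v c \<Longrightarrow> a \<noteq> b \<Longrightarrow> a \<noteq> c \<Longrightarrow> b \<noteq> c \<Longrightarrow> N v = {a, b, c}"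
proof (rule card_subset_eq[symmetric])
  assume "a \<noteq> b" "a \<noteq> c" "b \<noteq> c"
  then show "card {a, b, c} = card (N v)" by (simp add: card_N)
qed (auto simp: neighbors_def)

text \<open>At every distance the entries \<open>b_i\<close> and \<open>c_i\<close> add up to the
  valency 3 (with \<open>b_4\<close> and \<open>c_0\<close> zero), so no neighbor is left at equal
  distance: the graph is bipartite.\<close>

lemma d_adj: "adj v w \<Longrightarrow> d x w = d x v + 1 \<or> d x v = d x w + 1"
proof -
  assume "adj v w"
  define i where "i = d x v"
  let ?U = "if i = 4 then {} else N v \<inter> S (i + 1) x" and ?D = "if i = 0 then {} else N v \<inter> S (i - 1) x"
  have "i \<le> 4" by (simp add: i_def d_le)
  have "?U \<inter> ?D = {}" by (auto simp: gsphere_def)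
  moreover have "card ?U + card ?D = 3"
    using card_up[of x v i] card_down[of x v i] \<open>i \<le> 4\<close> by (auto simp: i_def)
  ultimately have "card (?U \<union> ?D) = card (N v)" by (simp add: card_Un_disjoint card_N)
  then have "?U \<union> ?D = N v" by (intro card_subset_eq) auto
  then have "w \<in> ?U \<union> ?D" using \<open>adj v w\<close> by (simp add: neighbors_def)
  then show ?thesis by (auto simp: i_def gsphere_def split: if_splits)
qed

text \<open>A step along a path changes the distances to \<open>x\<close> and to \<open>y\<close> by
  one each, so the parity of their sum is constant.\<close>

lemma parity: "even (d y v + d x v + d x y)"
proof -
  have "adj\<^sup>*\<^sup>* y v" using conn by (simp add: connected_graph_def)
  then show ?thesis
  proof induction
    case base
    show ?case by (simp add: d_self)
  next
    case (step v w)
    then show ?case using d_adj[OF step(2), of x] d_adj[OF step(2), of y] by presburger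
  qed
qed

text \<open>From \<open>c_2 = 1\<close>: there are no quadrilaterals.\<close>

lemma unique_path_2:
  assumes "adj s p" "adj p t" "adj s q" "adj q t" "s \<noteq> t"
  shows "p = q"
proof -
  have "d s p = 1" using assms by (simp add: d_1)
  moreover have "d s t \<noteq> 0" using assms(5) by (simp add: d_0)
  ultimately have "d s t = 2" using d_adj[OF assms(2), of s] by linarith
  then have "card (N t \<inter> S 1 s) = 1" using card_down[of s t 2] by simp
  moreover have "p \<in> N t \<inter> S 1 s" "q \<in> N t \<inter> S 1 s"
    using assms adj_sym by (auto simp: gsphere_1[OF conn graph] neighbors_def)
  ultimately show ?thesis by (metis card_1_singletonE singletonD)
qed

lemma d_2: "adj s p \<Longrightarrow> adj p t \<Longrightarrow> s \<noteq> t \<Longrightarrow> d s t = 2"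
proof -
  assume "adj s p" "adj p t" "s \<noteq> t"
  then have "d s p = Suc 0" "d s t \<noteq> 0" by (simp_all add: d_0 d_1)
  then show ?thesis using d_adj[OF \<open>adj p t\<close>, of s] by linarith
qed

text \<open>From \<open>c_3 = 1\<close>: there are no hexagons. The inequalities exclude walks that
  backtrack, which forces the endpoints to distance 3.\<close>

lemma unique_path_3:
  assumes "adj s a" "adj a b" "adj b t" "adj s a'" "adj a' b'" "adj b' t" "s \<noteq> b" "s \<noteq> b'" "a \<noteq> t"
  shows "b = b'"
proof -
  have b: "d s b = 2" "d s b' = 2" using d_2 assms by blast+
  have "\<not> adj s t" using unique_path_2[of s a b t] assms adj_sym by blast
  then have "d s t \<noteq> Suc 0" by (simp add: d_1)
  then have "d s t = 3" using d_adj[OF assms(3), of s] b(1) by linarith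
  then have "card (N t \<inter> S 2 s) = 1" using card_down[of s t 3] by simp
  moreover have "b \<in> N t \<inter> S 2 s" "b' \<in> N t \<inter> S 2 s"
    using assms adj_sym b by (auto simp: gsphere_def neighbors_def)
  ultimately show ?thesis by (metis card_1_singletonE singletonD)
qed

text \<open>In a bipartite graph of diameter 4, nonadjacent vertices of opposite color are at
  distance exactly 3.\<close>

lemma path_3:
  assumes "odd (d x s + d x t)" "\<not> adj s t"
  obtains a b where "adj s a" "adj a b" "adj b t"
proof -
  have "d s t \<noteq> Suc 0" using assms(2) by (simp add: d_1)
  have "odd (d s t)" using parity[of s t x] assms(1) by presburger
  moreover have "d s t = 0 \<or> d s t = Suc 0 \<or> d s t = 2 \<or> d s t = 3 \<or> d s t = 4"
    using d_le[of s t] by linarith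
  ultimately have "d s t = 3" using \<open>d s t \<noteq> Suc 0\<close> by (elim disjE) simp_all
  then obtain b where b: "d s b = 2" "adj b t" using gdist_pred[OF conn graph, of s t 2] by auto
  then obtain a where "d s a = 1" "adj a b" using gdist_pred[OF conn graph, of s b 1] by auto
  then show thesis using that b d_1[of s a] by auto
qed

end

text \<open>
  Around a fixed base vertex the graph is a tree up to distance 3, and every vertex at
  distance 4 is joined to one leaf in each of the three branches.
\<close>

locale rooted_tutte_graph = tutte_graph +
  fixes x :: 'a
begin

abbreviation L :: "nat \<Rightarrow> 'a set" where "L i \<equiv> S i x"

lemma L_iff: "v \<in> L i \<longleftrightarrow> d x v = i" by (simp add: gsphere_def)

lemma adj_level: "adj v w \<Longrightarrow> v \<in> L i \<Longrightarrow> w \<in> L j \<Longrightarrow> j = i + 1 \<or> i = j + 1"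
  using d_adj[of v w x] by (auto simp: L_iff)

lemma adj_level_cases: "adj v w \<Longrightarrow> v \<in> L i \<Longrightarrow> w \<in> L (i + 1) \<or> (1 \<le> i \<and> w \<in> L (i - 1))"
  using d_adj[of v w x] by (auto simp: L_iff)

lemma L_0: "L 0 = {x}" using d_0[of x] by (auto simp: gsphere_def)

lemma L_1: "L (Suc 0) = N x" by (rule gsphere_1[OF conn graph])

lemma L_disjoint: "v \<in> L i \<Longrightarrow> v \<in> L j \<Longrightarrow> i = j" by (simp add: L_iff)

lemma parent_ex1:
  assumes "v \<in> L i" "i \<in> {1, 2, 3}" shows "\<exists>!p. adj p v \<and> p \<in> L (i - 1)"
proof -
  have "card (N v \<inter> L (i - 1)) = 1" using card_down[of x v i] assms by (auto simp: L_iff)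
  then obtain p where p: "N v \<inter> L (i - 1) = {p}" by (rule card_1_singletonE)
  show ?thesis
  proof (rule ex1I[of _ p])
    show "adj p v \<and> p \<in> L (i - 1)" using p adj_sym by (auto simp: neighbors_def)
    show "\<And>q. adj q v \<and> q \<in> L (i - 1) \<Longrightarrow> q = p" using p adj_sym by (auto simp: neighbors_def)
  qed
qed

text \<open>The parent in the tree formed by the levels up to 3. On levels 1 to 3 the lower neighbor
  is unique because \<open>c_1 = c_2 = c_3 = 1\<close>; a vertex at level 4 has three lower
  neighbors.\<close>

definition par :: "'a \<Rightarrow> 'a" where "par v = (THE p. adj p v \<and> p \<in> L (d x v - 1))"

lemma par: "v \<in> L i \<Longrightarrow> i \<in> {1, 2, 3} \<Longrightarrow> adj (par v) v \<and> par v \<in> L (i - 1)"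
  using theI'[OF parent_ex1[of v i]] by (auto simp: par_def L_iff)

lemma par_eq: "v \<in> L i \<Longrightarrow> i \<in> {1, 2, 3} \<Longrightarrow> adj p v \<Longrightarrow> p \<in> L (i - 1) \<Longrightarrow> par v = p"
  using parent_ex1[of v i] par[of v i] by blast

lemma par_L3: "z \<in> L 3 \<Longrightarrow> adj (par z) z" "z \<in> L 3 \<Longrightarrow> par z \<in> L 2"
  using par[of z 3] by auto

lemma par_L2: "y \<in> L 2 \<Longrightarrow> adj (par y) y" "y \<in> L 2 \<Longrightarrow> par y \<in> L 1"
  using par[of y 2] by auto

lemma N_L4: "w \<in> L 4 \<Longrightarrow> adj w z \<Longrightarrow> z \<in> L 3"
  using adj_level_cases[of w z 4] d_le[of x z] by (auto simp: L_iff)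

lemma children:
  assumes "v \<in> L i" "i \<in> {1, 2}"
  shows "card {c \<in> L (i + 1). par c = v} = 2"
proof -
  have "{c \<in> L (i + 1). par c = v} = N v \<inter> L (i + 1)"
  proof (intro Set.set_eqI iffI)
    fix c assume "c \<in> {c \<in> L (i + 1). par c = v}"
    then show "c \<in> N v \<inter> L (i + 1)" using par[of c "i + 1"] assms by (auto simp: neighbors_def)
  next
    fix c assume "c \<in> N v \<inter> L (i + 1)"
    then show "c \<in> {c \<in> L (i + 1). par c = v}"
      using par_eq[of c "i + 1" v] assms by (auto simp: neighbors_def)
  qed
  then show ?thesis using card_up[of x v i] assms by (auto simp: L_iff)
qed

lemma sibling:
  assumes "v \<in> L i" "i \<in> {2, 3}"
  obtains v' where "v' \<in> L i" "par v' = par v" "v' \<noteq> v" "\<And>c. c \<in> L i \<Longrightarrow> par c = par v \<Longrightarrow> c = v \<or> c = v'"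
proof -
  have "par v \<in> L (i - 1)" "i - 1 \<in> {1, 2}" and i: "i - 1 + 1 = i" using par[of v i] assms by auto
  then have "card {c \<in> L i. par c = par v} = 2" using children[of "par v" "i - 1"] by (simp only: i)
  from card_2_other[OF this, of v] assms
  obtain v' where v': "{c \<in> L i. par c = par v} = {v, v'}" "v \<noteq> v'" by blast
  then have "v' \<in> {c \<in> L i. par c = par v}" by simp
  then show thesis using v' that[of v'] by blast
qed

lemma sibling_cases:
  assumes "s \<in> L 3" "s' \<in> L 3" "par s' = par s" "s' \<noteq> s" "v \<in> L 3" "par v = par s"
  shows "v = s \<or> v = s'"
proof -
  obtain s2 where "\<And>c. c \<in> L 3 \<Longrightarrow> par c = par s \<Longrightarrow> c = s \<or> c = s2"
    using sibling[OF assms(1)] by blast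
  then have "s' = s2" "v = s \<or> v = s2" using assms by blast+
  then show ?thesis by blast
qed

abbreviation "br z \<equiv> par (par z)"

text \<open>Levels 1 and 4 have opposite colors and no edges between them, so a path of length 3
  exists, and such a path must descend by one level at each step.\<close>

lemma leaf_in_branch:
  assumes w: "w \<in> L 4" and u: "u \<in> L 1"
  shows "\<exists>z. adj w z \<and> br z = u"
proof -
  have "\<not> adj u w" using adj_level[of u w 1 4] w u by auto
  moreover have "odd (d x u + d x w)" using w u by (auto simp: L_iff)
  ultimately obtain y z where p: "adj u y" "adj y z" "adj z w" using path_3[of x u w] by metis
  have z: "z \<in> L 3" using N_L4[OF w] adj_sym p by blast
  have y: "y \<in> L 2"
    using adj_level_cases[OF p(1) u] adj_level_cases[of z y 3] adj_sym[OF p(2)] z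
    by (auto simp: L_iff)
  have "par z = y" using par_eq[of z 3 y] z y p by auto
  moreover have "par y = u" using par_eq[of y 2 u] y u p by auto
  ultimately show ?thesis using p adj_sym by blast
qed

text \<open>Pigeonhole: the three leaves of \<open>w\<close> reach all three branches.\<close>

lemma leaf_in_branch_unique:
  assumes w: "w \<in> L 4" and "adj w z" "adj w z'" "br z = br z'"
  shows "z = z'"
proof -
  have "L 1 \<subseteq> br ` N w" using leaf_in_branch[OF w] by (fastforce simp: neighbors_def)
  moreover have "card (L 1) = card (N w)" by (simp add: L_1 card_N)
  ultimately have "card (N w) \<le> card (br ` N w)" by (metis card_mono finite)
  then have "inj_on br (N w)" by (metis card_image_le eq_card_imp_inj_on finite le_antisym)
  then show ?thesis using assms by (auto simp: inj_on_def neighbors_def)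
qed

text \<open>The vertices \<open>z\<close> and \<open>y\<close> are nonadjacent and of opposite
  color, hence joined by a path of length 3; a path that avoids level 4 would stay inside the branch
  of \<open>z\<close>.\<close>

lemma connecting_ex:
  assumes z: "z \<in> L 3" and y: "y \<in> L 2" and ne: "br z \<noteq> par y"
  shows "\<exists>w z'. w \<in> L 4 \<and> adj w z \<and> adj w z' \<and> par z' = y"
proof -
  have nadj: "\<not> adj z y" using par_eq[of z 3 y] z y ne adj_sym by auto
  have "odd (d x z + d x y)" using z y by (simp add: L_iff)
  then obtain w z' where p: "adj z w" "adj w z'" "adj z' y" using nadj by (rule path_3)
  have z': "z' \<in> L 3 \<or> z' \<in> L 1" using adj_level_cases[OF adj_sym[OF p(3)] y] by auto
  have w: "w \<in> L 4 \<or> w \<in> L 2" using adj_level_cases[OF p(1) z] by auto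
  show ?thesis
  proof (cases "w \<in> L 4")
    case True
    then have "z' \<in> L 3" using N_L4 p by blast
    then show ?thesis using True p par_eq[of z' 3 y] y adj_sym by (intro exI[of _ w] exI[of _ z']) auto
  next
    case False
    then have w2: "w \<in> L 2" using w by blast
    then have pz: "par z = w" using par_eq[of z 3 w] z p adj_sym by auto
    show ?thesis using z'
    proof
      assume z'3: "z' \<in> L 3"
      have "par z' = w" "par z' = y" using par_eq[of z' 3] z'3 w2 y p adj_sym by auto
      then show ?thesis using pz ne by simp
    next
      assume z'1: "z' \<in> L 1"
      have "par w = z'" "par y = z'" using par_eq[of w 2] par_eq[of y 2] w2 y z'1 p adj_sym by auto
      then show ?thesis using pz ne by simp
    qed
  qed
qed

text \<open>Two such vertices would give two paths of length 3 from \<open>z\<close> to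
  \<open>par a\<close>. The absence of hexagons identifies the leaves, and then the absence of
  quadrilaterals identifies \<open>w\<close> and \<open>w'\<close>.\<close>

lemma connecting_unique:
  assumes w: "w \<in> L 4" "adj w z" "adj w a" and w': "w' \<in> L 4" "adj w' z" "adj w' a'"
    and par: "par a = par a'" "br z \<noteq> br a"
  shows "w = w'"
proof -
  have L: "z \<in> L 3" "a \<in> L 3" "a' \<in> L 3" using N_L4 w w' by blast+
  have "a = a'"
  proof (rule unique_path_3[of z w a "par a" w' a'])
    show "adj a (par a)" "adj a' (par a)" using par_L3 L adj_sym par(1) by metis+
    show "w \<noteq> par a" using par_L3(2)[of a] L w L_disjoint[of w 4 2] by auto
  qed (use w w' par adj_sym in auto)
  then show ?thesis using unique_path_2[of z w a w'] w w' par adj_sym by auto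
qed

text \<open>
  If the third leaf of \<open>w'\<close> were not a sibling of \<open>c\<close>, a path of length 3 from \<open>c\<close> to \<open>w'\<close> would
  give a second path of length 3 from \<open>c\<close> to \<open>par a\<close> or \<open>par b\<close>, or a vertex with two leaves in
  one branch.
\<close>

lemma antipode:
  assumes w: "w \<in> L 4" "N w = {a, b, c}"
    and a': "a' \<in> L 3" "par a' = par a" "a' \<noteq> a"
    and b': "b' \<in> L 3" "par b' = par b" "b' \<noteq> b"
    and c': "c' \<in> L 3" "par c' = par c" "c' \<noteq> c"
    and br: "br a \<noteq> br b" "br a \<noteq> br c" "br b \<noteq> br c"
  shows "\<exists>w'\<in>L 4. N w' = {a', b', c'}"
proof -
  have adj: "adj w a" "adj w b" "adj w c" using w by (auto simp: neighbors_def)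
  have L: "a \<in> L 3" "b \<in> L 3" "c \<in> L 3" using N_L4 w adj by blast+
  have br_L1: "br s \<in> L 1" if "s \<in> L 3" for s using par_L3 par_L2 that by blast
  have L1: "L 1 = {br a, br b, br c}"
    using br_L1 L br by (intro card_subset_eq[symmetric]) (auto simp: L_1 card_N)
  \<comment> \<open>The candidate joins \<open>a'\<close> to a child of \<open>par b\<close>. This
    child is not \<open>b\<close>, since otherwise \<open>w\<close> and \<open>w'\<close> would both
    join \<open>b\<close> to children of \<open>par a\<close>.\<close>
  obtain w' b2 where w': "w' \<in> L 4" "adj w' a'" "adj w' b2" "par b2 = par b"
    using connecting_ex[of a' "par b"] a' br par_L3 L by metis
  have ww': "w \<noteq> w'"
    using leaf_in_branch_unique[OF w(1) adj(1), of a'] w' a' by auto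
  have b2: "b2 \<in> L 3" using N_L4 w' by blast
  have "b2 \<noteq> b"
    using connecting_unique[of w b a w' a'] w adj w' a' br ww' by auto
  then have b2': "b2 = b'" using sibling_cases[of b b' b2] L b' b2 w' by auto
  obtain c2 where c2: "adj w' c2" "br c2 = br c" using leaf_in_branch[OF w'(1) br_L1[OF L(3)]] by blast
  have c2L: "c2 \<in> L 3" using N_L4 w' c2 by blast
  have Nw': "N w' = {a', b', c2}"
    using w' c2 b2' br a' b' by (intro N_eq) auto
  have "par c2 = par c"
  proof (rule ccontr)
    assume ne: "par c2 \<noteq> par c"
    have nadj: "\<not> adj c w'"
    proof
      assume "adj c w'"
      then have "c = c2" using leaf_in_branch_unique[OF w'(1) adj_sym c2(1)] c2 by simp
      then show False using ne by simp
    qed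
    have "odd (d x c + d x w')" using L w' by (simp add: L_iff)
    then obtain v e where p: "adj c v" "adj v e" "adj e w'" using nadj by (rule path_3)
    have e: "e = a' \<or> e = b' \<or> e = c2" using Nw' p adj_sym by (auto simp: neighbors_def)
    have eL: "e \<in> L 3" using e a' b' c2L by blast
    have v: "v \<in> L 4"
    proof (rule ccontr)
      assume "v \<notin> L 4"
      then have "v \<in> L 2" using adj_level_cases[OF p(1) L(3)] by auto
      then have "par c = v" "par e = v" using par_eq[of c 3 v] par_eq[of e 3 v] L eL p adj_sym by auto
      then show False using e ne a' b' br by auto
    qed
    have wv: "w \<noteq> v"
    proof
      assume "w = v"
      then have "e \<in> {a, b, c}" using p w by (auto simp: neighbors_def)
      then show False using e a' b' br c2 ne leaf_in_branch_unique[OF w(1)] by auto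
    qed
    show False
      using e
    proof (elim disjE)
      assume "e = a'"
      then show False using connecting_unique[of w c a v a'] w adj v p adj_sym a' br wv by auto
    next
      assume "e = b'"
      then show False using connecting_unique[of w c b v b'] w adj v p adj_sym b' br wv by auto
    next
      assume "e = c2"
      then show False using leaf_in_branch_unique[OF v adj_sym[OF p(1)] p(2)] c2 ne by auto
    qed
  qed
  moreover have "c2 \<noteq> c"
    using connecting_unique[of w c a w' a'] w adj w' a' br ww' c2 by auto
  ultimately have "c2 = c'" using sibling_cases[of c c' c2] L c' c2L by auto
  then show ?thesis using w' Nw' by blast
qed

end

section \<open>Construction of an ordering of the spheres\<close>

lemma bij_betw_nth_1:
  assumes "distinct xs" "length xs = n" "set xs = A"
  shows "bij_betw (\<lambda>i. xs ! (i - 1)) {1..n} A"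
proof -
  have "bij_betw (\<lambda>i. i - 1) {1..n} {..<n}"
    by (rule bij_betw_byWitness[where f' = Suc]) auto
  moreover have "bij_betw ((!) xs) {..<n} A"
    using assms by (intro bij_betw_nth) auto
  ultimately show ?thesis using bij_betw_trans unfolding comp_def by blast
qed

text \<open>Distinctness of the vertices at level 4 is obtained from their neighbor sets, both when
  an ordering is built and when a given one is read off.\<close>

lemma distinct_triples:
  assumes "distinct [z1, z2, z3, z4, z5, z6, z7, z8, z9, z10, z11, z12]"
  shows "distinct [{z1, z5, z9}, {z2, z8, z12}, {z3, z7, z10}, {z4, z6, z11},
    {z2, z6, z10}, {z1, z7, z11}, {z4, z8, z9}, {z3, z5, z12}]"
  using assms by (simp add: set_eq_subset) blast

context rooted_tutte_graph
begin

lemma br_L1: "z \<in> L 3 \<Longrightarrow> br z \<in> L 1"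
  using par_L3 par_L2 by blast

lemma sibling_ex:
  assumes "v \<in> L i" "i \<in> {2, 3}"
  shows "\<exists>v'. v' \<in> L i \<and> par v' = par v \<and> v' \<noteq> v"
  using sibling[OF assms] by metis

lemma other_up:
  assumes "z \<in> L 3" "w \<in> L 4" "adj z w"
  obtains w' where "w' \<in> L 4" "adj z w'" "w' \<noteq> w"
proof -
  have "card (N z \<inter> L 4) = 2" using card_up[of x z 3] assms(1) by (simp add: L_iff)
  then obtain w' where "N z \<inter> L 4 = {w, w'}" "w \<noteq> w'"
    using card_2_other[of "N z \<inter> L 4" w] assms by (auto simp: neighbors_def)
  then show thesis using that[of w'] by (auto simp: neighbors_def)
qed

lemma up_only:
  assumes "z \<in> L 3" "w \<in> L 4" "adj z w" "w' \<in> L 4" "adj z w'" "w \<noteq> w'" "v \<in> L 4" "adj z v"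
  shows "v = w \<or> v = w'"
proof -
  have "card (N z \<inter> L 4) = 2" using card_up[of x z 3] assms(1) by (simp add: L_iff)
  then have "{w, w'} = N z \<inter> L 4"
    using assms by (intro card_subset_eq) (auto simp: neighbors_def)
  moreover have "v \<in> N z \<inter> L 4" using assms by (simp add: neighbors_def)
  ultimately show ?thesis by blast
qed

lemma leaves_of:
  assumes "w \<in> L 4" "adj w z" "L 1 = {br z, u, u'}" "br z \<noteq> u" "br z \<noteq> u'" "u \<noteq> u'"
  obtains a b where "N w = {z, a, b}" "a \<in> L 3" "b \<in> L 3" "br a = u" "br b = u'"
proof -
  obtain a where a: "adj w a" "br a = u" using leaf_in_branch[OF assms(1), of u] assms(3) by blast
  obtain b where b: "adj w b" "br b = u'" using leaf_in_branch[OF assms(1), of u'] assms(3) by blast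
  have "N w = {z, a, b}" using a b assms by (intro N_eq) auto
  moreover have "a \<in> L 3" "b \<in> L 3" using N_L4[OF assms(1)] a b by blast+
  ultimately show thesis using that a b by blast
qed

lemma par_cases:
  assumes "y \<in> L 2" "y' \<in> L 2" "par y' = par y" "y' \<noteq> y" "z \<in> L 3" "br z = par y"
  shows "par z = y \<or> par z = y'"
proof -
  obtain y2 where "\<And>c. c \<in> L 2 \<Longrightarrow> par c = par y \<Longrightarrow> c = y \<or> c = y2"
    using sibling[OF assms(1)] by blast
  then have "y' = y2" "par z = y \<or> par z = y2" using assms par_L3(2)[of z] by blast+
  then show ?thesis by blast
qed

text \<open>Equal parents in one branch would make both vertices above \<open>z\<close> connect it
  to the same vertex of level 2, against \<open>connecting_unique\<close>.\<close>

lemma par_differ: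
  assumes "w \<in> L 4" "w' \<in> L 4" "w \<noteq> w'" "N w = {z, a, b}" "N w' = {z, a', b'}" "br z \<noteq> br a" "br z \<noteq> br b"
  shows "par a \<noteq> par a'" "par b \<noteq> par b'"
proof -
  have "adj w z" "adj w a" "adj w b" "adj w' z" "adj w' a'" "adj w' b'"
    using assms(4,5) unfolding neighbors_def by blast+
  then show "par a \<noteq> par a'" "par b \<noteq> par b'"
    using connecting_unique[of w z a w' a'] connecting_unique[of w z b w' b'] assms(1-3,6,7) by blast+
qed

text \<open>The two paths of length 3 run from \<open>s\<close> to \<open>v\<close>, through
  \<open>w\<close> and \<open>b\<close> and through \<open>w'\<close> and \<open>b'\<close>.\<close>

lemma no_hexagon:
  assumes "w \<in> L 4" "w' \<in> L 4" "v \<in> L 4" "s \<in> N w" "b \<in> N w" "b \<in> N v" "s \<in> N w'" "b' \<in> N w'" "b' \<in> N v"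
    "s \<noteq> b" "s \<noteq> b'" "w \<noteq> v"
  shows "b = b'"
  using unique_path_3[of s w b v w' b'] assms adj_sym by (auto simp: neighbors_def)

text \<open>The branches, \<open>y1\<close>, \<open>z1\<close> and \<open>w1\<close> are chosen
  freely. The further vertices at level 4 are alternately second upper neighbors of known leaves and
  antipodes; the leaves of the former are located by \<open>par_differ\<close> and the exclusion of
  hexagons. Locally \<open>w1\<close> to \<open>w4\<close> form the first class of the ordering and
  \<open>w5\<close> to \<open>w8\<close> the second.\<close>

lemma ordering_exists: "\<exists>u y z w. tutte_ordering adj x u y z w"
proof -
  have L1: "card (L 1) = 3" by (simp add: L_1 card_N)
  then obtain u1 u2 u3 where u: "L 1 = {u1, u2, u3}" "u1 \<noteq> u2" "u1 \<noteq> u3" "u2 \<noteq> u3"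
    unfolding card_3_iff by blast
  have "card {c \<in> L 2. par c = u1} = 2" using children[of u1 1] u by (simp add: numeral_2_eq_2)
  then have "{c \<in> L 2. par c = u1} \<noteq> {}" by (metis card.empty zero_neq_numeral)
  then obtain y1 where y1: "y1 \<in> L 2" "par y1 = u1" by blast
  have "card {c \<in> L 3. par c = y1} = 2" using children[of y1 2] y1 by simp
  then have "{c \<in> L 3. par c = y1} \<noteq> {}" by (metis card.empty zero_neq_numeral)
  then obtain z1 where z1: "z1 \<in> L 3" "par z1 = y1" by blast
  have "card (N z1 \<inter> L 4) = 2" using card_up[of x z1 3] z1(1) by (simp add: L_iff)
  then have "N z1 \<inter> L 4 \<noteq> {}" by (metis card.empty zero_neq_numeral)
  then obtain w1 where w1: "w1 \<in> L 4" "adj z1 w1" by (auto simp: neighbors_def)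
  have u': "L 1 = {u2, u1, u3}" "L 1 = {u3, u1, u2}" using u(1) by blast+
  obtain z5 z9 where N1: "N w1 = {z1, z5, z9}" and z5: "z5 \<in> L 3" "br z5 = u2" and z9: "z9 \<in> L 3" "br z9 = u3"
    using leaves_of[of w1 z1 u2 u3] w1 adj_sym z1 y1 u by metis
  define y3 y5 where "y3 = par z5" and "y5 = par z9"
  have y3: "y3 \<in> L 2" "par y3 = u2" "par z5 = y3" and y5: "y5 \<in> L 2" "par y5 = u3" "par z9 = y5"
    using z5 z9 par_L3 by (auto simp: y3_def y5_def)
  obtain y2 where y2: "y2 \<in> L 2" "par y2 = u1" "y2 \<noteq> y1" using sibling_ex[OF y1(1)] y1 by auto
  obtain y4 where y4: "y4 \<in> L 2" "par y4 = u2" "y4 \<noteq> y3" using sibling_ex[OF y3(1)] y3 by auto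
  obtain y6 where y6: "y6 \<in> L 2" "par y6 = u3" "y6 \<noteq> y5" using sibling_ex[OF y5(1)] y5 by auto
  obtain z2 where z2: "z2 \<in> L 3" "par z2 = y1" "z2 \<noteq> z1" using sibling_ex[OF z1(1)] z1 by auto
  obtain z6 where z6: "z6 \<in> L 3" "par z6 = y3" "z6 \<noteq> z5" using sibling_ex[OF z5(1)] y3 by auto
  obtain z10 where z10: "z10 \<in> L 3" "par z10 = y5" "z10 \<noteq> z9" using sibling_ex[OF z9(1)] y5 by auto
  \<comment> \<open>The second vertex above \<open>z1\<close>: its other leaves lie under
    \<open>y4\<close> and \<open>y6\<close>, since \<open>par_differ\<close> excludes the parents of
    \<open>z5\<close> and \<open>z9\<close>. These leaves receive the names \<open>z7\<close> and
    \<open>z11\<close>.\<close>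
  obtain w6 where w6: "w6 \<in> L 4" "adj z1 w6" "w6 \<noteq> w1" using other_up[OF z1(1) w1] .
  obtain z7 z11 where N6: "N w6 = {z1, z7, z11}" and z7: "z7 \<in> L 3" "br z7 = u2" and z11: "z11 \<in> L 3" "br z11 = u3"
    using leaves_of[of w6 z1 u2 u3] w6 adj_sym z1 y1 u by metis
  have "par z5 \<noteq> par z7" "par z9 \<noteq> par z11"
    using par_differ[OF w1(1) w6(1) w6(3)[symmetric] N1 N6] z1 y1 z5 z9 u by auto
  then have z7': "par z7 = y4" and z11': "par z11 = y6"
    using par_cases[OF y3(1) y4(1) _ y4(3) z7(1)] par_cases[OF y5(1) y6(1) _ y6(3) z11(1)] y3 y4 y5 y6 z7 z11
    by auto
  obtain z8 where z8: "z8 \<in> L 3" "par z8 = y4" "z8 \<noteq> z7" using sibling_ex[OF z7(1)] z7' by auto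
  obtain z12 where z12: "z12 \<in> L 3" "par z12 = y6" "z12 \<noteq> z11" using sibling_ex[OF z11(1)] z11' by auto
  \<comment> \<open>Antipodes of \<open>w1\<close> and \<open>w6\<close>: all leaves are replaced by
    their siblings.\<close>
  obtain w5 where w5: "w5 \<in> L 4" "N w5 = {z2, z6, z10}"
    using antipode[OF w1(1) N1, of z2 z6 z10] z1 z2 z6 z10 y1 y3 y5 u by auto
  obtain w2 where w2: "w2 \<in> L 4" "N w2 = {z2, z8, z12}"
    using antipode[OF w6(1) N6, of z2 z8 z12] z1 z2 z8 z12 y1 y4 y6 z7' z11' u by auto
  have "adj z5 w1" using N1 adj_sym by (auto simp: neighbors_def)
  \<comment> \<open>The second vertex above \<open>z5\<close>: its leaf in the first branch lies
    under \<open>y2\<close> and is named \<open>z3\<close>; its third leaf lies under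
    \<open>y6\<close>, so it is \<open>z11\<close> or \<open>z12\<close>.\<close>
  then obtain w8 where w8: "w8 \<in> L 4" "adj z5 w8" "w8 \<noteq> w1" using other_up[OF z5(1) w1(1)] by blast
  have N1': "N w1 = {z5, z1, z9}" using N1 by blast
  obtain z3 e where N8: "N w8 = {z5, z3, e}" and z3: "z3 \<in> L 3" "br z3 = u1" and e: "e \<in> L 3" "br e = u3"
    using leaves_of[of w8 z5 u1 u3] w8 adj_sym z5 u u'(1) by metis
  have "par z1 \<noteq> par z3" "par z9 \<noteq> par e"
    using par_differ[OF w1(1) w8(1) w8(3)[symmetric] N1' N8] z1 y1 z5 z9 u by auto
  then have z3': "par z3 = y2" and e': "par e = y6"
    using par_cases[OF y1(1) y2(1) _ y2(3) z3(1)] par_cases[OF y5(1) y6(1) _ y6(3) e(1)] y1 y2 y5 y6 z1 z3 e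
    by auto
  \<comment> \<open>Otherwise \<open>z1\<close>, \<open>w1\<close>, \<open>z5\<close>,
    \<open>w8\<close>, \<open>z11\<close>, \<open>w6\<close> would form a hexagon.\<close>
  have "e \<noteq> z11"
  proof
    assume "e = z11"
    then have "z5 = z11"
      using no_hexagon[of w1 w6 w8 z1 z5 z11] w1 w6 w8 N1 N6 N8 z1 y1 z5 z11 u by auto
    then show False using z5 z11 u by simp
  qed
  then have e12: "e = z12" using sibling_cases[of z11 z12 e] z11 z12 z11' e e' by auto
  then have N8: "N w8 = {z3, z5, z12}" using N8 by blast
  obtain z4 where z4: "z4 \<in> L 3" "par z4 = y2" "z4 \<noteq> z3" using sibling_ex[OF z3(1)] z3' by auto
  obtain w4 where w4: "w4 \<in> L 4" "N w4 = {z4, z6, z11}"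
    using antipode[OF w8(1) N8, of z4 z6 z11] z3' z4 z6 z11 z12 y2 y3 y6 z11' u by auto
  have "adj z3 w8" using N8 adj_sym by (auto simp: neighbors_def)
  \<comment> \<open>The second vertex above \<open>z3\<close>: its leaves under \<open>y5\<close>
    and \<open>y4\<close> are found by excluding the hexagons \<open>z3\<close>, \<open>w8\<close>,
    \<open>z5\<close>, \<open>w1\<close>, \<open>z9\<close>, \<open>w3\<close> and
    \<open>z3\<close>, \<open>w8\<close>, \<open>z12\<close>, \<open>w2\<close>, \<open>z8\<close>,
    \<open>w3\<close>.\<close>
  then obtain w3 where w3: "w3 \<in> L 4" "adj z3 w3" "w3 \<noteq> w8" using other_up[OF z3(1) w8(1)] by blast
  obtain p q where N3: "N w3 = {z3, p, q}" and p: "p \<in> L 3" "br p = u2" and q: "q \<in> L 3" "br q = u3"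
    using leaves_of[of w3 z3 u2 u3] w3 adj_sym z3 u by metis
  have "par z5 \<noteq> par p" "par z12 \<noteq> par q"
    using par_differ[OF w8(1) w3(1) w3(3)[symmetric] N8 N3] z3 z5 z12 y6 u by auto
  then have p': "par p = y4" and q': "par q = y5"
    using par_cases[OF y3(1) y4(1) _ y4(3) p(1)] par_cases[OF y5(1) y6(1) _ y6(3) q(1)] y3 y4 y5 y6 z12 p q
    by auto
  have "q \<noteq> z9"
  proof
    assume "q = z9"
    then have "z5 = z9"
      using no_hexagon[of w8 w3 w1 z3 z5 z9] w1 w3 w8 N1 N3 N8 z3 z5 z9 u by auto
    then show False using z5 z9 u by simp
  qed
  then have q10: "q = z10" using sibling_cases[of z9 z10 q] z9 z10 y5 q q' by auto
  have w28: "w8 \<noteq> w2"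
    using N8 w2(2) z2 z3 z3' z8 z12 y1 y2 y4 y6 u by auto
  have "p \<noteq> z8"
  proof
    assume "p = z8"
    then have "z12 = z8"
      using no_hexagon[of w8 w3 w2 z3 z12 z8] w2 w3 w8 N3 N8 w28 z3 z8 z12 y4 y6 u by auto
    then show False using z8 z12 y4 y6 u by auto
  qed
  then have p7: "p = z7" using sibling_cases[of z7 z8 p] z7 z8 z7' p p' by auto
  have N3: "N w3 = {z3, z7, z10}" using N3 p7 q10 by blast
  obtain w7 where w7: "w7 \<in> L 4" "N w7 = {z4, z8, z9}"
    using antipode[OF w3(1) N3, of z4 z8 z9] z3' z4 z8 z9 z10 y2 y4 y5 z7' u by auto
  note ys = y1 y2 y3 y4 y5 y6
  have dy: "distinct [y1, y2, y3, y4, y5, y6]" using ys u by auto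
  have pz: "map par [z1, z2, z3, z4, z5, z6, z7, z8, z9, z10, z11, z12] =
      [y1, y1, y2, y2, y3, y3, y4, y4, y5, y5, y6, y6]"
    using z1 z2 z3' z4 y3 z6 z7' z8 y5 z10 z11' z12 by simp
  have dz: "distinct [z1, z2, z3, z4, z5, z6, z7, z8, z9, z10, z11, z12]"
    using pz dy z2 z4 z6 z8 z10 z12 by auto
  have L2: "y \<in> L 2 \<longleftrightarrow> y \<in> {y1, y2, y3, y4, y5, y6}" for y
  proof
    assume y: "y \<in> L 2"
    then have "par y = u1 \<or> par y = u2 \<or> par y = u3" using par_L2(2)[OF y] u(1) by blast
    moreover have "y \<in> {a, b}" if "a \<in> L 2" "b \<in> L 2" "par b = par a" "b \<noteq> a" "par y = par a" for a b
    proof -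
      obtain c where "\<And>v. v \<in> L 2 \<Longrightarrow> par v = par a \<Longrightarrow> v = a \<or> v = c" using sibling[OF \<open>a \<in> L 2\<close>] by blast
      then have "b = c" "y = a \<or> y = c" using that y by blast+
      then show ?thesis by blast
    qed
    ultimately show "y \<in> {y1, y2, y3, y4, y5, y6}" using ys by fastforce
  qed (use ys in blast)
  have L3: "z \<in> L 3 \<longleftrightarrow> z \<in> {z1, z2, z3, z4, z5, z6, z7, z8, z9, z10, z11, z12}" for z
  proof
    assume z: "z \<in> L 3"
    then have "par z \<in> {y1, y2, y3, y4, y5, y6}" using par_L3(2)[OF z] L2 by blast
    then show "z \<in> {z1, z2, z3, z4, z5, z6, z7, z8, z9, z10, z11, z12}"
      using sibling_cases[of z1 z2 z] sibling_cases[of z3 z4 z] sibling_cases[of z5 z6 z]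
        sibling_cases[of z7 z8 z] sibling_cases[of z9 z10 z] sibling_cases[of z11 z12 z]
        z z1 z2 z3(1) z3' z4 z5(1) y3 z6 z7(1) z7' z8 z9(1) y5 z10 z11(1) z11' z12
      by auto
  qed (use z1 z2 z3 z4 z5 z6 z7 z8 z9 z10 z11 z12 in blast)
  have w: "{w1, w2, w3, w4, w5, w6, w7, w8} \<subseteq> L 4" using w1 w2 w3 w4 w5 w6 w7 w8 by blast
  have Nw: "map N [w1, w2, w3, w4, w5, w6, w7, w8] =
      [{z1, z5, z9}, {z2, z8, z12}, {z3, z7, z10}, {z4, z6, z11},
       {z2, z6, z10}, {z1, z7, z11}, {z4, z8, z9}, {z3, z5, z12}]"
    by (simp only: N1 N3 N6 N8 w2 w4 w5 w7 list.map)
  have py: "map par [y1, y2, y3, y4, y5, y6] = [u1, u1, u2, u2, u3, u3]" using ys by simp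
  have dN: "distinct (map N [w1, w2, w3, w4, w5, w6, w7, w8])"
    unfolding Nw by (rule distinct_triples[OF dz])
  then have dw: "distinct [w1, w2, w3, w4, w5, w6, w7, w8]" unfolding distinct_map by blast
  have up: "adj v a" if "v \<in> L 4" "a \<in> N v" for v a using that by (simp add: neighbors_def)
  \<comment> \<open>Every vertex at level 4 has a leaf in the first branch, that is, among
    \<open>z1\<close> to \<open>z4\<close>, and both upper neighbors of each of these are already
    named.\<close>
  have L4: "v \<in> {w1, w2, w3, w4, w5, w6, w7, w8}" if v: "v \<in> L 4" for v
  proof -
    obtain a where a: "adj v a" "br a = u1" using leaf_in_branch[OF v, of u1] u(1) by blast
    have aL: "a \<in> L 3" using N_L4[OF v a(1)] .
    have av: "adj a v" using adj_sym a by blast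
    have 4: "a = z1 \<or> a = z2 \<or> a = z3 \<or> a = z4"
      using aL a(2) py pz u unfolding L3 by auto
    have e: "adj b c" if "b \<in> N c" for b c using that adj_sym by (simp add: neighbors_def)
    have "w1 \<in> L 4" "w2 \<in> L 4" "w3 \<in> L 4" "w4 \<in> L 4" "w5 \<in> L 4" "w6 \<in> L 4" "w7 \<in> L 4" "w8 \<in> L 4"
      using w by auto
    moreover have "adj z1 w1" "adj z1 w6" "adj z2 w2" "adj z2 w5" "adj z3 w3" "adj z3 w8" "adj z4 w4" "adj z4 w7"
      using Nw by (auto intro!: e)
    moreover have "w1 \<noteq> w6" "w2 \<noteq> w5" "w3 \<noteq> w8" "w4 \<noteq> w7" using dw by auto
    ultimately show ?thesis
      using 4 up_only[OF aL _ _ _ _ _ v av] by (elim disjE) blast+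
  qed
  let ?u = "\<lambda>i. [u1, u2, u3] ! (i - 1)"
  let ?y = "\<lambda>i. [y1, y2, y3, y4, y5, y6] ! (i - 1)"
  let ?z = "\<lambda>i. [z1, z2, z3, z4, z5, z6, z7, z8, z9, z10, z11, z12] ! (i - 1)"
  \<comment> \<open>The list puts \<open>w1\<close> to \<open>w4\<close> at the positions 1, 4, 5, 8
    and \<open>w5\<close> to \<open>w8\<close> at 2, 3, 6, 7.\<close>
  let ?w = "\<lambda>i. [w1, w5, w6, w2, w3, w7, w8, w4] ! (i - 1)"
  have 16: "{1..6::nat} = {1, 2, 3, 4, 5, 6}" by (simp add: set_eq_iff) linarith
  have Nz: "N b \<inter> L 3 = {a, c}" if b: "b \<in> L 2" "a \<in> L 3" "c \<in> L 3" "par a = b" "par c = b" "a \<noteq> c" for a b c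
  proof -
    have "card (N b \<inter> L 3) = 2" using card_up[of x b 2] b by (simp add: L_iff)
    moreover have "adj b a" "adj b c" using par_L3(1)[of a] par_L3(1)[of c] b by simp_all
    ultimately show ?thesis using b by (intro card_subset_eq[symmetric]) (auto simp: neighbors_def)
  qed
  have "tutte_ordering adj x ?u ?y ?z ?w"
    unfolding tutte_ordering_def
  proof (intro conjI)
    show "bij_betw ?u {1..3} (L 1)" by (rule bij_betw_nth_1) (use u in auto)
    show "bij_betw ?y {1..6} (L 2)" by (rule bij_betw_nth_1) (use L2 dy in auto)
    show "bij_betw ?z {1..12} (L 3)" by (rule bij_betw_nth_1) (use L3 dz in auto)
    show "bij_betw ?w {1..8} (L 4)" by (rule bij_betw_nth_1) (use w L4 dw in auto)
    have "\<And>y. y \<in> L 2 \<Longrightarrow> par y \<in> L 1 \<and> adj (par y) y" using par_L2 by blast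
    then show "\<forall>(i, j)\<in>{(1, 2), (3, 4), (5, 6)}. \<exists>v\<in>L 1. adj v (?y i) \<and> adj v (?y j)"
      using L2 py by simp metis
    show "\<forall>j\<in>{1..6}. N (?y j) \<inter> L 3 = {?z (2 * j - 1), ?z (2 * j)}"
      unfolding 16 using Nz[of y1 z1 z2] Nz[of y2 z3 z4] Nz[of y3 z5 z6] Nz[of y4 z7 z8] Nz[of y5 z9 z10]
        Nz[of y6 z11 z12] L2 L3 dz pz by simp
    show "(\<lambda>k. N (?w k)) ` {1, 4, 5, 8} = {{?z 1, ?z 5, ?z 9}, {?z 2, ?z 8, ?z 12}, {?z 3, ?z 7, ?z 10}, {?z 4, ?z 6, ?z 11}}"
      using Nw by simp
    show "(\<lambda>k. N (?w k)) ` {2, 3, 6, 7} = {{?z 2, ?z 6, ?z 10}, {?z 1, ?z 7, ?z 11}, {?z 4, ?z 8, ?z 9}, {?z 3, ?z 5, ?z 12}}"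
      using Nw by simp
  qed
  then show ?thesis by blast
qed

end

section \<open>From an ordering of the spheres to the fixed labelled graph\<close>

context rooted_tutte_graph
begin

text \<open>The listed edges supply three distinct neighbors of every vertex, and the valency is 3,
  so there are no others.\<close>

lemma neighbors_from_edges:
  assumes len: "length vs = 30" and dist: "distinct vs"
    and edges: "\<forall>(i, j)\<in>set edges. adj (vs ! i) (vs ! j)" and i: "i < 30"
  shows "N (vs ! i) = (!) vs ` set (nbr_table ! i)"
proof -
  have "i \<in> set [0..<30]" using i by simp
  from bspec[OF check_nbr_table this]
  have nb: "length (nbr_table ! i) = 3" "distinct (nbr_table ! i)"
    "\<And>j. j \<in> set (nbr_table ! i) \<Longrightarrow> j < 30 \<and> i \<in> set (nbr_table ! j) \<and> i \<noteq> j"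
    by blast+
  have adj: "adj (vs ! i) (vs ! j)" if "i < 30" "j < 30" "j \<in> set (nbr_table ! i)" "i < j" for i j
  proof -
    have "(i, j) \<in> set edges" using that by (auto simp: edges_def)
    then show ?thesis using edges by blast
  qed
  have sub: "(!) vs ` set (nbr_table ! i) \<subseteq> N (vs ! i)"
  proof
    fix v assume "v \<in> (!) vs ` set (nbr_table ! i)"
    then obtain j where j: "j \<in> set (nbr_table ! i)" "v = vs ! j" by blast
    note n = nb(3)[OF j(1)]
    show "v \<in> N (vs ! i)"
    proof (cases "i < j")
      case True
      then show ?thesis using adj[of i j] i j n by (simp add: neighbors_def)
    next
      case False
      then have "adj (vs ! j) (vs ! i)" using adj[of j i] i j n by simp
      then show ?thesis using adj_sym j(2) by (simp add: neighbors_def)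
    qed
  qed
  have "inj_on ((!) vs) (set (nbr_table ! i))"
    by (rule inj_on_nth[OF dist]) (use nb(3) len in auto)
  then have "card ((!) vs ` set (nbr_table ! i)) = card (N (vs ! i))"
    using nb(1,2) by (simp add: card_image card_N distinct_card)
  with sub show ?thesis by (metis card_subset_eq finite)
qed

text \<open>A graph isomorphism from the fixed graph onto \<open>adj\<close> that sends 0 to the
  base vertex, written as the list of its values.\<close>

definition labelling :: "'a list \<Rightarrow> bool" where
  "labelling vs \<longleftrightarrow> length vs = 30 \<and> distinct vs \<and> set vs = UNIV \<and>
     (\<forall>i<30. N (vs ! i) = (!) vs ` set (nbr_table ! i)) \<and> (\<forall>i<30. d x (vs ! i) = levels ! i)"

text \<open>
  In a labelling the vertices at distances 1 and 4 are numbered by their neighbors; the numbering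
  \<open>u\<close> is the labelling up to the permutation \<open>s\<close>, and \<open>w\<close> up to permutations within two classes.
\<close>

lemma labelling_exists:
  assumes card_X: "CARD('a) = 30" and ord: "tutte_ordering adj x u y z w"
  shows "\<exists>vs s. labelling vs \<and> s \<in> set perms \<and> (\<forall>j<3. u (s ! j + 1) = vs ! (j + 1)) \<and>
    (\<forall>j\<in>{1..6}. y j = vs ! (j + 3)) \<and> (\<forall>j\<in>{1..12}. z j = vs ! (j + 9)) \<and>
    (\<forall>k\<in>{1, 4, 5, 8}. \<exists>j\<in>{22, 23, 24, 25}. w k = vs ! j) \<and>
    (\<forall>k\<in>{2, 3, 6, 7}. \<exists>j\<in>{26, 27, 28, 29}. w k = vs ! j)"
proof -
  note o1 = ord[unfolded tutte_ordering_def]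
  note o2 = conjunct2[OF o1] note o3 = conjunct2[OF o2] note o4 = conjunct2[OF o3]
  note o5 = conjunct2[OF o4] note o6 = conjunct2[OF o5] note o7 = conjunct2[OF o6]
  note bu = conjunct1[OF o1] and by_ = conjunct1[OF o2] and bz = conjunct1[OF o3]
    and bw = conjunct1[OF o4] and pairs = conjunct1[OF o5] and yz = conjunct1[OF o6]
    and wp = conjunct1[OF o7] and wm = conjunct2[OF o7]
  have upt: "{1..3::nat} = set [1, 2, 3]" "{1..6::nat} = set [1, 2, 3, 4, 5, 6]"
    "{1..12::nat} = set [1, 2, 3, 4, 5, 6, 7, 8, 9, 10, 11, 12]" "{1..8::nat} = set [1, 2, 3, 4, 5, 6, 7, 8]"
    by code_simp+
  have dist: "distinct (map f xs)" if "bij_betw f (set xs) A" "distinct xs" for f :: "nat \<Rightarrow> 'a" and xs A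
    using that by (simp add: distinct_map bij_betw_def)
  have im: "set (map f xs) = A" if "bij_betw f (set xs) A" for f :: "nat \<Rightarrow> 'a" and xs A
    using that by (simp add: bij_betw_def)
  have dy: "distinct [y 1, y 2, y 3, y 4, y 5, y 6]" and Ly: "set [y 1, y 2, y 3, y 4, y 5, y 6] = L 2"
    using dist[of y "[1, 2, 3, 4, 5, 6]"] im[of y "[1, 2, 3, 4, 5, 6]"] by_ unfolding upt by simp_all
  have dz: "distinct [z 1, z 2, z 3, z 4, z 5, z 6, z 7, z 8, z 9, z 10, z 11, z 12]"
    and Lz: "set [z 1, z 2, z 3, z 4, z 5, z 6, z 7, z 8, z 9, z 10, z 11, z 12] = L 3"
    using dist[of z "[1, 2, 3, 4, 5, 6, 7, 8, 9, 10, 11, 12]"] im[of z "[1, 2, 3, 4, 5, 6, 7, 8, 9, 10, 11, 12]"] bz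
    unfolding upt by simp_all
  obtain v1 v2 v3 where v: "v1 \<in> L 1" "adj v1 (y 1)" "adj v1 (y 2)" "v2 \<in> L 1" "adj v2 (y 3)" "adj v2 (y 4)"
    "v3 \<in> L 1" "adj v3 (y 5)" "adj v3 (y 6)"
    using pairs by auto
  \<comment> \<open>A vertex at level 1 has only two upper neighbors; hence the common neighbors of
    the three pairs are distinct.\<close>
  have three: "\<not> (adj v a \<and> adj v b \<and> adj v c)"
    if "v \<in> L 1" "a \<in> L 2" "b \<in> L 2" "c \<in> L 2" "a \<noteq> b" "a \<noteq> c" "b \<noteq> c" for v a b c
  proof
    assume "adj v a \<and> adj v b \<and> adj v c"
    then have "{a, b, c} \<subseteq> N v \<inter> L 2" using that by (auto simp: neighbors_def)
    then have "card {a, b, c} \<le> card (N v \<inter> L 2)" by (intro card_mono) auto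
    then show False using card_up[of x v 1] that by (simp add: L_iff numeral_2_eq_2)
  qed
  have yL: "y 1 \<in> L 2" "y 2 \<in> L 2" "y 3 \<in> L 2" "y 4 \<in> L 2" "y 5 \<in> L 2" "y 6 \<in> L 2"
    using Ly by auto
  have dv: "distinct [v1, v2, v3]"
    using three[OF v(1) yL(1,2,3)] three[OF v(1) yL(1,2,5)] three[OF v(4) yL(3,4,5)] v dy by auto
  have N1: "N w' = S \<Longrightarrow> w' \<in> L 4 \<Longrightarrow> a \<in> S \<Longrightarrow> adj w' a" for w' S a by (auto simp: neighbors_def)
  have ex: "\<exists>w'\<in>L 4. (\<exists>k\<in>K. w' = w k) \<and> N w' = S"
    if "(\<lambda>k. N (w k)) ` K = \<S>" "S \<in> \<S>" "K \<subseteq> {1..8}" for K \<S> S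
  proof -
    have "S \<in> (\<lambda>k. N (w k)) ` K" using that by simp
    then obtain k where "k \<in> K" "N (w k) = S" by blast
    moreover have "w k \<in> L 4" using bw that(3) \<open>k \<in> K\<close> bij_betwE by blast
    ultimately show ?thesis by blast
  qed
  \<comment> \<open>The ordering gives the neighbor sets within each class only up to a permutation,
    so the vertices at level 4 are renamed by their neighbor sets.\<close>
  obtain t1 where t1: "t1 \<in> L 4" "N t1 = {z 1, z 5, z 9}" using ex[OF wp, of "{z 1, z 5, z 9}"] by auto
  obtain t2 where t2: "t2 \<in> L 4" "N t2 = {z 2, z 8, z 12}" using ex[OF wp, of "{z 2, z 8, z 12}"] by auto
  obtain t3 where t3: "t3 \<in> L 4" "N t3 = {z 3, z 7, z 10}" using ex[OF wp, of "{z 3, z 7, z 10}"] by auto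
  obtain t4 where t4: "t4 \<in> L 4" "N t4 = {z 4, z 6, z 11}" using ex[OF wp, of "{z 4, z 6, z 11}"] by auto
  obtain t5 where t5: "t5 \<in> L 4" "N t5 = {z 2, z 6, z 10}" using ex[OF wm, of "{z 2, z 6, z 10}"] by auto
  obtain t6 where t6: "t6 \<in> L 4" "N t6 = {z 1, z 7, z 11}" using ex[OF wm, of "{z 1, z 7, z 11}"] by auto
  obtain t7 where t7: "t7 \<in> L 4" "N t7 = {z 4, z 8, z 9}" using ex[OF wm, of "{z 4, z 8, z 9}"] by auto
  obtain t8 where t8: "t8 \<in> L 4" "N t8 = {z 3, z 5, z 12}" using ex[OF wm, of "{z 3, z 5, z 12}"] by auto
  note t = t1 t2 t3 t4 t5 t6 t7 t8
  have "distinct (map N [t1, t2, t3, t4, t5, t6, t7, t8])"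
    unfolding list.map t by (rule distinct_triples[OF dz])
  then have dt: "distinct [t1, t2, t3, t4, t5, t6, t7, t8]" unfolding distinct_map by blast
  define vs where "vs = [x] @ [v1, v2, v3] @ [y 1, y 2, y 3, y 4, y 5, y 6] @
    [z 1, z 2, z 3, z 4, z 5, z 6, z 7, z 8, z 9, z 10, z 11, z 12] @ [t1, t2, t3, t4, t5, t6, t7, t8]"
  have len: "length vs = 30" by (simp add: vs_def)
  have Lv: "set [v1, v2, v3] \<subseteq> L 1" using v by auto
  have Lt: "set [t1, t2, t3, t4, t5, t6, t7, t8] \<subseteq> L 4" using t by auto
  have Lx: "set [x] = L 0" by (simp add: L_0)
  have disj: "A \<inter> B = {}" if "A \<subseteq> L i" "B \<subseteq> L j" "i \<noteq> j" for A B i j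
    using that L_disjoint by blast
  have dvs: "distinct vs"
    unfolding vs_def distinct_append set_append Lx Ly Lz Int_Un_distrib
    using disj[OF subset_refl Lv, of 0] disj[OF subset_refl Lt] disj[OF Lv Lt] disj[OF Lv subset_refl] disj[OF subset_refl subset_refl]
      dv dy dz dt by simp
  have "card (set vs) = CARD('a)" using len dvs card_X by (simp add: distinct_card)
  then have UN: "set vs = UNIV" by (intro card_subset_eq) auto
  have map_d: "map (d x) vs = levels"
  proof -
    have m: "map (d x) us = replicate (length us) i" if "set us \<subseteq> L i" for us i
      using that by (induction us) (auto simp: L_iff)
    have "map (d x) vs = replicate (length [x]) 0 @ replicate (length [v1, v2, v3]) 1 @
        replicate (length [y 1, y 2, y 3, y 4, y 5, y 6]) 2 @
        replicate (length [z 1, z 2, z 3, z 4, z 5, z 6, z 7, z 8, z 9, z 10, z 11, z 12]) 3 @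
        replicate (length [t1, t2, t3, t4, t5, t6, t7, t8]) 4"
      unfolding vs_def map_append m[OF Lv] m[OF Lt] m[OF equalityD1[OF Lx]] m[OF equalityD1[OF Ly]] m[OF equalityD1[OF Lz]] ..
    then show ?thesis by (simp add: levels_def numeral_eq_Suc)
  qed
  have lev: "d x (vs ! i) = levels ! i" if "i < 30" for i
    unfolding map_d[symmetric] using that len by simp
  have zy: "adj (y j) (z (2 * j - 1)) \<and> adj (y j) (z (2 * j))" if "j \<in> {1..6}" for j
    using yz that by (auto simp: neighbors_def)
  have zt: "adj a b" if "a \<in> N b" for a b using that adj_sym by (simp add: neighbors_def)
  have xv: "adj x a" if "a \<in> L 1" for a using that by (simp add: L_1 neighbors_def)
  have e: "\<forall>(i, j)\<in>set edges. adj (vs ! i) (vs ! j)"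
    unfolding edges_eq vs_def
    using xv v zy[of 1] zy[of 2] zy[of 3] zy[of 4] zy[of 5] zy[of 6] by (simp add: zt t)
  have lab: "labelling vs"
    using neighbors_from_edges[OF len dvs e] len dvs UN lev by (simp add: labelling_def)
  have "\<exists>a<3. u (a + 1) = v" if "v \<in> L 1" for v
  proof -
    have "v \<in> u ` {1..3}" using that by (simp only: bij_betw_imp_surj_on[OF bu])
    then obtain k where "k \<in> {1..3}" "u k = v" by blast
    then show ?thesis by (intro exI[of _ "k - 1"]) auto
  qed
  \<comment> \<open>Positions of the parents \<open>v1\<close>, \<open>v2\<close>, \<open>v3\<close>
    in the arbitrary order \<open>u\<close>; they make up the permutation \<open>s\<close>.\<close>
  then obtain a b c where abc: "a < 3" "b < 3" "c < 3" "u (a + 1) = v1" "u (b + 1) = v2" "u (c + 1) = v3"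
    using v by metis
  have "a \<noteq> b" "a \<noteq> c" "b \<noteq> c" using abc dv by auto
  have j3: "j = 0 \<or> j = 1 \<or> j = 2" if "j < 3" for j :: nat using that by linarith
  have perm: "[a, b, c] \<in> set perms"
    using j3[OF abc(1)] j3[OF abc(2)] j3[OF abc(3)] \<open>a \<noteq> b\<close> \<open>a \<noteq> c\<close> \<open>b \<noteq> c\<close>
    by (elim disjE) (simp_all add: perms_def)
  have us: "\<forall>j<3. u ([a, b, c] ! j + 1) = vs ! (j + 1)"
    using abc by (auto dest!: j3 simp: vs_def)
  have ys: "\<forall>j\<in>{1..6}. y j = vs ! (j + 3)" unfolding upt by (simp add: vs_def)
  have zs: "\<forall>j\<in>{1..12}. z j = vs ! (j + 9)" unfolding upt by (simp add: vs_def)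
  \<comment> \<open>Two common neighbors already suffice, because there are no
    quadrilaterals.\<close>
  have inj: "a = b" if "a \<in> L 4" "b \<in> L 4" "N a = N b" for a b
  proof -
    obtain p q r where pq: "N a = {p, q, r}" "p \<noteq> q"
      using card_N[of a] unfolding card_3_iff by blast
    then have "p \<in> N a" "q \<in> N a" "p \<in> N b" "q \<in> N b" using that(3) by auto
    then have "adj p a" "adj a q" "adj p b" "adj b q" using adj_sym unfolding neighbors_def by blast+
    then show ?thesis using unique_path_2[of p a q b] pq(2) by blast
  qed
  have wL: "w k \<in> L 4" if "k \<in> {1..8}" for k using bw that bij_betwE by blast
  have ws1: "\<forall>k\<in>{1, 4, 5, 8}. \<exists>j\<in>{22, 23, 24, 25}. w k = vs ! j"
  proof
    fix k :: nat assume k: "k \<in> {1, 4, 5, 8}"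
    then have "N (w k) \<in> (\<lambda>k. N (w k)) ` {1, 4, 5, 8}" by (rule imageI)
    then have "N (w k) = N t1 \<or> N (w k) = N t2 \<or> N (w k) = N t3 \<or> N (w k) = N t4"
      by (simp only: wp t insert_iff empty_iff simp_thms)
    moreover have "w k \<in> L 4" using k by (intro wL) auto
    ultimately have "w k = t1 \<or> w k = t2 \<or> w k = t3 \<or> w k = t4" 
      using inj[of "w k" t1] inj[of "w k" t2] inj[of "w k" t3] inj[of "w k" t4] t by argo
    then show "\<exists>j\<in>{22, 23, 24, 25}. w k = vs ! j" by (auto simp: vs_def)
  qed
  have ws2: "\<forall>k\<in>{2, 3, 6, 7}. \<exists>j\<in>{26, 27, 28, 29}. w k = vs ! j"
  proof
    fix k :: nat assume k: "k \<in> {2, 3, 6, 7}"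
    then have "N (w k) \<in> (\<lambda>k. N (w k)) ` {2, 3, 6, 7}" by (rule imageI)
    then have "N (w k) = N t5 \<or> N (w k) = N t6 \<or> N (w k) = N t7 \<or> N (w k) = N t8"
      by (simp only: wm t insert_iff empty_iff simp_thms)
    moreover have "w k \<in> L 4" using k by (intro wL) auto
    ultimately have "w k = t5 \<or> w k = t6 \<or> w k = t7 \<or> w k = t8" 
      using inj[of "w k" t5] inj[of "w k" t6] inj[of "w k" t7] inj[of "w k" t8] t by argo
    then show "\<exists>j\<in>{26, 27, 28, 29}. w k = vs ! j" by (auto simp: vs_def)
  qed
  show ?thesis using lab perm us ys zs ws1 ws2 by blast
qed

end

section \<open>Symmetric matrices with an orthogonal eigenbasis\<close>

text \<open>In the orthogonal expansion of an eigenvector every coefficient is multiplied by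
  \<open>ev i - \<theta>\<close> and the result vanishes, so only the basis vectors with the
  eigenvalue \<open>\<theta>\<close> survive.\<close>

lemma eigenspace_dim:
  fixes M :: "complex ^ 'v::finite ^ 'v"
  assumes f: "orthogonal_family I f" and card: "card I = CARD('v)"
    and ev: "\<And>i. i \<in> I \<Longrightarrow> M *v f i = ev i *s f i"
  shows "vec.dim (eigenspace M \<theta>) = card {i \<in> I. ev i = \<theta>}"
proof -
  let ?J = "{i \<in> I. ev i = \<theta>}"
  have fin: "finite I" using f by (simp add: orthogonal_family_def)
  have fJ: "orthogonal_family ?J f" using f by (auto simp: orthogonal_family_def)
  have "eigenspace M \<theta> = vec.span (f ` ?J)"
  proof (intro equalityI subsetI)
    fix v assume "v \<in> eigenspace M \<theta>"
    then have v: "M *v v = \<theta> *s v" by (simp add: eigenspace_def)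
    define a where "a i = hermitian_inner v (f i) / hermitian_inner (f i) (f i)" for i
    have "v \<in> vec.span (f ` I)" by (simp add: orthogonal_family_span_UNIV[OF f card])
    from orthogonal_family_expansion[OF f this] have va: "v = (\<Sum>i\<in>I. a i *s f i)"
      by (simp only: a_def)
    have "0 = M *v v - \<theta> *s v" by (simp add: v)
    also have "\<dots> = (\<Sum>i\<in>I. (a i * (ev i - \<theta>)) *s f i)"
      by (subst (1 2) va) (simp add: vec.sum vec.scale ev vec.scale_sum_right sum_subtractf[symmetric]
          algebra_simps vec.scale_left_diff_distrib)
    finally have z: "(\<Sum>i\<in>I. (a i * (ev i - \<theta>)) *s f i) = 0" by simp
    have "a j = 0" if j: "j \<in> I" "ev j \<noteq> \<theta>" for j
    proof -
      have "0 = hermitian_inner (\<Sum>i\<in>I. (a i * (ev i - \<theta>)) *s f i) (f j)" by (simp add: z)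
      also have "\<dots> = (\<Sum>i\<in>I. if i = j then a j * (ev j - \<theta>) * hermitian_inner (f j) (f j) else 0)"
        unfolding hermitian_inner_sum_left hermitian_inner_scale_left
        using f j by (intro sum.cong) (auto simp: orthogonal_family_def)
      also have "\<dots> = a j * (ev j - \<theta>) * hermitian_inner (f j) (f j)" using j fin by simp
      finally show ?thesis using j f by (simp add: orthogonal_family_def)
    qed
    then have "\<forall>i\<in>I - ?J. a i *s f i = 0" by simp
    with fin have "(\<Sum>i\<in>I. a i *s f i) = (\<Sum>i\<in>?J. a i *s f i)"
      by (intro sum.mono_neutral_right) auto
    then have "v = (\<Sum>i\<in>?J. a i *s f i)" using va by metis
    then show "v \<in> vec.span (f ` ?J)"
      by (auto intro!: vec.span_sum vec.span_scale intro: vec.span_base)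
  next
    fix v assume "v \<in> vec.span (f ` ?J)"
    then have "M *v v = \<theta> *s v"
    proof (induction rule: vec.span_induct_alt)
      case (step c u w)
      then obtain i where "i \<in> I" "ev i = \<theta>" "u = f i" by auto
      then have "M *v u = \<theta> *s u" using ev by simp
      then show ?case using step
        by (simp add: matrix_vector_right_distrib vec.scale vec.scale_right_distrib mult.commute)
    qed simp
    then show "v \<in> eigenspace M \<theta>" by (simp add: eigenspace_def)
  qed
  then show ?thesis
    using fJ by (simp add: vec.dim_eq_card_independent orthogonal_family_independent card_image
        orthogonal_family_inj_on)
qed

lemma adj_matrix_adjoint:
  assumes "symp adj"
  shows "hermitian_inner (adj_matrix adj *v u) v = hermitian_inner u (adj_matrix adj *v v)"
proof -
  have a: "adj y z \<longleftrightarrow> adj z y" for y z using assms by (metis sympD)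
  have "hermitian_inner (adj_matrix adj *v u) v = (\<Sum>y\<in>UNIV. \<Sum>z\<in>UNIV. (if adj y z then u $ z * cnj (v $ y) else 0))"
    unfolding hermitian_inner_def adj_matrix_def matrix_vector_mult_def
    by (auto simp: sum_distrib_right intro!: sum.cong)
  also have "\<dots> = (\<Sum>z\<in>UNIV. \<Sum>y\<in>UNIV. (if adj z y then u $ z * cnj (v $ y) else 0))"
    by (subst sum.swap) (simp only: a)
  also have "\<dots> = hermitian_inner u (adj_matrix adj *v v)"
    unfolding hermitian_inner_def adj_matrix_def matrix_vector_mult_def
    by (auto simp: sum_distrib_left intro!: sum.cong)
  finally show ?thesis .
qed

text \<open>Integer eigenvalues are invariant under conjugation, so the adjoint identity compares
  the same inner product with two different factors.\<close>

lemma eigenvectors_orthogonal: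
  assumes "symp adj" "adj_matrix adj *v u = of_int \<theta> *s u" "adj_matrix adj *v v = of_int \<eta> *s v" "\<theta> \<noteq> \<eta>"
  shows "hermitian_inner u v = 0"
proof -
  have "of_int \<theta> * hermitian_inner u v = of_int \<eta> * hermitian_inner u v"
    using adj_matrix_adjoint[OF assms(1), of u v]
    by (simp add: assms hermitian_inner_scale_left hermitian_inner_scale_right)
  then show ?thesis using assms(4) by simp
qed


section \<open>The thirty ladder vectors in coordinates\<close>

lemma UNIV_summand: "UNIV = set summands"
proof -
  have "k \<in> set summands" for k by (cases k) (simp_all add: summands_def)
  then show ?thesis by blast
qed

instance summand :: finite
  by standard (simp add: UNIV_summand)

lemma len_summands: "length summands = 13"
  by (simp add: summands_def)

lemma sum_summands: "(\<Sum>k\<in>UNIV. f k) = sum_list (map f summands)"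
proof -
  have "distinct summands" by (simp add: summands_def)
  then show ?thesis by (simp add: UNIV_summand sum_list_distinct_conv_sum_set)
qed

lemma sum_5: "(\<Sum>i<5::nat. f i) = f 0 + f 1 + f 2 + f 3 + (f 4 :: 'b::comm_monoid_add)"
  by (simp add: eval_nat_numeral add.assoc)

fun spectrum_of :: "module_type \<Rightarrow> int list" where
  "spectrum_of TypeI = [3, 2, 0, -2, -3]"
| "spectrum_of TypeII = [2, 0, -2]"
| "spectrum_of TypeIII = [2, 0, -2]"
| "spectrum_of TypeIV = [0]"
| "spectrum_of TypeV = [2, -2]"
| "spectrum_of TypeVI = [0]"

text \<open>Eigenvectors of the tridiagonal matrix of each type, indexed by level and padded with
  zeros. Opposite nonzero eigenvalues of types II, III and V, and the pair 2, -2 of type I, share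
  one formula in \<open>\<theta>\<close>.\<close>

fun eigen_coeffs :: "module_type \<Rightarrow> int \<Rightarrow> int list" where
  "eigen_coeffs TypeI \<theta> = (if \<theta> = 3 then [1, 1, 1, 1, 1] else if \<theta> = -3 then [1, -1, 1, -1, 1]
     else if \<theta> = 0 then [4, 0, -2, 0, 1] else [12, 4 * \<theta>, 2, -\<theta>, -3])"
| "eigen_coeffs TypeII \<theta> = [0, 2, \<theta>, if \<theta> = 0 then -1 else 1, 0]"
| "eigen_coeffs TypeIII \<theta> = [0, 0, 2, \<theta>, if \<theta> = 0 then -1 else 1]"
| "eigen_coeffs TypeIV \<theta> = [0, 0, 0, 1, 0]"
| "eigen_coeffs TypeV \<theta> = [0, 0, 0, \<theta>, 1]"
| "eigen_coeffs TypeVI \<theta> = [0, 0, 0, 0, 1]"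

locale labelled_tutte_graph = rooted_tutte_graph +
  fixes vs :: "'a list" and s :: "nat list"
  assumes lab: "labelling vs" and s: "s \<in> set perms"
begin

abbreviation "A \<equiv> adj_matrix adj"
abbreviation "E \<equiv> dual_idempotent adj x"

lemma len_vs: "length vs = 30" and dist_vs: "distinct vs" and set_vs: "set vs = UNIV"
  and N_vs: "i < 30 \<Longrightarrow> N (vs ! i) = (!) vs ` set (nbr_table ! i)"
  and d_vs: "i < 30 \<Longrightarrow> d x (vs ! i) = levels ! i"
  using lab by (simp_all add: labelling_def)

lemma bij_vs: "bij_betw ((!) vs) {..<30} UNIV"
  using bij_betw_nth[OF dist_vs, of "{..<30}" UNIV] by (simp add: len_vs set_vs)

lemma ex_vs: "\<exists>i<30. v = vs ! i"
  using set_vs len_vs by (metis UNIV_I in_set_conv_nth)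

definition pos :: "'a \<Rightarrow> nat" where "pos v = (THE i. i < 30 \<and> vs ! i = v)"

lemma pos_vs: "i < 30 \<Longrightarrow> pos (vs ! i) = i"
  unfolding pos_def by (rule the_equality) (auto simp: nth_eq_iff_index_eq[OF dist_vs] len_vs)

definition vec_of :: "int list \<Rightarrow> complex ^ 'a" where "vec_of l = (\<chi> v. of_int (l ! pos v))"

lemma vec_of_vs: "i < 30 \<Longrightarrow> vec_of l $ (vs ! i) = of_int (l ! i)"
  by (simp add: vec_of_def pos_vs)

lemma vec_eqI_vs: "(\<And>i. i < 30 \<Longrightarrow> v $ (vs ! i) = w $ (vs ! i)) \<Longrightarrow> v = w"
  unfolding Finite_Cartesian_Product.vec_eq_iff using ex_vs by metis

lemma len_nbr_table: "length nbr_table = 30" by (simp add: nbr_table_def)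

lemma adj_vec_of: "i < 30 \<Longrightarrow> (A *v vec_of l) $ (vs ! i) = of_int (apply_adj l ! i)"
proof -
  assume i: "i < 30"
  then have "i \<in> set [0..<30]" by simp
  from bspec[OF check_nbr_table this]
  have nb: "distinct (nbr_table ! i)" "\<And>j. j \<in> set (nbr_table ! i) \<Longrightarrow> j < 30" by blast+
  have "(A *v vec_of l) $ (vs ! i) = (\<Sum>v\<in>UNIV. if v \<in> N (vs ! i) then vec_of l $ v else 0)"
    unfolding adj_matrix_def matrix_vector_mult_def by (auto intro!: sum.cong simp: neighbors_def)
  also have "\<dots> = (\<Sum>v\<in>N (vs ! i). vec_of l $ v)"
    by (simp add: sum.If_cases)
  also have "\<dots> = (\<Sum>j\<in>set (nbr_table ! i). vec_of l $ (vs ! j))"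
    unfolding N_vs[OF i] using nb len_vs by (intro sum.reindex[unfolded comp_def] inj_on_nth[OF dist_vs]) auto
  also have "\<dots> = (\<Sum>j\<in>set (nbr_table ! i). of_int (l ! j))"
    using nb by (intro sum.cong) (auto simp: vec_of_vs)
  also have "\<dots> = of_int (sum_list (map ((!) l) (nbr_table ! i)))"
    using nb(1) by (simp add: sum_list_distinct_conv_sum_set)
  also have "\<dots> = of_int (apply_adj l ! i)"
    using i by (simp add: apply_adj_def len_nbr_table)
  finally show ?thesis .
qed

lemma inner_vec_of:
  assumes "length l = 30" "length m = 30"
  shows "hermitian_inner (vec_of l) (vec_of m) = of_int (dot l m)"
proof -
  have "hermitian_inner (vec_of l) (vec_of m) = (\<Sum>i<30. vec_of l $ (vs ! i) * cnj (vec_of m $ (vs ! i)))"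
    unfolding hermitian_inner_def by (rule sum.reindex_bij_betw[OF bij_vs, symmetric])
  also have "\<dots> = of_int (\<Sum>i<30. l ! i * m ! i)" by (simp add: vec_of_vs)
  also have "(\<Sum>i<30. l ! i * m ! i) = dot l m"
    using assms by (simp add: dot_def sum_list_sum_nth lessThan_atLeast0)
  finally show ?thesis .
qed

lemma dual_vec_of:
  assumes "j < 30"
  shows "(E i *v vec_of l) $ (vs ! j) = (if levels ! j = i then of_int (l ! j) else 0)"
  using assms by (simp add: dual_idempotent_mult_nth d_vs vec_of_vs)

lemma check_ladder_s: "check_ladder s k"
proof (cases "k \<in> {W1a, W1b}")
  case True
  then show ?thesis using check_ladder_W1 s by auto
next
  case False
  have "blist s k = blist [0, 1, 2] k" using blist_perm[OF False] by blast
  then have "check_ladder s k = check_ladder [0, 1, 2] k" by (simp add: check_ladder_def)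
  then show ?thesis using check_ladder_id UNIV_summand by auto
qed

lemma blist_facts:
  assumes "i < 6"
  shows "length (blist s k i) = 30" "proj i (blist s k i) = blist s k i"
    "(\<exists>a\<in>set (blist s k i). a \<noteq> 0) \<longleftrightarrow> type_lo (summand_type k) \<le> i \<and> i \<le> type_hi (summand_type k)"
    "type_lo (summand_type k) \<le> i \<Longrightarrow> i \<le> type_hi (summand_type k) \<Longrightarrow> i < 5 \<Longrightarrow> apply_adj (blist s k i) =
      map2 (\<lambda>p q. type_up (summand_type k) i * p + q) (blist s k (i + 1))
        (if i = type_lo (summand_type k) then replicate 30 0
         else map ((*) (type_down (summand_type k) i)) (blist s k (i - 1)))"
proof -
  have i: "i \<in> set [0..<6]" using assms by simp
  have n: "map (blist s k) [0..<6] ! j = blist s k j" if "j < 6" for j using that by simp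
  note c = bspec[OF check_ladder_s[of k, unfolded check_ladder_def Let_def] i]
  show "length (blist s k i) = 30" "proj i (blist s k i) = blist s k i"
    "(\<exists>a\<in>set (blist s k i). a \<noteq> 0) \<longleftrightarrow> type_lo (summand_type k) \<le> i \<and> i \<le> type_hi (summand_type k)"
    using c unfolding n[OF assms] by blast+
  assume lo: "type_lo (summand_type k) \<le> i" "i \<le> type_hi (summand_type k)" "i < 5"
  have n': "map (blist s k) [0..<6] ! (i + 1) = blist s k (i + 1)" "map (blist s k) [0..<6] ! (i - 1) = blist s k (i - 1)"
    using lo(3) by (auto intro!: n)
  show "apply_adj (blist s k i) = map2 (\<lambda>p q. type_up (summand_type k) i * p + q) (blist s k (i + 1))
        (if i = type_lo (summand_type k) then replicate 30 0
         else map ((*) (type_down (summand_type k) i)) (blist s k (i - 1)))"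
    using c lo(1,2) unfolding n[OF assms] n' by blast
qed

lemma type_hi_le: "type_hi t \<le> 4" by (cases t) simp_all

lemma type_lo_le_hi: "type_lo t \<le> type_hi t" by (cases t) simp_all

text \<open>\<open>check_ladder\<close> covers the levels below 6, while \<open>ladder\<close>
  requires zero vectors at all indices above the top; hence the cutoff.\<close>

definition bk :: "summand \<Rightarrow> nat \<Rightarrow> complex ^ 'a" where
  "bk k i = (if i < 5 then vec_of (blist s k i) else 0)"

lemma vec_of_eq_0_iff: "length l = 30 \<Longrightarrow> vec_of l = 0 \<longleftrightarrow> \<not> (\<exists>a\<in>set l. a \<noteq> 0)"
proof
  assume l: "length l = 30" and z: "vec_of l = 0"
  have "l ! i = 0" if "i < 30" for i
    using arg_cong[OF z, of "\<lambda>v. v $ (vs ! i)"] that by (simp add: vec_of_vs)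
  then show "\<not> (\<exists>a\<in>set l. a \<noteq> 0)" using l by (metis in_set_conv_nth)
next
  assume l: "length l = 30" and z: "\<not> (\<exists>a\<in>set l. a \<noteq> 0)"
  then have "l ! i = 0" if "i < 30" for i using that by (metis nth_mem)
  then show "vec_of l = 0" by (intro vec_eqI_vs) (simp add: vec_of_vs)
qed

text \<open>At level 5 the cutoff agrees with the computed list, which the check shows to be zero;
  this serves the upward term of a ladder that ends at level 4.\<close>

lemma bk_vs: "i < 6 \<Longrightarrow> j < 30 \<Longrightarrow> bk k i $ (vs ! j) = of_int (blist s k i ! j)"
proof (cases "i < 5")
  case False
  assume "i < 6" "j < 30"
  with False have "i = 5" by simp
  then have "\<not> (\<exists>a\<in>set (blist s k 5). a \<noteq> 0)" using blist_facts(3)[of 5 k] type_hi_le[of "summand_type k"] by simp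
  then have "blist s k 5 ! j = 0" using blist_facts(1)[of 5 k] \<open>j < 30\<close> by simp
  then show ?thesis by (simp add: bk_def \<open>i = 5\<close>)
qed (simp add: bk_def vec_of_vs)

lemma ladder_bk:
  "ladder adj x (type_lo (summand_type k)) (type_hi (summand_type k))
     (\<lambda>i. of_int (type_up (summand_type k) i)) (\<lambda>i. of_int (type_down (summand_type k) i)) (bk k)"
  unfolding ladder_def
proof (intro conjI allI impI)
  let ?t = "summand_type k"
  show "type_lo ?t \<le> type_hi ?t" by (rule type_lo_le_hi)
  show "type_hi ?t \<le> gdiameter adj" using type_hi_le by (simp add: diameter)
  show "complex_of_int (type_up ?t i) \<noteq> 0" "complex_of_int (type_down ?t i) \<noteq> 0" for i by simp_all
  show "bk k i \<noteq> 0 \<longleftrightarrow> type_lo ?t \<le> i \<and> i \<le> type_hi ?t" for i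
    using blist_facts(1,3)[of i k] type_hi_le[of ?t] by (auto simp: bk_def vec_of_eq_0_iff)
  show "E i *v bk k i = bk k i" for i
  proof (cases "i < 5")
    case True
    have "(E i *v vec_of (blist s k i)) $ (vs ! j) = vec_of (blist s k i) $ (vs ! j)" if j: "j < 30" for j
    proof -
      have "length levels = 30" by (simp add: levels_def)
      then have "proj i (blist s k i) ! j = (if levels ! j = i then blist s k i ! j else 0)"
        using j blist_facts(1)[of i k] True by (simp add: proj_def)
      then have "levels ! j = i \<or> blist s k i ! j = 0"
        using blist_facts(2)[of i k] True by (cases "levels ! j = i") auto
      then show ?thesis using j by (auto simp: dual_vec_of vec_of_vs)
    qed
    then show ?thesis using True by (auto simp: bk_def intro: vec_eqI_vs)
  qed (simp add: bk_def)
  fix i assume i: "type_lo ?t \<le> i \<and> i \<le> type_hi ?t"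
  then have i4: "i < 5" using type_hi_le[of ?t] by simp
  show "A *v bk k i = of_int (type_up ?t i) *s bk k (i + 1) +
      (if i = type_lo ?t then 0 else of_int (type_down ?t i) *s bk k (i - 1))"
  proof (rule vec_eqI_vs)
    fix j :: nat assume j: "j < 30"
    have len: "length (blist s k (i + 1)) = 30" "length (blist s k (i - 1)) = 30"
      using blist_facts(1)[of "i + 1" k] blist_facts(1)[of "i - 1" k] i4 by simp_all
    have "(A *v bk k i) $ (vs ! j) = of_int (apply_adj (blist s k i) ! j)"
      using i4 j by (simp add: bk_def adj_vec_of)
    also have "apply_adj (blist s k i) ! j = type_up ?t i * blist s k (i + 1) ! j +
        (if i = type_lo ?t then 0 else type_down ?t i * blist s k (i - 1) ! j)"
      using blist_facts(4)[of i k] i i4 j len by (simp del: type_up.simps type_down.simps)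
    finally show "(A *v bk k i) $ (vs ! j) = (of_int (type_up ?t i) *s bk k (i + 1) +
      (if i = type_lo ?t then 0 else of_int (type_down ?t i) *s bk k (i - 1))) $ (vs ! j)"
      using bk_vs[of "i + 1" j k] bk_vs[of "i - 1" j k] i4 j by (simp del: type_up.simps type_down.simps)
  qed
qed

lemma dot_commute: "dot l m = dot m l"
proof -
  have "map2 (*) l m = map2 (*) m l"
    by (rule nth_equalityI) (simp_all add: mult.commute)
  then show ?thesis by (simp add: dot_def)
qed

lemma summand_index: "\<exists>p<13. summands ! p = k"
proof -
  have "k \<in> set summands" using UNIV_summand by auto
  then show ?thesis using len_summands by (metis in_set_conv_nth)
qed

text \<open>Pairs without a type II summand do not depend on \<open>s\<close> and reduce to the
  evaluation for the identity permutation. For the others the six permutations were evaluated on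
  levels 1 to 3, outside which type II vectors vanish.\<close>

lemma orth_bk:
  assumes "k \<noteq> l"
  shows "hermitian_inner (bk k i) (bk l i) = 0"
proof (cases "i < 5")
  case True
  have nth: "map (\<lambda>k. blist r k i) summands ! p = blist r (summands ! p) i" if "p < 13" for r p
    using that len_summands by simp
  have W1: "hermitian_inner (bk k i) (bk l i) = 0" if k: "k \<in> {W1a, W1b}" and kl: "k \<noteq> l" for k l
  proof (cases "i \<in> set [1..<4]")
    case i: True
    \<comment> \<open>The positions of \<open>W1a\<close> and \<open>W1b\<close> in
      \<open>summands\<close>.\<close>
    define p where "p = (if k = W1a then 1 else 2 :: nat)"
    have p: "p \<in> set [1, 2]" "summands ! p = k" "p < 13" using k by (auto simp: p_def summands_def)
    obtain q where q: "q < 13" "summands ! q = l" using summand_index by blast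
    have "q \<in> set (remove1 p [0..<13])" using q p kl by auto
    with check_orth_W1 s i p(1)
    have "dot (map (\<lambda>k. blist s k i) summands ! p) (map (\<lambda>k. blist s k i) summands ! q) = 0"
      unfolding check_orth_def Let_def by blast
    then show ?thesis using nth p q True blist_facts(1) by (simp add: bk_def inner_vec_of)
  next
    case False
    then have "bk k i = 0" using ladder_eq_0_iff[OF ladder_bk[of k], of i] k True by auto
    then show ?thesis by simp
  qed
  show ?thesis
  proof (cases "k \<in> {W1a, W1b} \<or> l \<in> {W1a, W1b}")
    case True
    then show ?thesis using W1[of k l] W1[of l k] assms hermitian_inner_eq_0_commute by metis
  next
    case False
    obtain p q where pq: "p < 13" "summands ! p = k" "q < 13" "summands ! q = l" using summand_index by blast
    have less: "dot (blist [0, 1, 2] (summands ! p) i) (blist [0, 1, 2] (summands ! q) i) = 0"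
      if "p < 13" "q < p" for p q
    proof -
      have "i \<in> set [0..<5]" "p \<in> set [0..<13]" "q \<in> set [0..<p]" using True that by auto
      then have "dot (map (\<lambda>k. blist [0, 1, 2] k i) summands ! p) (map (\<lambda>k. blist [0, 1, 2] k i) summands ! q) = 0"
        using check_orth_id unfolding check_orth_def Let_def by blast
      then show ?thesis using nth that by simp
    qed
    have "p \<noteq> q" using pq assms by auto
    then have "dot (blist [0, 1, 2] k i) (blist [0, 1, 2] l i) = 0"
      using less[of p q] less[of q p] pq dot_commute by (metis nat_neq_iff)
    then have "dot (blist s k i) (blist s l i) = 0"
      using blist_perm[of k s i "[0, 1, 2]"] blist_perm[of l s i "[0, 1, 2]"] False by simp
    then show ?thesis using True blist_facts(1) by (simp add: bk_def inner_vec_of)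
  qed
qed (simp add: bk_def)

lemma card_vertices: "CARD('a) = 30"
  using distinct_card[OF dist_vs] by (simp add: set_vs len_vs)

end

section \<open>Separation of the six types inside the Terwilliger algebra\<close>

sublocale labelled_tutte_graph \<subseteq> ladder_decomposition adj x summand_type type_lo type_hi
  "\<lambda>t i. of_int (type_up t i)" "\<lambda>t i. of_int (type_down t i)" bk
  by unfold_locales (auto simp: ladder_bk orth_bk card_vertices sum_summands summands_def
      simp del: type_up.simps type_down.simps)

context labelled_tutte_graph
begin

lemma type_range: "t \<in> range summand_type"
proof -
  have "\<exists>k. summand_type k = t"
    by (cases t) (metis summand_type.simps)+
  then show ?thesis by auto
qed

lemma bk_0: "i \<notin> lev (summand_type k) \<Longrightarrow> bk k i = 0"
  using b_eq_0_iff by blast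

lemmas unit_simps = matrix_vector_mult_diff_rdistrib cmat_scale_mult_vec unit_b
  matrix_vector_mul_assoc[symmetric] ladder_dual[OF ladder_bk] ladder_adj[OF ladder_bk]
  matrix_vector_right_distrib vec.scale

lemma unit_I: "unit TypeI 0 0 = E 0"
proof (rule unit_eqI[symmetric])
  fix k n assume "n \<in> lev (summand_type k)"
  then show "E 0 *v bk k n = (if summand_type k = TypeI \<and> n = 0 then bk k 0 else 0)"
    by (cases "summand_type k") (auto simp: unit_simps)
qed

lemma unit_II: "unit TypeII 1 1 = E 1 - unit TypeI 1 1"
proof (rule unit_eqI[symmetric])
  fix k n assume "n \<in> lev (summand_type k)"
  then show "(E 1 - unit TypeI 1 1) *v bk k n = (if summand_type k = TypeII \<and> n = 1 then bk k 1 else 0)"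
    by (cases "summand_type k") (auto simp: unit_simps)
qed

lemma unit_III: "unit TypeIII 2 2 = E 2 - unit TypeI 2 2 - unit TypeII 2 2"
proof (rule unit_eqI[symmetric])
  fix k n assume "n \<in> lev (summand_type k)"
  then show "(E 2 - unit TypeI 2 2 - unit TypeII 2 2) *v bk k n
      = (if summand_type k = TypeIII \<and> n = 2 then bk k 2 else 0)"
    by (cases "summand_type k") (auto simp: unit_simps)
qed

text \<open>
  Going from level 3 up to level 4 and back multiplies the seeds of type V by 4 and kills those
  of type IV.
\<close>

lemma unit_V: "unit TypeV 3 3 = cmat_scale (1 / 4) (E 3 ** A **
    E 4 ** A **
    (E 3 - unit TypeI 3 3 - unit TypeII 3 3 - unit TypeIII 3 3))"
  (is "_ = ?M")
proof (rule unit_eqI[symmetric])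
  fix k n assume n: "n \<in> lev (summand_type k)"
  let ?P = "E 3 - unit TypeI 3 3 - unit TypeII 3 3 - unit TypeIII 3 3"
  have P: "?P *v bk k n = (if n = 3 \<and> summand_type k \<in> {TypeIV, TypeV} then bk k 3 else 0)"
    using n by (cases "summand_type k") (auto simp: unit_simps)
  have M: "?M *v bk k n = (1 / 4) *s (E 3 *v (A *v (E 4 *v
      (A *v (?P *v bk k n)))))"
    by (simp only: cmat_scale_mult_vec matrix_vector_mul_assoc[symmetric])
  have 4: "bk k 4 = 0" if "summand_type k = TypeIV" using bk_0[of 4 k] that by simp
  have 5: "bk k 5 = 0" using bk_0[of 5 k] type_hi_le[of "summand_type k"] by simp
  have IV: "E 4 *v (A *v bk k 3) = 0" if "summand_type k = TypeIV"
    using that 4 by (simp add: unit_simps)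
  have V: "E 3 *v (A *v (E 4 *v (A *v bk k 3))) = 4 *s bk k 3"
    if "summand_type k = TypeV"
    using that 5 by (simp add: unit_simps)
  show "?M *v bk k n = (if summand_type k = TypeV \<and> n = 3 then bk k 3 else 0)"
    unfolding M P using IV V by (cases "summand_type k") auto
qed

lemma unit_IV: "unit TypeIV 3 3 =
  E 3 - unit TypeI 3 3 - unit TypeII 3 3 - unit TypeIII 3 3 - unit TypeV 3 3"
proof (rule unit_eqI[symmetric])
  fix k n assume "n \<in> lev (summand_type k)"
  then show "(E 3 - unit TypeI 3 3 - unit TypeII 3 3 - unit TypeIII 3 3 - unit TypeV 3 3) *v bk k n
      = (if summand_type k = TypeIV \<and> n = 3 then bk k 3 else 0)"
    by (cases "summand_type k") (auto simp: unit_simps)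
qed

text \<open>Types II and IV end at level 3, so besides type VI only I, III and V reach level
  4.\<close>

lemma unit_VI: "unit TypeVI 4 4 = E 4 - unit TypeI 4 4 - unit TypeIII 4 4 - unit TypeV 4 4"
proof (rule unit_eqI[symmetric])
  fix k n assume "n \<in> lev (summand_type k)"
  then show "(E 4 - unit TypeI 4 4 - unit TypeIII 4 4 - unit TypeV 4 4) *v bk k n
      = (if summand_type k = TypeVI \<and> n = 4 then bk k 4 else 0)"
    by (cases "summand_type k") (auto simp: unit_simps)
qed

text \<open>Each bottom unit brings along the units of its type at higher levels, which the later
  types subtract. Type V precedes type IV because it is isolated by the loop through level 4 and
  then subtracted.\<close>

lemma unit_lo_in_T: "unit t (type_lo t) (type_lo t) \<in> T"
proof -
  note E = dual_idempotent_in_terwilliger[of _ adj x, unfolded diameter]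
  note diff = cmat.subspace_diff[OF terwilliger_subspace]
  note up = unit_in_T[OF type_range]
  have I: "unit TypeI (type_lo TypeI) (type_lo TypeI) \<in> T"
    by (simp add: unit_I E)
  have II: "unit TypeII (type_lo TypeII) (type_lo TypeII) \<in> T"
    using diff[OF E up[OF I]] by (simp add: unit_II[simplified])
  have III: "unit TypeIII (type_lo TypeIII) (type_lo TypeIII) \<in> T"
    using diff[OF diff[OF E up[OF I]] up[OF II]] by (simp add: unit_III)
  have P: "E 3 - unit TypeI 3 3 - unit TypeII 3 3 - unit TypeIII 3 3 \<in> T"
    by (intro diff E up[OF I] up[OF II] up[OF III]) simp_all
  have V: "unit TypeV (type_lo TypeV) (type_lo TypeV) \<in> T"
    unfolding type_lo.simps unit_V
    by (intro cmat.subspace_scale[OF terwilliger_subspace] terwilliger_mult E adj_matrix_in_terwilliger P) simp_all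
  have IV: "unit TypeIV (type_lo TypeIV) (type_lo TypeIV) \<in> T"
    unfolding type_lo.simps unit_IV by (intro diff P up[OF V]) simp_all
  have VI: "unit TypeVI (type_lo TypeVI) (type_lo TypeVI) \<in> T"
    unfolding type_lo.simps unit_VI by (intro diff E up[OF I] up[OF III] up[OF V]) simp_all
  show ?thesis using I II III IV V VI by (cases t) simp_all
qed

end

sublocale labelled_tutte_graph \<subseteq> separated_ladders adj x summand_type type_lo type_hi
  "\<lambda>t i. of_int (type_up t i)" "\<lambda>t i. of_int (type_down t i)" bk
  by unfold_locales (rule unit_lo_in_T)

section \<open>The spectrum of the adjacency matrix\<close>

context labelled_tutte_graph
begin

definition eigvec :: "summand \<times> int \<Rightarrow> complex ^ 'a" where
  "eigvec = (\<lambda>(k, \<theta>). \<Sum>i<5. of_int (eigen_coeffs (summand_type k) \<theta> ! i) *s bk k i)"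

definition eigidx :: "(summand \<times> int) set" where
  "eigidx = (SIGMA k:UNIV. set (spectrum_of (summand_type k)))"

lemma eigvec_in: "eigvec (k, \<theta>) \<in> ladder_space (bk k)"
  unfolding eigvec_def by (auto intro!: vec.subspace_sum vec.subspace_scale)

lemma eigvec_eigen:
  assumes "\<theta> \<in> set (spectrum_of (summand_type k))"
  shows "A *v eigvec (k, \<theta>) = of_int \<theta> *s eigvec (k, \<theta>)"
proof -
  have z: "bk k i = 0" if "i \<notin> lev (summand_type k)" for i using that by (rule bk_0)
  have 5: "bk k 5 = 0" using z[of 5] type_hi_le[of "summand_type k"] by simp
  show ?thesis
    using assms z[of 0] z[of 1] z[of 2] z[of 3] z[of 4] 5 unfolding eigvec_def prod.case sum_5
    by (cases "summand_type k")
      (auto simp: matrix_vector_right_distrib vec.scale ladder_adj[OF ladder_bk] Finite_Cartesian_Product.vec_eq_iff algebra_simps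
        numeral_2_eq_2[symmetric] numeral_3_eq_3[symmetric])
qed

lemma eigvec_nonzero:
  assumes "\<theta> \<in> set (spectrum_of (summand_type k))"
  shows "eigvec (k, \<theta>) \<noteq> 0"
proof -
  let ?t = "summand_type k"
  have lo: "type_lo ?t \<in> {..<5}" using type_lo_le_hi[of ?t] type_hi_le[of ?t] by simp
  have "coord k (type_lo ?t) (eigvec (k, \<theta>)) = (\<Sum>i<5. if i = type_lo ?t then of_int (eigen_coeffs ?t \<theta> ! i) else 0)"
    unfolding eigvec_def prod.case coord_sum coord_scale coord_b
    using type_lo_le_hi[of ?t] by (intro sum.cong) auto
  also have "\<dots> = of_int (eigen_coeffs ?t \<theta> ! type_lo ?t)" using lo by simp
  \<comment> \<open>The coefficient at the bottom level is nonzero in every type; in type V it is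
    the eigenvalue 2 or -2.\<close>
  also have "\<dots> \<noteq> 0" using assms by (cases ?t) auto
  finally show ?thesis by (auto simp: coord_zero)
qed

text \<open>Within one ladder the eigenvalues differ and the adjacency matrix is symmetric; between
  different ladders the spaces are already orthogonal.\<close>

lemma orthogonal_family_eigvec: "orthogonal_family eigidx eigvec"
  unfolding orthogonal_family_def
proof (intro conjI ballI impI)
  show "finite eigidx" by (simp add: eigidx_def)
  show "p \<in> eigidx \<Longrightarrow> eigvec p \<noteq> 0" for p
    using eigvec_nonzero by (auto simp: eigidx_def)
  fix p q assume pq: "p \<in> eigidx" "q \<in> eigidx" "p \<noteq> q"
  obtain k \<theta> l \<eta> where p: "p = (k, \<theta>)" and q: "q = (l, \<eta>)" by (cases p; cases q)
  show "hermitian_inner (eigvec p) (eigvec q) = 0"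
  proof (cases "k = l")
    case True
    have "symp adj" using graph by (simp add: simple_graph_def)
    then show ?thesis
      using eigenvectors_orthogonal[OF _ eigvec_eigen[of \<theta> k] eigvec_eigen[of \<eta> l]] pq p q True
      by (auto simp: eigidx_def)
  next
    case False
    then show ?thesis
      using orthogonal_direct_sum_b eigvec_in unfolding orthogonal_direct_sum_def p q by blast
  qed
qed

lemma card_eigidx: "card eigidx = CARD('a)"
  unfolding eigidx_def by (subst card_SigmaI) (auto simp: card_vertices sum_summands summands_def)

lemma dim_eigenspace:
  "vec.dim (eigenspace A \<theta>) = card {p \<in> eigidx. of_int (snd p) = \<theta>}"
  by (rule eigenspace_dim[OF orthogonal_family_eigvec card_eigidx]) (auto simp: eigidx_def eigvec_eigen)

lemma dim_eigenspace_int: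
  "vec.dim (eigenspace A (of_int n)) = length (filter (\<lambda>k. n \<in> set (spectrum_of (summand_type k))) summands)"
proof -
  have "{p \<in> eigidx. of_int (snd p) = (of_int n :: complex)} = (\<lambda>k. (k, n)) ` {k. n \<in> set (spectrum_of (summand_type k))}"
    by (auto simp: eigidx_def)
  then have "card {p \<in> eigidx. of_int (snd p) = (of_int n :: complex)} = card {k. n \<in> set (spectrum_of (summand_type k))}"
    by (simp add: card_image inj_on_def)
  also have "{k. n \<in> set (spectrum_of (summand_type k))} = set (filter (\<lambda>k. n \<in> set (spectrum_of (summand_type k))) summands)"
    using UNIV_summand by auto
  also have "card \<dots> = length (filter (\<lambda>k. n \<in> set (spectrum_of (summand_type k))) summands)"
    by (rule distinct_card) (simp add: summands_def)
  finally show ?thesis by (simp add: dim_eigenspace)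
qed

lemma eigenspace_dims:
  "vec.dim (eigenspace A 3) = 1" "vec.dim (eigenspace A 2) = 9"
  "vec.dim (eigenspace A 0) = 10" "vec.dim (eigenspace A (-2)) = 9"
  "vec.dim (eigenspace A (-3)) = 1"
  using dim_eigenspace_int[of 3] dim_eigenspace_int[of 2] dim_eigenspace_int[of 0]
    dim_eigenspace_int[of "-2"] dim_eigenspace_int[of "-3"]
  by (simp_all add: summands_def)

lemma eigenvalues_adj: "{\<theta>. eigenspace A \<theta> \<noteq> {0}} = {3, 2, 0, -2, -3}"
proof -
  have z: "eigenspace A \<theta> = {0} \<longleftrightarrow> vec.dim (eigenspace A \<theta>) = 0" for \<theta>
  proof -
    have "0 \<in> eigenspace A \<theta>" by (simp add: eigenspace_def)
    then show ?thesis unfolding vec.dim_eq_0 by auto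
  qed
  have "\<theta> \<in> {3, 2, 0, -2, -3}" if "vec.dim (eigenspace A \<theta>) \<noteq> 0" for \<theta>
  proof -
    have "{p \<in> eigidx. of_int (snd p) = \<theta>} \<noteq> {}"
      using that unfolding dim_eigenspace by (metis card.empty)
    then obtain k n where "n \<in> set (spectrum_of (summand_type k))" "of_int n = \<theta>"
      by (auto simp: eigidx_def)
    then show ?thesis by (cases "summand_type k") auto
  qed
  then show ?thesis unfolding z using eigenspace_dims by (auto simp del: vec.dim_eq_0)
qed

lemma dim_T_49: "cmat.dim T = 49"
proof -
  have "range summand_type = {TypeI, TypeII, TypeIII, TypeIV, TypeV, TypeVI}"
    using type_range by (auto intro: module_type.exhaust)
  then show ?thesis unfolding dim_T by simp
qed

end

section \<open>Matrices representing the adjacency matrix\<close>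

lemma square_matrix_index:
  "i < length rs \<Longrightarrow> j < length rs \<Longrightarrow> square_matrix rs $$ (i, j) = rs ! i ! j"
  by (simp add: square_matrix_def mat_of_rows_list_def)

lemma square_matrix_carrier: "square_matrix rs \<in> carrier_mat (length rs) (length rs)"
  by (simp add: square_matrix_def mat_of_rows_list_def)

text \<open>Passing to functions on indices turns the eigenvalue problem of a concrete matrix into a
  finite system of scalar equations.\<close>

lemma eigenvalue_square_matrix_iff:
  "eigenvalue (square_matrix rs) \<theta> \<longleftrightarrow>
     (\<exists>f. (\<exists>i<length rs. f i \<noteq> 0) \<and> (\<forall>i<length rs. (\<Sum>j<length rs. rs ! i ! j * f j) = \<theta> * f i))"
  (is "?L \<longleftrightarrow> ?R")
proof -
  let ?n = "length rs"
  let ?M = "square_matrix rs"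
  have M: "?M \<in> carrier_mat ?n ?n" by (rule square_matrix_carrier)
  have mult: "vec_index (?M *\<^sub>v v) i = (\<Sum>j<?n. rs ! i ! j * vec_index v j)"
    if "v \<in> carrier_vec ?n" "i < ?n" for v i
    using that M by (simp add: scalar_prod_def square_matrix_index lessThan_atLeast0)
  have iff: "?M *\<^sub>v v = \<theta> \<cdot>\<^sub>v v \<longleftrightarrow> (\<forall>i<?n. (\<Sum>j<?n. rs ! i ! j * vec_index v j) = \<theta> * vec_index v i)"
    if v: "v \<in> carrier_vec ?n" for v
  proof -
    have "?M *\<^sub>v v = \<theta> \<cdot>\<^sub>v v \<longleftrightarrow> (\<forall>i<?n. vec_index (?M *\<^sub>v v) i = vec_index (\<theta> \<cdot>\<^sub>v v) i)"
      using v M by (auto simp: Matrix.vec_eq_iff)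
    then show ?thesis using v by (simp add: mult)
  qed
  show ?thesis
  proof
    assume ?L
    then obtain v where v: "v \<in> carrier_vec ?n" "v \<noteq> 0\<^sub>v ?n" "?M *\<^sub>v v = \<theta> \<cdot>\<^sub>v v"
      using M by (auto simp: eigenvalue_def eigenvector_def)
    have "\<exists>i<?n. vec_index v i \<noteq> 0" using v(1,2) by (auto simp: Matrix.vec_eq_iff)
    then show ?R using iff[OF v(1)] v(3) by blast
  next
    assume ?R
    then obtain f where f: "\<exists>i<?n. f i \<noteq> 0" "\<forall>i<?n. (\<Sum>j<?n. rs ! i ! j * f j) = \<theta> * f i" by blast
    define v where "v = Matrix.vec ?n f"
    have v: "v \<in> carrier_vec ?n" and vi: "i < ?n \<Longrightarrow> vec_index v i = f i" for i by (simp_all add: v_def)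
    have "v \<noteq> 0\<^sub>v ?n" using f(1) vi by (auto simp: Matrix.vec_eq_iff)
    moreover have "?M *\<^sub>v v = \<theta> \<cdot>\<^sub>v v" using f(2) by (simp add: iff[OF v] vi)
    ultimately show ?L using v M by (auto simp: eigenvalue_def eigenvector_def)
  qed
qed

text \<open>Restores the numeral after the length of a five-element list has been unfolded into
  successors.\<close>

lemma Suc_5: "Suc (Suc (Suc (Suc (Suc 0)))) = 5"
  by simp

lemma all_less_5: "(\<forall>i<5::nat. P i) \<longleftrightarrow> P 0 \<and> P 1 \<and> P 2 \<and> P 3 \<and> P 4"
  by (auto simp: eval_nat_numeral less_Suc_eq)

lemma ex_less_5: "(\<exists>i<5::nat. P i) \<longleftrightarrow> P 0 \<or> P 1 \<or> P 2 \<or> P 3 \<or> P 4"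
  by (auto simp: eval_nat_numeral less_Suc_eq)

text \<open>The product of the linear factors is the characteristic polynomial of the type I matrix
  \<open>B\<close>. The multipliers of the five equations are, up to sign, the first row of the
  adjugate of \<open>\<theta> I - B\<close>.\<close>

lemma char_I:
  fixes \<theta> :: complex
  assumes "3 * b = \<theta> * a" "a + 2 * c = \<theta> * b" "b + 2 * d = \<theta> * c" "c + 2 * e = \<theta> * d" "3 * d = \<theta> * e"
  shows "\<theta> * (\<theta> - 2) * (\<theta> + 2) * (\<theta> - 3) * (\<theta> + 3) * a = 0"
proof -
  have "\<theta> * (\<theta> - 2) * (\<theta> + 2) * (\<theta> - 3) * (\<theta> + 3) * a =
    - 24 * (3 * d - \<theta> * e) - 12 * \<theta> * (c + 2 * e - \<theta> * d)
    - (6 * \<theta> * \<theta> - 36) * (b + 2 * d - \<theta> * c) - (3 * \<theta> * \<theta> * \<theta> - 24 * \<theta>) * (a + 2 * c - \<theta> * b)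
    - (\<theta> * \<theta> * \<theta> * \<theta> - 10 * \<theta> * \<theta> + 12) * (3 * b - \<theta> * a)"
    by (simp add: algebra_simps)
  then show ?thesis by (simp add: assms)
qed

lemma eigenvalues_I:
  "{\<theta>::complex. eigenvalue (square_matrix [[0, 3, 0, 0, 0],
                                [1, 0, 2, 0, 0],
                                [0, 1, 0, 2, 0],
                                [0, 0, 1, 0, 2],
                                [0, 0, 0, 3, 0]]) \<theta>} = {3, 2, 0, -2, -3}"
proof -
  have "(\<exists>f. (f 0 \<noteq> 0 \<or> f 1 \<noteq> 0 \<or> f 2 \<noteq> 0 \<or> f 3 \<noteq> 0 \<or> f 4 \<noteq> 0) \<and>
      3 * f 1 = \<theta> * f 0 \<and> f 0 + 2 * f 2 = \<theta> * f 1 \<and> f 1 + 2 * f 3 = \<theta> * f 2 \<and>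
      f 2 + 2 * f 4 = \<theta> * f 3 \<and> 3 * f 3 = \<theta> * f (4 :: nat)) \<longleftrightarrow> \<theta> \<in> {3, 2, 0, -2, -3}"
    (is "(\<exists>f. ?P f) \<longleftrightarrow> _") for \<theta> :: complex
  proof
    assume "\<exists>f. ?P f"
    then obtain f where f: "?P f" by blast
    then have e: "3 * f 1 = \<theta> * f 0" "f 0 + 2 * f 2 = \<theta> * f 1" "f 1 + 2 * f 3 = \<theta> * f 2"
      "f 2 + 2 * f 4 = \<theta> * f 3" "3 * f 3 = \<theta> * f 4" by blast+
    \<comment> \<open>The superdiagonal of a tridiagonal matrix with nonzero entries there
      propagates a vanishing first coordinate to all the others.\<close>
    have "f 0 \<noteq> 0"
    proof
      assume 0: "f 0 = 0"
      then have 1: "f 1 = 0" using e(1) by simp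
      then have 2: "f 2 = 0" using e(2) 0 by simp
      then have 3: "f 3 = 0" using e(3) 1 by simp
      then have "f 4 = 0" using e(4) 2 by simp
      then show False using f 0 1 2 3 by blast
    qed
    moreover have "\<theta> * (\<theta> - 2) * (\<theta> + 2) * (\<theta> - 3) * (\<theta> + 3) * f 0 = 0"
      using e by (rule char_I)
    ultimately have "\<theta> = 0 \<or> \<theta> - 2 = 0 \<or> \<theta> + 2 = 0 \<or> \<theta> - 3 = 0 \<or> \<theta> + 3 = 0" by auto
    then show "\<theta> \<in> {3, 2, 0, -2, -3}" by (auto simp: eq_neg_iff_add_eq_0)
  next
    assume "\<theta> \<in> {3, 2, 0, -2, -3}"
    then consider "\<theta> = 3" | "\<theta> = 2" | "\<theta> = 0" | "\<theta> = -2" | "\<theta> = -3" by blast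
    then show "\<exists>f. ?P f"
    proof cases
      case 1 then show ?thesis by (intro exI[of _ "(!) [1, 1, 1, 1, 1]"]) simp
    next
      case 2 then show ?thesis by (intro exI[of _ "(!) [12, 8, 2, -2, -3]"]) simp
    next
      case 3 then show ?thesis by (intro exI[of _ "(!) [4, 0, -2, 0, 1]"]) simp
    next
      case 4 then show ?thesis by (intro exI[of _ "(!) [12, -8, 2, 2, -3]"]) simp
    next
      case 5 then show ?thesis by (intro exI[of _ "(!) [1, -1, 1, -1, 1]"]) simp
    qed
  qed
  then show ?thesis
    by (simp add: eigenvalue_square_matrix_iff all_less_5 ex_less_5 sum_5 set_eq_iff Suc_5
        numeral_2_eq_2[symmetric] numeral_3_eq_3[symmetric])
qed

lemma all_less_3: "(\<forall>i<3::nat. P i) \<longleftrightarrow> P 0 \<and> P 1 \<and> P 2"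
  by (auto simp: eval_nat_numeral less_Suc_eq)

lemma ex_less_3: "(\<exists>i<3::nat. P i) \<longleftrightarrow> P 0 \<or> P 1 \<or> P 2"
  by (auto simp: eval_nat_numeral less_Suc_eq)

lemma sum_3: "(\<Sum>i<3::nat. f i) = f 0 + f 1 + (f 2 :: 'b::comm_monoid_add)"
  by (simp add: eval_nat_numeral add.assoc)

lemma eigenvalues_II:
  "{\<theta>::complex. eigenvalue (square_matrix [[0, 2, 0],
                                [1, 0, 2],
                                [0, 1, 0]]) \<theta>} = {2, 0, -2}"
proof -
  have "(\<exists>f. (f 0 \<noteq> 0 \<or> f 1 \<noteq> 0 \<or> f 2 \<noteq> 0) \<and>
      2 * f 1 = \<theta> * f 0 \<and> f 0 + 2 * f 2 = \<theta> * f 1 \<and> f 1 = \<theta> * f (2 :: nat)) \<longleftrightarrow> \<theta> \<in> {2, 0, -2}"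
    (is "(\<exists>f. ?P f) \<longleftrightarrow> _") for \<theta> :: complex
  proof
    assume "\<exists>f. ?P f"
    then obtain f where f: "?P f" by blast
    then have e: "2 * f 1 = \<theta> * f 0" "f 0 + 2 * f 2 = \<theta> * f 1" "f 1 = \<theta> * f 2" by blast+
    have "f 2 \<noteq> 0"
    proof
      assume 2: "f 2 = 0"
      then have 1: "f 1 = 0" using e(3) by simp
      then have "f 0 = 0" using e(2) 2 by simp
      then show False using f 1 2 by blast
    qed
    moreover have "\<theta> * (\<theta> - 2) * (\<theta> + 2) * f 2 = 0"
    proof -
      have "\<theta> * (\<theta> - 2) * (\<theta> + 2) * f 2 = \<theta> * (\<theta> * (\<theta> * f 2) - 2 * f 2) - 2 * (\<theta> * f 2)"
        by (simp add: algebra_simps)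
      also have "\<dots> = \<theta> * (\<theta> * f 1 - 2 * f 2) - 2 * f 1" by (simp only: e(3))
      also have "\<dots> = \<theta> * f 0 - 2 * f 1" by (simp only: e(2)[symmetric] add_diff_cancel_right')
      finally show ?thesis using e(1) by simp
    qed
    ultimately have "\<theta> = 0 \<or> \<theta> - 2 = 0 \<or> \<theta> + 2 = 0" by auto
    then show "\<theta> \<in> {2, 0, -2}" by (auto simp: eq_neg_iff_add_eq_0)
  next
    assume "\<theta> \<in> {2, 0, -2}"
    then consider "\<theta> = 2" | "\<theta> = 0" | "\<theta> = -2" by blast
    then show "\<exists>f. ?P f"
    proof cases
      case 1 then show ?thesis by (intro exI[of _ "(!) [2, 2, 1]"]) simp
    next
      case 2 then show ?thesis by (intro exI[of _ "(!) [2, 0, -1]"]) simp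
    next
      case 3 then show ?thesis by (intro exI[of _ "(!) [2, -2, 1]"]) simp
    qed
  qed
  then show ?thesis
    by (simp add: eigenvalue_square_matrix_iff all_less_3 ex_less_3 sum_3 set_eq_iff numeral_3_eq_3[symmetric])
qed

lemma eigenvalues_IV: "{\<theta>::complex. eigenvalue (square_matrix [[0]]) \<theta>} = {0}"
proof -
  have "(\<exists>f. f 0 \<noteq> 0 \<and> \<theta> * f (0 :: nat) = 0) \<longleftrightarrow> \<theta> = 0" for \<theta> :: complex
    by (auto intro: exI[of _ "\<lambda>_. 1"])
  then show ?thesis by (simp add: eigenvalue_square_matrix_iff set_eq_iff)
qed

lemma eigenvalues_V:
  "{\<theta>::complex. eigenvalue (square_matrix [[0, 4],
                                [1, 0]]) \<theta>} = {2, -2}"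
proof -
  have "(\<exists>f. (f 0 \<noteq> 0 \<or> f 1 \<noteq> 0) \<and> 4 * f 1 = \<theta> * f 0 \<and> f 0 = \<theta> * f (1 :: nat)) \<longleftrightarrow> \<theta> \<in> {2, -2}"
    (is "(\<exists>f. ?P f) \<longleftrightarrow> _") for \<theta> :: complex
  proof
    assume "\<exists>f. ?P f"
    then obtain f where f: "f 0 \<noteq> 0 \<or> f 1 \<noteq> 0" and e: "4 * f 1 = \<theta> * f 0" "f 0 = \<theta> * f (1 :: nat)" by blast
    have "f 1 \<noteq> 0" using f e(2) by auto
    moreover have "(\<theta> - 2) * (\<theta> + 2) * f 1 = \<theta> * (\<theta> * f 1) - 4 * f 1" by (simp add: algebra_simps)
    then have "(\<theta> - 2) * (\<theta> + 2) * f 1 = 0" using e by simp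
    ultimately have "\<theta> - 2 = 0 \<or> \<theta> + 2 = 0" by auto
    then show "\<theta> \<in> {2, -2}" by (auto simp: eq_neg_iff_add_eq_0)
  next
    assume "\<theta> \<in> {2, -2}"
    then show "\<exists>f. ?P f" by (intro exI[of _ "(!) [\<theta>, 1]"]) auto
  qed
  moreover have "(\<forall>i<Suc (Suc 0). P i) \<longleftrightarrow> P 0 \<and> P 1" "(\<exists>i<Suc (Suc 0). P i) \<longleftrightarrow> P 0 \<or> P 1" for P
    by (auto simp: less_Suc_eq)
  ultimately show ?thesis
    by (simp add: eigenvalue_square_matrix_iff set_eq_iff)
qed

section \<open>Module data and seed coordinates of the thirteen summands\<close>

context labelled_tutte_graph
begin

lemma card_type:
  "card {l. summand_type l = t} = length (filter (\<lambda>l. summand_type l = t) summands)"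
proof -
  have "{l. summand_type l = t} = set (filter (\<lambda>l. summand_type l = t) summands)"
    using UNIV_summand by auto
  moreover have "distinct (filter (\<lambda>l. summand_type l = t) summands)" by (simp add: summands_def)
  ultimately show ?thesis by (simp only: distinct_card)
qed

text \<open>Ladder theory supplies everything except the representing matrix; the multiplicity is
  the number of labels of the same type.\<close>

lemma module_data_bk:
  assumes "representing_matrix A bs B"
    and "bs = map (bk k) [type_lo (summand_type k)..<type_hi (summand_type k) + 1]"
  shows "module_data adj x (ladder_space (bk k)) (type_lo (summand_type k))
    (length (filter (\<lambda>l. summand_type l = summand_type k) summands))
    (type_hi (summand_type k) + 1 - type_lo (summand_type k))
    (type_hi (summand_type k) - type_lo (summand_type k))
    (replicate (type_hi (summand_type k) - type_lo (summand_type k) + 1) 1) bs B"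
  unfolding module_data_def assms(2)
  using assms ladder_endpoint[OF ladder_bk] multiplicity_b ladder_space_dim[OF ladder_bk]
    ladder_diameter[OF ladder_bk] ladder_shape[OF ladder_bk] ladder_pure_basis[OF ladder_bk]
  by (simp only: card_type[symmetric] simp_thms)

lemmas adj_bk = ladder_adj[OF ladder_bk]

lemma bk_5: "bk k 5 = 0" using bk_0[of 5 k] type_hi_le[of "summand_type k"] by simp

lemma sphere_vector_bk: "i < 5 \<Longrightarrow> bk W0 i = sphere_vector adj x i"
proof (rule vec_eqI_vs)
  fix j :: nat assume "i < 5" "j < 30"
  moreover have "length levels = 30" by (simp add: levels_def)
  ultimately show "bk W0 i $ (vs ! j) = sphere_vector adj x i $ (vs ! j)"
    by (simp add: bk_vs blist.simps sphere_vector_def d_vs)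
qed

lemma data_I:
  "module_data adj x (ladder_space (bk W0)) 0 1 5 4 [1, 1, 1, 1, 1]
     (map (sphere_vector adj x) [0, 1, 2, 3, 4])
     (square_matrix [[0, 3, 0, 0, 0],
                     [1, 0, 2, 0, 0],
                     [0, 1, 0, 2, 0],
                     [0, 0, 1, 0, 2],
                     [0, 0, 0, 3, 0]])"
proof -
  have bs: "map (sphere_vector adj x) [0, 1, 2, 3, 4] = map (bk W0) [0..<4 + 1]"
  proof -
    have "[0..<4 + 1] = [0, 1, 2, 3, 4::nat]" by code_simp
    then show ?thesis by (simp only: list.map sphere_vector_bk[symmetric])
  qed
  have "representing_matrix A (map (bk W0) [0, 1, 2, 3, 4])
     (square_matrix [[0, 3, 0, 0, 0], [1, 0, 2, 0, 0], [0, 1, 0, 2, 0], [0, 0, 1, 0, 2], [0, 0, 0, 3, 0]])"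
    using square_matrix_carrier[of "[[0, 3, 0, 0, 0], [1, 0, 2, 0, 0], [0, 1, 0, 2, 0], [0, 0, 1, 0, 2], [0, 0, 0, 3, 0 :: complex]]"]
    by (simp add: representing_matrix_def all_less_5 sum_5 square_matrix_index adj_bk bk_5 add.commute Suc_5
        numeral_2_eq_2[symmetric] numeral_3_eq_3[symmetric])
  then have "representing_matrix A (map (sphere_vector adj x) [0, 1, 2, 3, 4])
     (square_matrix [[0, 3, 0, 0, 0], [1, 0, 2, 0, 0], [0, 1, 0, 2, 0], [0, 0, 1, 0, 2], [0, 0, 0, 3, 0]])"
    by (simp add: sphere_vector_bk)
  from module_data_bk[OF this, of W0] bs show ?thesis
    by (simp add: summands_def eval_nat_numeral)
qed

text \<open>With upward coefficients 1, the listed vectors are literally the rungs of the ladder;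
  the projection to level 3 removes the downward term of the second application.\<close>

lemma data_II:
  assumes k: "summand_type k = TypeII"
  shows "A *v bk k 1 = E 2 *v (A *v bk k 1)"
    and "module_data adj x (ladder_space (bk k)) 1 2 3 2 [1, 1, 1]
      [bk k 1, A *v bk k 1,
       E 3 *v (A *v (A *v bk k 1))]
      (square_matrix [[0, 2, 0], [1, 0, 2], [0, 1, 0]])"
proof -
  have z: "bk k 4 = 0" using bk_0[of 4 k] k by simp
  have 1: "A *v bk k 1 = bk k 2"
    and 2: "A *v bk k 2 = bk k 3 + 2 *s bk k 1"
    and 3: "A *v bk k 3 = 2 *s bk k 2"
    using k z by (simp_all add: adj_bk numeral_2_eq_2[symmetric])
  have d: "E 3 *v (bk k 3 + 2 *s bk k 1) = bk k 3"
    by (simp add: matrix_vector_right_distrib vec.scale ladder_dual[OF ladder_bk])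
  show "A *v bk k 1 = E 2 *v (A *v bk k 1)"
    unfolding 1 by (simp add: ladder_dual[OF ladder_bk])
  have "representing_matrix A [bk k 1, bk k 2, bk k 3] (square_matrix [[0, 2, 0], [1, 0, 2], [0, 1, 0]])"
    using square_matrix_carrier[of "[[0, 2, 0], [1, 0, 2], [0, 1, 0 :: complex]]"] 1 2 3
    by (simp add: representing_matrix_def all_less_3 sum_3 square_matrix_index numeral_3_eq_3[symmetric] add.commute)
  from module_data_bk[OF this, of k] k
  show "module_data adj x (ladder_space (bk k)) 1 2 3 2 [1, 1, 1]
      [bk k 1, A *v bk k 1,
       E 3 *v (A *v (A *v bk k 1))]
      (square_matrix [[0, 2, 0], [1, 0, 2], [0, 1, 0]])"
    unfolding 1 2 d by (simp add: summands_def eval_nat_numeral)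
qed

lemma data_III:
  assumes k: "summand_type k = TypeIII"
  shows "A *v bk k 2 = E 3 *v (A *v bk k 2)"
    and "module_data adj x (ladder_space (bk k)) 2 3 3 2 [1, 1, 1]
      [bk k 2, A *v bk k 2,
       E 4 *v (A *v (A *v bk k 2))]
      (square_matrix [[0, 2, 0], [1, 0, 2], [0, 1, 0]])"
proof -
  have 1: "A *v bk k 2 = bk k 3"
    and 2: "A *v bk k 3 = bk k 4 + 2 *s bk k 2"
    and 3: "A *v bk k 4 = 2 *s bk k 3"
    using k bk_5[of k] by (simp_all add: adj_bk)
  have d: "E 4 *v (bk k 4 + 2 *s bk k 2) = bk k 4"
    by (simp add: matrix_vector_right_distrib vec.scale ladder_dual[OF ladder_bk])
  show "A *v bk k 2 = E 3 *v (A *v bk k 2)"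
    unfolding 1 by (simp add: ladder_dual[OF ladder_bk])
  have "representing_matrix A [bk k 2, bk k 3, bk k 4] (square_matrix [[0, 2, 0], [1, 0, 2], [0, 1, 0]])"
    using square_matrix_carrier[of "[[0, 2, 0], [1, 0, 2], [0, 1, 0 :: complex]]"] 1 2 3
    by (simp add: representing_matrix_def all_less_3 sum_3 square_matrix_index numeral_3_eq_3[symmetric] add.commute)
  from module_data_bk[OF this, of k] k
  show "module_data adj x (ladder_space (bk k)) 2 3 3 2 [1, 1, 1]
      [bk k 2, A *v bk k 2,
       E 4 *v (A *v (A *v bk k 2))]
      (square_matrix [[0, 2, 0], [1, 0, 2], [0, 1, 0]])"
    unfolding 1 2 d by (simp add: summands_def eval_nat_numeral)
qed

lemma data_IV:
  assumes k: "summand_type k = TypeIV"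
  shows "module_data adj x (ladder_space (bk k)) 3 3 1 0 [1] [bk k 3] (square_matrix [[0]])"
proof -
  have "A *v bk k 3 = 0" using k bk_0[of 4 k] by (simp add: adj_bk)
  then have "representing_matrix A [bk k 3] (square_matrix [[0]])"
    using square_matrix_carrier[of "[[0 :: complex]]"] by (simp add: representing_matrix_def square_matrix_index)
  from module_data_bk[OF this, of k] k show ?thesis
    by (simp add: summands_def eval_nat_numeral)
qed

lemma data_V:
  assumes k: "summand_type k = TypeV"
  shows "A *v bk k 3 = E 4 *v (A *v bk k 3)"
    and "module_data adj x (ladder_space (bk k)) 3 3 2 1 [1, 1] [bk k 3, A *v bk k 3]
      (square_matrix [[0, 4], [1, 0]])"
proof -
  have 1: "A *v bk k 3 = bk k 4"
    and 2: "A *v bk k 4 = 4 *s bk k 3"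
    using k bk_5[of k] by (simp_all add: adj_bk)
  show "A *v bk k 3 = E 4 *v (A *v bk k 3)"
    unfolding 1 by (simp add: ladder_dual[OF ladder_bk])
  have "representing_matrix A [bk k 3, bk k 4] (square_matrix [[0, 4], [1, 0]])"
    using square_matrix_carrier[of "[[0, 4], [1, 0 :: complex]]"] 1 2
    by (auto simp: representing_matrix_def square_matrix_index less_Suc_eq)
  from module_data_bk[OF this, of k] k
  show "module_data adj x (ladder_space (bk k)) 3 3 2 1 [1, 1] [bk k 3, A *v bk k 3]
      (square_matrix [[0, 4], [1, 0]])"
    unfolding 1 by (simp add: summands_def eval_nat_numeral)
qed

lemma data_VI:
  assumes k: "summand_type k = TypeVI"
  shows "module_data adj x (ladder_space (bk k)) 4 1 1 0 [1] [bk k 4] (square_matrix [[0]])"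
proof -
  have "A *v bk k 4 = 0" using k bk_5[of k] by (simp add: adj_bk)
  then have "representing_matrix A [bk k 4] (square_matrix [[0]])"
    using square_matrix_carrier[of "[[0 :: complex]]"] by (simp add: representing_matrix_def square_matrix_index)
  from module_data_bk[OF this, of k] k show ?thesis
    by (simp add: summands_def eval_nat_numeral)
qed

lemma seed_bk: "seed_vector adj x (ladder_space (bk k)) (bk k (type_lo (summand_type k)))"
  by (rule ladder_seed[OF ladder_bk])

lemma bk_seed:
  assumes "k \<noteq> W0" "i = type_lo (summand_type k)" "j < 30"
  shows "bk k i $ (vs ! j) = of_int (seed s k ! j)"
  using assms type_lo_le_hi[of "summand_type k"] type_hi_le[of "summand_type k"]
  by (simp add: bk_vs blist.simps)

text \<open>The vertices \<open>y j\<close> and \<open>z j\<close> occupy consecutive labels, so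
  their coordinates are a shifted segment of the seed list.\<close>

lemma essential_part_shift:
  assumes "\<forall>j\<in>{1..n}. f j = vs ! (j + m)" "m + n < 30" "k \<noteq> W0" "i = type_lo (summand_type k)"
  shows "essential_part f n (bk k i) = map of_int (map (\<lambda>j. seed s k ! (j + m)) [1..<n + 1])"
  using assms by (auto simp: essential_part_def bk_seed)

lemma essential_III:
  assumes "\<forall>j\<in>{1..6}. y j = vs ! (j + 3)"
  shows "essential_part y 6 (bk W2a 2) = [1, -1, 0, 0, 0, 0]"
    "essential_part y 6 (bk W2b 2) = [0, 0, 1, -1, 0, 0]"
    "essential_part y 6 (bk W2c 2) = [0, 0, 0, 0, 1, -1]"
proof -
  have "map (\<lambda>j. seed s W2a ! (j + 3)) [1..<6 + 1] = [1, -1, 0, 0, 0, 0]"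
    "map (\<lambda>j. seed s W2b ! (j + 3)) [1..<6 + 1] = [0, 0, 1, -1, 0, 0]"
    "map (\<lambda>j. seed s W2c ! (j + 3)) [1..<6 + 1] = [0, 0, 0, 0, 1, -1]"
    by code_simp+
  then show "essential_part y 6 (bk W2a 2) = [1, -1, 0, 0, 0, 0]"
    "essential_part y 6 (bk W2b 2) = [0, 0, 1, -1, 0, 0]"
    "essential_part y 6 (bk W2c 2) = [0, 0, 0, 0, 1, -1]"
    using essential_part_shift[OF assms, of W2a 2] essential_part_shift[OF assms, of W2b 2]
      essential_part_shift[OF assms, of W2c 2] by simp_all
qed

lemma essential_z:
  assumes z: "\<forall>j\<in>{1..12}. z j = vs ! (j + 9)"
  shows "essential_part z 12 (bk W3a 3) = [2, -2, 0, 0, -1, 1, -1, 1, -1, 1, -1, 1]"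
    "essential_part z 12 (bk W3b 3) = [0, 0, 2, -2, -1, 1, -1, 1, 1, -1, 1, -1]"
    "essential_part z 12 (bk W3c 3) = [0, 0, 0, 0, -1, 1, 1, -1, 1, -1, -1, 1]"
    "essential_part z 12 (bk W3d 3) = [-1, 1, -1, 1, -1, 1, -1, 1, 0, 0, 0, 0]"
    "essential_part z 12 (bk W3e 3) = [-1, 1, 1, -1, -1, 1, 1, -1, -2, 2, 0, 0]"
    "essential_part z 12 (bk W3f 3) = [-1, 1, 1, -1, 1, -1, -1, 1, 0, 0, -2, 2]"
proof -
  have "map (\<lambda>j. seed s W3a ! (j + 9)) [1..<12 + 1] = [2, -2, 0, 0, -1, 1, -1, 1, -1, 1, -1, 1]"
    "map (\<lambda>j. seed s W3b ! (j + 9)) [1..<12 + 1] = [0, 0, 2, -2, -1, 1, -1, 1, 1, -1, 1, -1]"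
    "map (\<lambda>j. seed s W3c ! (j + 9)) [1..<12 + 1] = [0, 0, 0, 0, -1, 1, 1, -1, 1, -1, -1, 1]"
    "map (\<lambda>j. seed s W3d ! (j + 9)) [1..<12 + 1] = [-1, 1, -1, 1, -1, 1, -1, 1, 0, 0, 0, 0]"
    "map (\<lambda>j. seed s W3e ! (j + 9)) [1..<12 + 1] = [-1, 1, 1, -1, -1, 1, 1, -1, -2, 2, 0, 0]"
    "map (\<lambda>j. seed s W3f ! (j + 9)) [1..<12 + 1] = [-1, 1, 1, -1, 1, -1, -1, 1, 0, 0, -2, 2]"
    by code_simp+
  then show "essential_part z 12 (bk W3a 3) = [2, -2, 0, 0, -1, 1, -1, 1, -1, 1, -1, 1]"
    "essential_part z 12 (bk W3b 3) = [0, 0, 2, -2, -1, 1, -1, 1, 1, -1, 1, -1]"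
    "essential_part z 12 (bk W3c 3) = [0, 0, 0, 0, -1, 1, 1, -1, 1, -1, -1, 1]"
    "essential_part z 12 (bk W3d 3) = [-1, 1, -1, 1, -1, 1, -1, 1, 0, 0, 0, 0]"
    "essential_part z 12 (bk W3e 3) = [-1, 1, 1, -1, -1, 1, 1, -1, -2, 2, 0, 0]"
    "essential_part z 12 (bk W3f 3) = [-1, 1, 1, -1, 1, -1, -1, 1, 0, 0, -2, 2]"
    using essential_part_shift[OF z, of W3a 3] essential_part_shift[OF z, of W3b 3]
      essential_part_shift[OF z, of W3c 3] essential_part_shift[OF z, of W3d 3]
      essential_part_shift[OF z, of W3e 3] essential_part_shift[OF z, of W3f 3] by simp_all
qed

text \<open>The seeds of type II were permuted by \<open>s\<close>, and the vertex with label
  \<open>j + 1\<close> is number \<open>s ! j\<close> in the order \<open>u\<close> when counted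
  from 0; the two permutations cancel.\<close>

lemma essential_II:
  assumes u: "\<forall>j<3. u (s ! j + 1) = vs ! (j + 1)"
  shows "essential_part u 3 (bk W1a 1) = [1, -1, 0]" "essential_part u 3 (bk W1b 1) = [1, 1, -2]"
proof -
  have seeds: "\<forall>t\<in>set perms. \<forall>i\<in>set [0, 1, 2]. \<exists>j\<in>set [0, 1, 2]. t ! j = i \<and>
      seed t W1a ! (j + 1) = [1, -1, 0] ! i \<and> seed t W1b ! (j + 1) = [1, 1, -2] ! i"
    by code_simp
  have v: "bk W1a 1 $ u (i + 1) = of_int ([1, -1, 0] ! i) \<and> bk W1b 1 $ u (i + 1) = of_int ([1, 1, -2] ! i)"
    if i: "i \<in> set [0, 1, 2]" for i
  proof -
    obtain j where j: "j \<in> set [0, 1, 2]" "s ! j = i"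
      "seed s W1a ! (j + 1) = [1, -1, 0] ! i" "seed s W1b ! (j + 1) = [1, 1, -2] ! i"
      using bspec[OF bspec[OF seeds s] i] by blast
    then have "j < 3" by auto
    then have "u (i + 1) = vs ! (j + 1)" using u j(2) by blast
    then show ?thesis
      using bk_seed[of W1a 1 "j + 1"] bk_seed[of W1b 1 "j + 1"] j(3,4) \<open>j < 3\<close> by simp
  qed
  have "[1..<3 + 1] = [0 + 1, 1 + 1, 2 + 1::nat]" by code_simp
  then have e: "essential_part u 3 w = [w $ u (0 + 1), w $ u (1 + 1), w $ u (2 + 1)]" for w
    by (simp only: essential_part_def list.map)
  show "essential_part u 3 (bk W1a 1) = [1, -1, 0]" "essential_part u 3 (bk W1b 1) = [1, 1, -2]"
    unfolding e using v[of 0] v[of 1] v[of 2] by simp_all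
qed

text \<open>The seed is 1 on the labels of the first class and -1 on those of the second, so the
  unknown order inside a class does not change the listed signs.\<close>

lemma essential_VI:
  assumes w: "\<forall>k\<in>{1, 4, 5, 8}. \<exists>j\<in>{22, 23, 24, 25}. w k = vs ! j"
    "\<forall>k\<in>{2, 3, 6, 7}. \<exists>j\<in>{26, 27, 28, 29}. w k = vs ! j"
  shows "essential_part w 8 (bk W4 4) = [1, -1, -1, 1, 1, -1, -1, 1]"
proof -
  have seeds: "\<forall>j\<in>set [22, 23, 24, 25]. seed s W4 ! j = 1" "\<forall>j\<in>set [26, 27, 28, 29]. seed s W4 ! j = -1"
    by code_simp+
  have "bk W4 4 $ w k = 1" if "k \<in> {1, 4, 5, 8}" for k
  proof -
    from bspec[OF w(1) that] obtain j where "j \<in> {22, 23, 24, 25}" "w k = vs ! j" by (rule bexE)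
    then have j: "j \<in> set [22, 23, 24, 25]" "w k = vs ! j" by simp_all
    then have "j < 30" by auto
    then show ?thesis using bk_seed[of W4 4 j] bspec[OF seeds(1) j(1)] j(2) by simp
  qed
  moreover have "bk W4 4 $ w k = -1" if "k \<in> {2, 3, 6, 7}" for k
  proof -
    from bspec[OF w(2) that] obtain j where "j \<in> {26, 27, 28, 29}" "w k = vs ! j" by (rule bexE)
    then have j: "j \<in> set [26, 27, 28, 29]" "w k = vs ! j" by simp_all
    then have "j < 30" by auto
    then show ?thesis using bk_seed[of W4 4 j] bspec[OF seeds(2) j(1)] j(2) by simp
  qed
  moreover have "[1..<8 + 1] = [1, 2, 3, 4, 5, 6, 7, 8::nat]" by code_simp
  ultimately show ?thesis by (simp add: essential_part_def)
qed

end

section \<open>Passage from the labelled graph to an arbitrary ordering of the spheres\<close>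

theorem mainTheorem8:
  fixes adj :: "'v::finite \<Rightarrow> 'v \<Rightarrow> bool" and x :: 'v
  defines "A \<equiv> adj_matrix adj"
    and "E \<equiv> dual_idempotent adj x"
    and "T \<equiv> terwilliger_algebra adj x"
  assumes drg: "distance_regular adj"
    and card_X: "CARD('v) = 30"
    and arr: "intersection_array adj = ([3, 2, 2, 2], [1, 1, 1, 3])"
  shows
    "{\<theta>. eigenspace A \<theta> \<noteq> {0}} = {3, 2, 0, -2, -3} \<and>
     vec.dim (eigenspace A 3) = 1 \<and> vec.dim (eigenspace A 2) = 9 \<and>
     vec.dim (eigenspace A 0) = 10 \<and> vec.dim (eigenspace A (-2)) = 9 \<and>
     vec.dim (eigenspace A (-3)) = 1 \<and>
     cmat.dim T = 5^2 + 3^2 + 3^2 + 1^2 + 2^2 + 1^2 \<and> cmat.dim T = 49 \<and>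
     (\<exists>u y z w. tutte_ordering adj x u y z w) \<and>
     (\<forall>u y z w. tutte_ordering adj x u y z w \<longrightarrow>
        (\<exists>(W :: summand \<Rightarrow> (complex ^ 'v) set) (\<nu> :: summand \<Rightarrow> complex ^ 'v).
           orthogonal_direct_sum UNIV W \<and>
           (\<forall>k. irreducible_module T (W k)) \<and>
           (\<forall>k l. module_isomorphic T (W k) (W l) \<longleftrightarrow> summand_type k = summand_type l) \<and>
           (\<forall>k. k \<noteq> W0 \<longrightarrow> seed_vector adj x (W k) (\<nu> k)) \<and>

           module_data adj x (W W0) 0 1 5 4 [1, 1, 1, 1, 1]
             (map (sphere_vector adj x) [0, 1, 2, 3, 4])
             (square_matrix [[0, 3, 0, 0, 0],
                             [1, 0, 2, 0, 0],
                             [0, 1, 0, 2, 0],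
                             [0, 0, 1, 0, 2],
                             [0, 0, 0, 3, 0]]) \<and>
           {\<theta>. eigenvalue (square_matrix [[0, 3, 0, 0, 0],
                                          [1, 0, 2, 0, 0],
                                          [0, 1, 0, 2, 0],
                                          [0, 0, 1, 0, 2],
                                          [0, 0, 0, 3, 0]]) \<theta>} = {3, 2, 0, -2, -3} \<and>

           (\<forall>k \<in> {W1a, W1b}.
              A *v \<nu> k = E 2 *v (A *v \<nu> k) \<and>
              module_data adj x (W k) 1 2 3 2 [1, 1, 1]
                [\<nu> k, A *v \<nu> k, E 3 *v (A *v (A *v \<nu> k))]
                (square_matrix [[0, 2, 0],
                                [1, 0, 2],
                                [0, 1, 0]])) \<and>
           {\<theta>. eigenvalue (square_matrix [[0, 2, 0],
                                          [1, 0, 2],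
                                          [0, 1, 0]]) \<theta>} = {2, 0, -2} \<and>
           essential_part u 3 (\<nu> W1a) = [1, -1, 0] \<and>
           essential_part u 3 (\<nu> W1b) = [1, 1, -2] \<and>

           (\<forall>k \<in> {W2a, W2b, W2c}.
              A *v \<nu> k = E 3 *v (A *v \<nu> k) \<and>
              module_data adj x (W k) 2 3 3 2 [1, 1, 1]
                [\<nu> k, A *v \<nu> k, E 4 *v (A *v (A *v \<nu> k))]
                (square_matrix [[0, 2, 0],
                                [1, 0, 2],
                                [0, 1, 0]])) \<and>
           essential_part y 6 (\<nu> W2a) = [1, -1, 0, 0, 0, 0] \<and>
           essential_part y 6 (\<nu> W2b) = [0, 0, 1, -1, 0, 0] \<and>
           essential_part y 6 (\<nu> W2c) = [0, 0, 0, 0, 1, -1] \<and>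

           (\<forall>k \<in> {W3a, W3b, W3c}.
              module_data adj x (W k) 3 3 1 0 [1] [\<nu> k] (square_matrix [[0]])) \<and>
           {\<theta>. eigenvalue (square_matrix [[0]]) \<theta>} = {0} \<and>
           essential_part z 12 (\<nu> W3a) = [2, -2, 0, 0, -1, 1, -1, 1, -1, 1, -1, 1] \<and>
           essential_part z 12 (\<nu> W3b) = [0, 0, 2, -2, -1, 1, -1, 1, 1, -1, 1, -1] \<and>
           essential_part z 12 (\<nu> W3c) = [0, 0, 0, 0, -1, 1, 1, -1, 1, -1, -1, 1] \<and>

           (\<forall>k \<in> {W3d, W3e, W3f}.
              A *v \<nu> k = E 4 *v (A *v \<nu> k) \<and>
              module_data adj x (W k) 3 3 2 1 [1, 1] [\<nu> k, A *v \<nu> k]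
                (square_matrix [[0, 4],
                                [1, 0]])) \<and>
           {\<theta>. eigenvalue (square_matrix [[0, 4],
                                          [1, 0]]) \<theta>} = {2, -2} \<and>
           essential_part z 12 (\<nu> W3d) = [-1, 1, -1, 1, -1, 1, -1, 1, 0, 0, 0, 0] \<and>
           essential_part z 12 (\<nu> W3e) = [-1, 1, 1, -1, -1, 1, 1, -1, -2, 2, 0, 0] \<and>
           essential_part z 12 (\<nu> W3f) = [-1, 1, 1, -1, 1, -1, -1, 1, 0, 0, -2, 2] \<and>

           module_data adj x (W W4) 4 1 1 0 [1] [\<nu> W4] (square_matrix [[0]]) \<and>
           essential_part w 8 (\<nu> W4) = [1, -1, -1, 1, 1, -1, -1, 1]))"
proof -
  interpret R: rooted_tutte_graph adj x by unfold_locales (rule drg, rule arr)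
  have labelled: "labelled_tutte_graph adj x vs s" if "R.labelling vs" "s \<in> set perms" for vs s
    by unfold_locales (rule that)+
  \<comment> \<open>The spectrum and the dimension of \<open>T\<close> do not mention an ordering,
    so the labelling obtained from any one ordering serves for them.\<close>
  obtain u y z w where "tutte_ordering adj x u y z w" using R.ordering_exists by blast
  from R.labelling_exists[OF card_X this] obtain vs0 s0 where "labelled_tutte_graph adj x vs0 s0"
    by (elim exE conjE) (rule that[OF labelled])
  then interpret L0: labelled_tutte_graph adj x vs0 s0 .
  have T49: "cmat.dim T = 49" unfolding T_def by (rule L0.dim_T_49)
  show ?thesis
  proof (intro conjI allI impI, goal_cases)
    case 1 show ?case unfolding A_def by (rule L0.eigenvalues_adj)
  next
    case 2 show ?case unfolding A_def by (rule L0.eigenspace_dims)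
  next
    case 3 show ?case unfolding A_def by (rule L0.eigenspace_dims)
  next
    case 4 show ?case unfolding A_def by (rule L0.eigenspace_dims)
  next
    case 5 show ?case unfolding A_def by (rule L0.eigenspace_dims)
  next
    case 6 show ?case unfolding A_def by (rule L0.eigenspace_dims)
  next
    case 7 show ?case using T49 by simp
  next
    case 8 show ?case by (rule T49)
  next
    case 9 show ?case by (rule R.ordering_exists)
  next
    case (10 u y z w)
    from R.labelling_exists[OF card_X 10] obtain vs s where
      lab: "R.labelling vs" "s \<in> set perms" and u: "\<forall>j<3. u (s ! j + 1) = vs ! (j + 1)"
      and y: "\<forall>j\<in>{1..6}. y j = vs ! (j + 3)" and z: "\<forall>j\<in>{1..12}. z j = vs ! (j + 9)"
      and w: "\<forall>k\<in>{1, 4, 5, 8}. \<exists>j\<in>{22, 23, 24, 25}. w k = vs ! j"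
        "\<forall>k\<in>{2, 3, 6, 7}. \<exists>j\<in>{26, 27, 28, 29}. w k = vs ! j"
      by (elim exE conjE)
    \<comment> \<open>A second labelling, obtained from the given ordering: the seeds and their
      coordinates depend on it.\<close>
    interpret L: labelled_tutte_graph adj x vs s by (rule labelled[OF lab])
    note defs = A_def E_def T_def
    show ?case
    proof (rule exI[of _ "\<lambda>k. ladder_space (L.bk k)"], rule exI[of _ "\<lambda>k. L.bk k (type_lo (summand_type k))"],
        intro conjI allI impI ballI)
      show "orthogonal_direct_sum UNIV (\<lambda>k. ladder_space (L.bk k))" by (rule L.orthogonal_direct_sum_b)
      show "irreducible_module T (ladder_space (L.bk k))" for k
        unfolding defs by (rule ladder_irreducible[OF L.ladder_bk])
      show "module_isomorphic T (ladder_space (L.bk k)) (ladder_space (L.bk l)) \<longleftrightarrow> summand_type k = summand_type l" for k l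
        unfolding defs by (rule L.ladder_b_isomorphic_iff)
      show "seed_vector adj x (ladder_space (L.bk k)) (L.bk k (type_lo (summand_type k)))" for k
        by (rule L.seed_bk)
    next
      fix k assume "k \<in> {W1a, W1b}"
      then have k: "summand_type k = TypeII" by auto
      show "A *v L.bk k (type_lo (summand_type k)) = E 2 *v (A *v L.bk k (type_lo (summand_type k)))"
        unfolding k type_lo.simps defs by (rule L.data_II(1)[OF k])
      show "module_data adj x (ladder_space (L.bk k)) 1 2 3 2 [1, 1, 1]
         [L.bk k (type_lo (summand_type k)), A *v L.bk k (type_lo (summand_type k)),
          E 3 *v (A *v (A *v L.bk k (type_lo (summand_type k))))]
         (square_matrix [[0, 2, 0], [1, 0, 2], [0, 1, 0]])"
        unfolding k type_lo.simps defs by (rule L.data_II(2)[OF k])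
    next
      fix k assume "k \<in> {W2a, W2b, W2c}"
      then have k: "summand_type k = TypeIII" by auto
      show "A *v L.bk k (type_lo (summand_type k)) = E 3 *v (A *v L.bk k (type_lo (summand_type k)))"
        unfolding k type_lo.simps defs by (rule L.data_III(1)[OF k])
      show "module_data adj x (ladder_space (L.bk k)) 2 3 3 2 [1, 1, 1]
         [L.bk k (type_lo (summand_type k)), A *v L.bk k (type_lo (summand_type k)),
          E 4 *v (A *v (A *v L.bk k (type_lo (summand_type k))))]
         (square_matrix [[0, 2, 0], [1, 0, 2], [0, 1, 0]])"
        unfolding k type_lo.simps defs by (rule L.data_III(2)[OF k])
    next
      fix k assume "k \<in> {W3a, W3b, W3c}"
      then have k: "summand_type k = TypeIV" by auto
      show "module_data adj x (ladder_space (L.bk k)) 3 3 1 0 [1]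
         [L.bk k (type_lo (summand_type k))] (square_matrix [[0]])"
        unfolding k type_lo.simps by (rule L.data_IV[OF k])
    next
      fix k assume "k \<in> {W3d, W3e, W3f}"
      then have k: "summand_type k = TypeV" by auto
      show "A *v L.bk k (type_lo (summand_type k)) = E 4 *v (A *v L.bk k (type_lo (summand_type k)))"
        unfolding k type_lo.simps defs by (rule L.data_V(1)[OF k])
      show "module_data adj x (ladder_space (L.bk k)) 3 3 2 1 [1, 1]
         [L.bk k (type_lo (summand_type k)), A *v L.bk k (type_lo (summand_type k))]
         (square_matrix [[0, 4], [1, 0]])"
        unfolding k type_lo.simps defs by (rule L.data_V(2)[OF k])
    next
      show "module_data adj x (ladder_space (L.bk W4)) 4 1 1 0 [1]
         [L.bk W4 (type_lo (summand_type W4))] (square_matrix [[0]])"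
        unfolding summand_type.simps type_lo.simps by (rule L.data_VI) simp
    qed (unfold summand_type.simps type_lo.simps,
        (rule L.data_I eigenvalues_I eigenvalues_II eigenvalues_IV eigenvalues_V
          L.essential_II[OF u] L.essential_III[OF y] L.essential_z[OF z] L.essential_VI[OF w])+)
  qed
qed

end
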